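(* Let $1\le k\le K$. If $$\alpha_k:=\sup_{v_h\in E_h(k)\setminus\{0\}}\frac{\|v_h-\mathcal{A}v_h\|_{L^2(\Omega)}}{a_{\mathrm{pw}}(v_h,v_h)^{1/2}}<\lambda_{h(k)}^{-1/2},$$ then $\mu_k$ exists (i.e. $\dim\mathcal{A}E_h(K)\ge k$) and satisfies $\mu_k\ge\lambda_k$.
   Context: Let $\Omega\subset\mathbb{R}^n$, $n\ge2$, be a polyhedral bounded Lipschitz domain and $V\in L^\infty(\Omega)$ with $\operatorname{ess\,inf}_\Omega V=0$. Write $a(v,w):=\int_\Omega\nabla v\cdot\nabla w\,dx$, $b(v,w):=\int_\Omega vw\,dx$, $(v,w)_V:=\int_\Omega V v w\,dx$. The exact eigenvalues $0<\lambda_1\le\lambda_2\le\dots$ (counted with multiplicity) are those of: find $(\lambda,u)\in\mathbb{R}_+\times H_0^1(\Omega)$, $u\ne0$, with $a(u,v)+(u,v)_V=\lambda b(u,v)$ for all $v\in H^1_0(\Omega)$. $\mathcal{T}$ is a regular (face-to-face) triangulation of $\Omega$ into non-degenerate compact $n$-simplices, $\mathcal F$ the set of all faces, $\mathcal V(T)$ the set of vertices of $T$, $\operatorname{mid}(\cdot)$ denotes the barycenter. The jump $[v]_F$ is the difference of the traces from the two adjacent simplices if $F$ is interior and the trace $v|_F$ if $F\subset\partial\Omega$. $P_m(\mathcal T)$ is the space of piecewise polynomials of total degree at most $m$ and $\Pi_0$ the $L^2$ projection onto $P_0(\mathcal T)$. Set $\mathrm{CR}_0^1(\mathcal T):=\{v\in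 P_1(\mathcal T): [v]_F(\operatorname{mid}(F))=0\ \forall F\in\mathcal F\}$ and $\mathrm{eCR}_0^1(\mathcal T):=\mathrm{CR}_0^1(\mathcal T)\oplus B(\mathcal T)$ with $B(\mathcal T)$ the span of the bubbles $\flat_T(x):=\frac{n+2}{2}-\frac{n(n+1)^2(n+2)}{\sum_{P\ne Q\in\mathcal V(T)}|P-Q|^2}|x-\operatorname{mid}(T)|^2$ on $T$ (sum over ordered pairs), extended by zero outside $T$, for $T\in\mathcal T$. Let $a_{\mathrm{pw}}(v,w):=\sum_{T\in\mathcal T}\int_T\nabla v\cdot\nabla w\,dx$, which is a scalar product on $\mathrm{eCR}_0^1(\mathcal T)$. Nonconforming scheme: $(\mathbb{V}_h,P,Q)$ is one of $(\mathrm{CR}_0^1(\mathcal T),\mathrm{id},\mathrm{id})$, $(\mathrm{eCR}_0^1(\mathcal T),\mathrm{id},\mathrm{id})$, $(\mathrm{eCR}_0^1(\mathcal T),\Pi_0,\mathrm{id})$, $(\mathrm{eCR}_0^1(\mathcal T),\Pi_0,\Pi_0)$, and the discrete eigenvalue problem is: find $(\lambda_h,u_h)\in\mathbb{R}_+\times\mathbb{V}_h$, $\|u_h\|_{L^2(\Omega)}=1$, with $a_{\mathrm{pw}}(u_h,v_h)+(Pu_h,Pv_h)_V=\lambda_hb(Qu_h,Qv_h)$ for all $v_h\in\mathbb{V}_h$. Its finite positive eigenvalues, counted with multiplicity, are $0<\lambda_{h(1)}\le\lambda_{h(2)}\le\dots$. Let $K\in\mathbb N$ be at most the number of finite eigenvalues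 and $u_{h(1)},\dots,u_{h(K)}$ corresponding discrete eigenfunctions, pairwise orthogonal with respect to $b(Q\bullet,Q\bullet)$ (so $L^2$-orthonormal if $Q=\mathrm{id}$). For $j\le K$ let $E_h(j):=\operatorname{span}\{u_{h(1)},\dots,u_{h(j)}\}$ (of dimension $j$). Averaging: $\mathcal A:\mathbb{V}_h\to S_0^m(\mathcal T):=P_m(\mathcal T)\cap H_0^1(\Omega)$ is a linear operator for some $m\in\mathbb N$, $\mathcal AE_h(K):=\operatorname{span}\{\mathcal Au_{h(1)},\dots,\mathcal Au_{h(K)}\}$, and $$\mu_k:=\min_{\substack{V_c\subseteq\mathcal AE_h(K)\\ \dim V_c=k}}\ \max_{v_c\in V_c\setminus\{0\}}\frac{a(v_c,v_c)+(v_c,v_c)_V}{b(v_c,v_c)},$$ which exists if and only if $\dim\mathcal AE_h(K)\ge k$. *)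

theory Defs
  imports "HOL-Analysis.Analysis" "HOL-Probability.Essential_Supremum"
begin

definition square_integrable :: "('a::euclidean_space \<Rightarrow> real) \<Rightarrow> bool" where
  "square_integrable f \<longleftrightarrow>
     f \<in> borel_measurable lebesgue \<and> integrable lebesgue (\<lambda>x. (f x)\<^sup>2)"

lemma square_integrable_0: "square_integrable (\<lambda>_. 0)"
  by (simp add: square_integrable_def)

lemma square_integrable_scale:
  "square_integrable f \<Longrightarrow> square_integrable (\<lambda>x. c * f x)"
  by (auto simp: square_integrable_def power_mult_distrib intro!: borel_measurable_times)

lemma square_integrable_mult:
  assumes "square_integrable f" "square_integrable g"
  shows "integrable lebesgue (\<lambda>x. f x * g x)"
proof (rule Bochner_Integration.integrable_bound)
  show "integrable lebesgue (\<lambda>x. (f x)\<^sup>2 + (g x)\<^sup>2)"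
    using assms by (simp add: square_integrable_def)
  show "(\<lambda>x. f x * g x) \<in> borel_measurable lebesgue"
    using assms unfolding square_integrable_def by (intro borel_measurable_times) auto
  have "norm (f x * g x) \<le> norm ((f x)\<^sup>2 + (g x)\<^sup>2)" for x
  proof -
    have "0 \<le> (\<bar>f x\<bar> - \<bar>g x\<bar>)\<^sup>2" by simp
    then have "2 * (\<bar>f x\<bar> * \<bar>g x\<bar>) \<le> (f x)\<^sup>2 + (g x)\<^sup>2"
      by (simp add: power2_diff)
    moreover have "0 \<le> \<bar>f x\<bar> * \<bar>g x\<bar>" by simp
    ultimately have "\<bar>f x\<bar> * \<bar>g x\<bar> \<le> (f x)\<^sup>2 + (g x)\<^sup>2" by linarith
    then show ?thesis by (simp add: abs_mult)
  qed
  then show "AE x in lebesgue. norm (f x * g x) \<le> norm ((f x)\<^sup>2 + (g x)\<^sup>2)" by simp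
qed

lemma square_integrable_add:
  assumes "square_integrable f" "square_integrable g"
  shows "square_integrable (\<lambda>x. f x + g x)"
proof -
  have "integrable lebesgue (\<lambda>x. (f x)\<^sup>2 + (g x)\<^sup>2 + 2 * (f x * g x))"
    using assms square_integrable_mult[OF assms]
    by (intro Bochner_Integration.integrable_add integrable_mult_right)
       (auto simp: square_integrable_def)
  then show ?thesis
    using assms by (auto simp: square_integrable_def power2_sum mult.assoc)
qed

quotient_type (overloaded) 'a L2 = "'a::euclidean_space \<Rightarrow> real" / partial:
  "\<lambda>f g. square_integrable f \<and> square_integrable g \<and> (AE x in lebesgue. f x = g x)"
proof (rule part_equivpI)
  show "\<exists>f::'a \<Rightarrow> real. square_integrable f \<and> square_integrable f \<and> (AE x in lebesgue. f x = f x)"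
    using square_integrable_0 by auto
  show "symp (\<lambda>f g::'a \<Rightarrow> real. square_integrable f \<and> square_integrable g \<and> (AE x in lebesgue. f x = g x))"
    by (auto simp: symp_def)
  show "transp (\<lambda>f g::'a \<Rightarrow> real. square_integrable f \<and> square_integrable g \<and> (AE x in lebesgue. f x = g x))"
    unfolding transp_def by auto
qed

instantiation L2 :: (euclidean_space) real_inner
begin

lift_definition zero_L2 :: "'a L2" is "\<lambda>_. 0"
  by (simp add: square_integrable_0)

lift_definition plus_L2 :: "'a L2 \<Rightarrow> 'a L2 \<Rightarrow> 'a L2" is "\<lambda>f g x. f x + g x"
  by (auto simp: square_integrable_add)

lift_definition scaleR_L2 :: "real \<Rightarrow> 'a L2 \<Rightarrow> 'a L2" is "\<lambda>c f x. c * f x"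
  by (auto simp: square_integrable_scale)

lift_definition uminus_L2 :: "'a L2 \<Rightarrow> 'a L2" is "\<lambda>f x. - f x"
  using square_integrable_scale[of _ "-1"] by auto

definition minus_L2 :: "'a L2 \<Rightarrow> 'a L2 \<Rightarrow> 'a L2" where
  "minus_L2 v w = v + - w"

lift_definition inner_L2 :: "'a L2 \<Rightarrow> 'a L2 \<Rightarrow> real" is
  "\<lambda>f g. LINT x|lebesgue. f x * g x"
proof -
  fix f f' g g' :: "'a \<Rightarrow> real"
  assume a: "square_integrable f \<and> square_integrable f' \<and> (AE x in lebesgue. f x = f' x)"
    "square_integrable g \<and> square_integrable g' \<and> (AE x in lebesgue. g x = g' x)"
  show "(LINT x|lebesgue. f x * g x) = (LINT x|lebesgue. f' x * g' x)"
  proof (rule integral_cong_AE)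
    show "(\<lambda>x. f x * g x) \<in> borel_measurable lebesgue" "(\<lambda>x. f' x * g' x) \<in> borel_measurable lebesgue"
      using a square_integrable_mult by (blast intro: borel_measurable_integrable)+
    show "AE x in lebesgue. f x * g x = f' x * g' x"
      using a by auto
  qed
qed

definition norm_L2 :: "'a L2 \<Rightarrow> real" where
  "norm_L2 v = sqrt (v \<bullet> v)"

definition dist_L2 :: "'a L2 \<Rightarrow> 'a L2 \<Rightarrow> real" where
  "dist_L2 v w = norm (v - w)"

definition sgn_L2 :: "'a L2 \<Rightarrow> 'a L2" where
  "sgn_L2 v = inverse (norm v) *\<^sub>R v"

definition uniformity_L2 :: "('a L2 \<times> 'a L2) filter" where
  "uniformity_L2 = (INF e\<in>{0<..}. principal {(x, y). dist x y < e})"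

definition open_L2 :: "'a L2 set \<Rightarrow> bool" where
  "open_L2 U \<longleftrightarrow> (\<forall>x\<in>U. \<forall>\<^sub>F (x', y) in uniformity. x' = x \<longrightarrow> y \<in> U)"

instance
proof
  fix a b c :: "'a L2" and r s :: real
  show "a + b + c = a + (b + c)"
    by transfer (auto simp: add.assoc square_integrable_add)
  show "a + b = b + a"
    by transfer (auto simp: add.commute square_integrable_add)
  show "0 + a = a"
    by transfer auto
  show "- a + a = 0"
    by transfer (auto simp: square_integrable_0)
  show "a - b = a + - b"
    by (simp add: minus_L2_def)
  show "r *\<^sub>R (a + b) = r *\<^sub>R a + r *\<^sub>R b"
    by transfer (auto simp: distrib_left square_integrable_add square_integrable_scale
        simp flip: distrib_left)
  show "(r + s) *\<^sub>R a = r *\<^sub>R a + s *\<^sub>R a"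
    by transfer (auto simp: distrib_right square_integrable_scale simp flip: distrib_right)
  show "r *\<^sub>R s *\<^sub>R a = (r * s) *\<^sub>R a"
    by transfer (auto simp: mult.assoc square_integrable_scale simp flip: mult.assoc)
  show "1 *\<^sub>R a = a"
    by transfer auto
  show "dist a b = norm (a - b)" by (simp add: dist_L2_def)
  show "sgn a = inverse (norm a) *\<^sub>R a" by (simp add: sgn_L2_def)
  show "uniformity = (INF e\<in>{0<..}. principal {(x::'a L2, y). dist x y < e})"
    by (simp add: uniformity_L2_def)
  show "open U \<longleftrightarrow> (\<forall>x\<in>U. \<forall>\<^sub>F (x', y) in uniformity. x' = x \<longrightarrow> y \<in> U)" for U :: "'a L2 set"
    by (simp add: open_L2_def)
  show "norm a = sqrt (a \<bullet> a)" by (simp add: norm_L2_def)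
  show "a \<bullet> b = b \<bullet> a"
    by transfer (simp add: mult.commute)
  show "(a + b) \<bullet> c = a \<bullet> c + b \<bullet> c"
    by transfer (simp add: distrib_right square_integrable_mult)
  show "r *\<^sub>R a \<bullet> b = r * (a \<bullet> b)"
    by transfer (simp add: mult.assoc)
  show "0 \<le> a \<bullet> a"
    by transfer simp
  show "a \<bullet> a = 0 \<longleftrightarrow> a = 0"
  proof (transfer, goal_cases)
    case (1 f)
    then have f: "square_integrable f" by simp
    then have "integrable lebesgue (\<lambda>x. f x * f x)"
      by (rule square_integrable_mult[OF f])
    then have "(LINT x|lebesgue. f x * f x) = 0 \<longleftrightarrow> (AE x in lebesgue. f x * f x = 0)"
      by (intro integral_nonneg_eq_0_iff_AE) auto
    then show ?case using f by (simp add: square_integrable_0)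
  qed
qed

end

text \<open>
  \<^term>\<open>rep_L2\<close> selects a representative; everything below is independent of that choice.
  For a set \<open>\<Omega>\<close> the space \<open>L\<^sup>2(\<Omega>)\<close> is identified, by extension by zero, with
  the functions vanishing almost everywhere outside \<open>\<Omega>\<close>; on it the inner product of
  \<^typ>\<open>'a L2\<close> is \<open>b(v,w)\<close> and its norm is the \<open>L\<^sup>2(\<Omega>)\<close> norm.
\<close>

definition L2_on :: "'a::euclidean_space set \<Rightarrow> 'a L2 set" where
  "L2_on \<Omega> = {v. AE x in lebesgue. x \<notin> \<Omega> \<longrightarrow> rep_L2 v x = 0}"

definition grad :: "(real^'n \<Rightarrow> real) \<Rightarrow> real^'n \<Rightarrow> real^'n" where
  "grad f x = (\<chi> j. frechet_derivative f (at x) (axis j 1))"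

text \<open>\<^term>\<open>times_differentiable k f\<close> says that \<open>f\<close> is of class \<open>C\<^sup>k\<close>.\<close>

primrec times_differentiable :: "nat \<Rightarrow> (real^'n \<Rightarrow> real) \<Rightarrow> bool" where
  "times_differentiable 0 f \<longleftrightarrow> continuous_on UNIV f"
| "times_differentiable (Suc k) f \<longleftrightarrow>
     (\<forall>x. f differentiable (at x)) \<and> (\<forall>j. times_differentiable k (\<lambda>x. grad f x $ j))"

definition test_functions :: "(real^'n) set \<Rightarrow> (real^'n \<Rightarrow> real) set" where
  "test_functions \<Omega> = {\<phi>. (\<forall>k. times_differentiable k \<phi>) \<and>
     compact (closure {x. \<phi> x \<noteq> 0}) \<and> closure {x. \<phi> x \<noteq> 0} \<subseteq> \<Omega>}"

definition is_weak_deriv :: "(real^'n) set \<Rightarrow> 'n \<Rightarrow> (real^'n) L2 \<Rightarrow> (real^'n) L2 \<Rightarrow> bool" where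
  "is_weak_deriv \<Omega> j v g \<longleftrightarrow> g \<in> L2_on \<Omega> \<and>
     (\<forall>\<phi>\<in>test_functions \<Omega>.
        (LINT x:\<Omega>|lebesgue. rep_L2 v x * grad \<phi> x $ j) =
        - (LINT x:\<Omega>|lebesgue. rep_L2 g x * \<phi> x))"

definition weak_deriv :: "(real^'n) set \<Rightarrow> 'n \<Rightarrow> (real^'n) L2 \<Rightarrow> (real^'n) L2" where
  "weak_deriv \<Omega> j v = (THE g. is_weak_deriv \<Omega> j v g)"

definition H1 :: "(real^'n) set \<Rightarrow> (real^'n) L2 set" where
  "H1 \<Omega> = {v \<in> L2_on \<Omega>. \<forall>j. \<exists>g. is_weak_deriv \<Omega> j v g}"

definition H1_norm :: "(real^'n) set \<Rightarrow> (real^'n) L2 \<Rightarrow> real" where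
  "H1_norm \<Omega> v = sqrt ((norm v)\<^sup>2 + (\<Sum>j\<in>UNIV. (norm (weak_deriv \<Omega> j v))\<^sup>2))"

definition H10 :: "(real^'n) set \<Rightarrow> (real^'n) L2 set" where
  "H10 \<Omega> = {v \<in> H1 \<Omega>. \<forall>\<epsilon>>0. \<exists>\<phi>\<in>test_functions \<Omega>. H1_norm \<Omega> (v - abs_L2 \<phi>) < \<epsilon>}"

text \<open>Near every boundary point, a Lipschitz domain lies strictly above the graph of a
  Lipschitz function over the hyperplane orthogonal to some unit vector \<open>e\<close>.\<close>

definition lipschitz_domain :: "(real^'n) set \<Rightarrow> bool" where
  "lipschitz_domain \<Omega> \<longleftrightarrow> open \<Omega> \<and> connected \<Omega> \<and> \<Omega> \<noteq> {} \<and>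
     (\<forall>z\<in>frontier \<Omega>. \<exists>r>0. \<exists>e \<gamma> L. norm e = 1 \<and> L-lipschitz_on {y. y \<bullet> e = 0} \<gamma> \<and>
        \<Omega> \<inter> ball z r = {x \<in> ball z r. \<gamma> (x - (x \<bullet> e) *\<^sub>R e) < x \<bullet> e})"

definition polyhedral :: "(real^'n) set \<Rightarrow> bool" where
  "polyhedral \<Omega> \<longleftrightarrow> (\<exists>\<P>. finite \<P> \<and> (\<forall>P\<in>\<P>. polytope P) \<and> closure \<Omega> = \<Union>\<P>)"

definition Linfty_on :: "(real^'n) set \<Rightarrow> (real^'n \<Rightarrow> real) set" where
  "Linfty_on \<Omega> = {V. V \<in> borel_measurable (lebesgue_on \<Omega>) \<and>
     esssup (lebesgue_on \<Omega>) (\<lambda>x. ereal \<bar>V x\<bar>) < \<infinity>}"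

definition essinf_on :: "(real^'n) set \<Rightarrow> (real^'n \<Rightarrow> real) \<Rightarrow> ereal" where
  "essinf_on \<Omega> V = - esssup (lebesgue_on \<Omega>) (\<lambda>x. ereal (- V x))"

definition a_form :: "(real^'n) set \<Rightarrow> (real^'n) L2 \<Rightarrow> (real^'n) L2 \<Rightarrow> real" where
  "a_form \<Omega> v w = (\<Sum>j\<in>UNIV. weak_deriv \<Omega> j v \<bullet> weak_deriv \<Omega> j w)"

definition V_form ::
  "(real^'n) set \<Rightarrow> (real^'n \<Rightarrow> real) \<Rightarrow> (real^'n) L2 \<Rightarrow> (real^'n) L2 \<Rightarrow> real" where
  "V_form \<Omega> V v w = (LINT x:\<Omega>|lebesgue. V x * rep_L2 v x * rep_L2 w x)"

definition exact_eigenspace ::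
  "(real^'n) set \<Rightarrow> (real^'n \<Rightarrow> real) \<Rightarrow> real \<Rightarrow> (real^'n) L2 set" where
  "exact_eigenspace \<Omega> V t =
     {u \<in> H10 \<Omega>. \<forall>v\<in>H10 \<Omega>. a_form \<Omega> u v + V_form \<Omega> V u v = t * (u \<bullet> v)}"

text \<open>\<open>lam i\<close>, \<open>i \<in> I\<close>, is the nondecreasing enumeration of all positive eigenvalues, each value
  \<open>t\<close> being repeated as often as the dimension of its eigenspace \<open>E t\<close>. In particular all
  eigenspaces of positive \<open>t\<close> are finite-dimensional, and are trivial if \<open>t\<close> is not listed.\<close>

definition enumerates_eigenvalues ::
  "nat set \<Rightarrow> (nat \<Rightarrow> real) \<Rightarrow> (real \<Rightarrow> 'b::real_vector set) \<Rightarrow> bool" where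
  "enumerates_eigenvalues I lam E \<longleftrightarrow> (\<forall>i\<in>I. 0 < lam i) \<and> mono_on I lam \<and>
     (\<forall>t>0. finite {i\<in>I. lam i = t} \<and>
        (\<exists>B. finite B \<and> independent B \<and> span B = E t \<and> card B = card {i\<in>I. lam i = t}))"

definition regular_triangulation :: "(real^'n) set \<Rightarrow> (real^'n) set set \<Rightarrow> bool" where
  "regular_triangulation \<Omega> \<T> \<longleftrightarrow> triangulation \<T> \<and>
     (\<forall>T\<in>\<T>. int CARD('n) simplex T) \<and> \<Union>\<T> = closure \<Omega>"

definition faces :: "(real^'n) set set \<Rightarrow> (real^'n) set set" where
  "faces \<T> = {F. \<exists>T\<in>\<T>. F facet_of T}"

definition vertices :: "(real^'n) set \<Rightarrow> (real^'n) set" where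
  "vertices T = {p. p extreme_point_of T}"

definition barycenter :: "(real^'n) set \<Rightarrow> real^'n" where
  "barycenter T = (\<Sum>p\<in>vertices T. p) /\<^sub>R real (card (vertices T))"

definition polys :: "nat \<Rightarrow> (real^'n \<Rightarrow> real) set" where
  "polys m = {p. \<exists>c. p = (\<lambda>x. \<Sum>\<alpha> | sum \<alpha> UNIV \<le> m. c \<alpha> * (\<Prod>i\<in>UNIV. x $ i ^ \<alpha> i))}"

definition pw_polys :: "(real^'n) set set \<Rightarrow> nat \<Rightarrow> (real^'n) L2 set" where
  "pw_polys \<T> m = {v \<in> L2_on (\<Union>\<T>).
     \<forall>T\<in>\<T>. \<exists>p\<in>polys m. AE x in lebesgue. x \<in> T \<longrightarrow> rep_L2 v x = p x}"

text \<open>The polynomial representing a piecewise polynomial on the simplex \<open>T\<close>. It is unique since \<open>T\<close>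
  has positive measure; its values on the boundary of \<open>T\<close> are the traces from \<open>T\<close>.\<close>

definition piece :: "(real^'n) L2 \<Rightarrow> (real^'n) set \<Rightarrow> real^'n \<Rightarrow> real" where
  "piece v T = (THE p. (\<exists>m. p \<in> polys m) \<and> (AE x in lebesgue. x \<in> T \<longrightarrow> rep_L2 v x = p x))"

text \<open>The orientation of an interior face, i.e. the sign of the jump, is an arbitrary choice.\<close>

definition jump ::
  "(real^'n) set \<Rightarrow> (real^'n) set set \<Rightarrow> (real^'n) L2 \<Rightarrow> (real^'n) set \<Rightarrow> real^'n \<Rightarrow> real" where
  "jump \<Omega> \<T> v F x =
     (if F \<subseteq> frontier \<Omega> then piece v (THE T. T \<in> \<T> \<and> F facet_of T) x
      else let (T1, T2) = (SOME (T1, T2). T1 \<in> \<T> \<and> T2 \<in> \<T> \<and> T1 \<noteq> T2 \<and> F facet_of T1 \<and> F facet_of T2)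
           in piece v T1 x - piece v T2 x)"

definition CR :: "(real^'n) set \<Rightarrow> (real^'n) set set \<Rightarrow> (real^'n) L2 set" where
  "CR \<Omega> \<T> = {v \<in> pw_polys \<T> 1. \<forall>F\<in>faces \<T>. jump \<Omega> \<T> v F (barycenter F) = 0}"

definition bubble :: "(real^'n) set \<Rightarrow> (real^'n) L2" where
  "bubble T = (let n = real CARD('n);
       s = (\<Sum>(p, q)\<in>{(p, q). p \<in> vertices T \<and> q \<in> vertices T \<and> p \<noteq> q}. (norm (p - q))\<^sup>2)
     in abs_L2 (\<lambda>x. if x \<in> T
          then (n + 2) / 2 - n * (n + 1)\<^sup>2 * (n + 2) / s * (norm (x - barycenter T))\<^sup>2
          else 0))"

definition eCR :: "(real^'n) set \<Rightarrow> (real^'n) set set \<Rightarrow> (real^'n) L2 set" where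
  "eCR \<Omega> \<T> = {v + w |v w. v \<in> CR \<Omega> \<T> \<and> w \<in> span (bubble ` \<T>)}"

definition a_pw :: "(real^'n) set set \<Rightarrow> (real^'n) L2 \<Rightarrow> (real^'n) L2 \<Rightarrow> real" where
  "a_pw \<T> v w = (\<Sum>T\<in>\<T>. LINT x:T|lebesgue. grad (piece v T) x \<bullet> grad (piece w T) x)"

definition S0 :: "(real^'n) set \<Rightarrow> (real^'n) set set \<Rightarrow> nat \<Rightarrow> (real^'n) L2 set" where
  "S0 \<Omega> \<T> m = pw_polys \<T> m \<inter> H10 \<Omega>"

definition L2_proj :: "'b::real_inner set \<Rightarrow> 'b \<Rightarrow> 'b" where
  "L2_proj S v = (THE w. w \<in> S \<and> (\<forall>z\<in>S. (v - w) \<bullet> z = 0))"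

definition Pi0 :: "(real^'n) set set \<Rightarrow> (real^'n) L2 \<Rightarrow> (real^'n) L2" where
  "Pi0 \<T> = L2_proj (pw_polys \<T> 0)"

definition schemes :: "(real^'n) set \<Rightarrow> (real^'n) set set \<Rightarrow>
    ((real^'n) L2 set \<times> ((real^'n) L2 \<Rightarrow> (real^'n) L2) \<times> ((real^'n) L2 \<Rightarrow> (real^'n) L2)) set" where
  "schemes \<Omega> \<T> = {(CR \<Omega> \<T>, id, id), (eCR \<Omega> \<T>, id, id), (eCR \<Omega> \<T>, Pi0 \<T>, id), (eCR \<Omega> \<T>, Pi0 \<T>, Pi0 \<T>)}"

definition discrete_eigenspace ::
  "(real^'n) set \<Rightarrow> (real^'n \<Rightarrow> real) \<Rightarrow> (real^'n) set set \<Rightarrow> (real^'n) L2 set \<Rightarrow>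
   ((real^'n) L2 \<Rightarrow> (real^'n) L2) \<Rightarrow> ((real^'n) L2 \<Rightarrow> (real^'n) L2) \<Rightarrow> real \<Rightarrow> (real^'n) L2 set" where
  "discrete_eigenspace \<Omega> V \<T> Vh P Q t =
     {u \<in> Vh. \<forall>v\<in>Vh. a_pw \<T> u v + V_form \<Omega> V (P u) (P v) = t * (Q u \<bullet> Q v)}"

definition is_max_value :: "('b \<Rightarrow> real) \<Rightarrow> 'b set \<Rightarrow> real \<Rightarrow> bool" where
  "is_max_value f X M \<longleftrightarrow> (\<exists>x\<in>X. f x = M) \<and> (\<forall>x\<in>X. f x \<le> M)"

definition is_min_value :: "('b \<Rightarrow> real) \<Rightarrow> 'b set \<Rightarrow> real \<Rightarrow> bool" where
  "is_min_value f X M \<longleftrightarrow> (\<exists>x\<in>X. f x = M) \<and> (\<forall>x\<in>X. M \<le> f x)"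

text \<open>\<open>\<mu>\<close> is the minimum over all \<open>k\<close>-dimensional subspaces \<open>W\<close> of the finite-dimensional space \<open>S\<close>
  of the maximum \<open>g W\<close> of \<open>R\<close> over \<open>W - {0}\<close>, all maxima and the minimum being attained.\<close>

definition is_min_max :: "('b::real_vector \<Rightarrow> real) \<Rightarrow> 'b set \<Rightarrow> nat \<Rightarrow> real \<Rightarrow> bool" where
  "is_min_max R S k \<mu> \<longleftrightarrow> (\<exists>g.
     (\<forall>W. subspace W \<and> W \<subseteq> S \<and> dim W = k \<longrightarrow> is_max_value R (W - {0}) (g W)) \<and>
     is_min_value g {W. subspace W \<and> W \<subseteq> S \<and> dim W = k} \<mu>)"

definition rayleigh :: "(real^'n) set \<Rightarrow> (real^'n \<Rightarrow> real) \<Rightarrow> (real^'n) L2 \<Rightarrow> real" where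
  "rayleigh \<Omega> V v = (a_form \<Omega> v v + V_form \<Omega> V v v) / (v \<bullet> v)"

end

theory Submission
  imports Defs
begin

text \<open>
  For \<open>v = \<Sum> c\<^sub>j u\<^sub>j\<close> in \<open>E\<^sub>h(k)\<close> the discrete eigenvalue equations and the contractivity of \<open>Q\<close> give
  \<open>a\<^sub>p\<^sub>w(v,v) \<le> \<lambda>\<^sub>h\<^sub>(\<^sub>k\<^sub>) \<parallel>v\<parallel>\<^sup>2\<close>. Hence \<open>\<alpha>\<^sub>k < \<lambda>\<^sub>h\<^sub>(\<^sub>k\<^sub>)\<^sup>-\<^sup>1\<^sup>/\<^sup>2\<close> forces \<open>\<parallel>v - A v\<parallel> < \<parallel>v\<parallel>\<close> for \<open>v \<noteq> 0\<close>, so \<open>A\<close> is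
  injective on \<open>E\<^sub>h(k)\<close> and \<open>\<mu>\<^sub>k\<close> exists. This uses that \<open>a\<^sub>p\<^sub>w\<close> is definite: a function with vanishing
  piecewise gradient has no bubble part and is piecewise constant, and the jump conditions propagate
  its value along a generic segment from any simplex to the boundary, where it is \<open>0\<close>.

  Since \<open>A\<close> maps into \<open>H\<^sub>0\<^sup>1(\<Omega>)\<close>, the bound \<open>\<mu>\<^sub>k \<ge> \<lambda>\<^sub>k\<close> is the min-max principle for the exact problem.
  If the Rayleigh quotient were below \<open>\<lambda>\<^sub>k\<close> on a \<open>k\<close>-dimensional subspace, its infimum \<open>\<rho>\<close> on the
  orthogonal complement of the (at most \<open>k - 1\<close>) eigenfunctions with eigenvalues below \<open>\<lambda>\<^sub>k\<close> would be
  less than \<open>\<lambda>\<^sub>k\<close> as well, and a minimizer would be a further eigenfunction. The minimizer exists because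
  \<open>\<parallel>v\<parallel>\<^sup>2 \<le> \<delta> \<parallel>\<nabla>v\<parallel>\<^sup>2 + \<Sum> (v, g\<^sub>c)\<^sup>2\<close> for a finite family \<open>g\<^sub>c\<close> of normalized indicators of grid cells, a
  consequence of \<open>\<parallel>\<phi>(\<sqdot> + h) - \<phi>\<parallel> \<le> |h| \<parallel>\<nabla>\<phi>\<parallel>\<close>.
\<close>

section \<open>Symmetric bilinear forms and the finite-dimensional min-max principle\<close>

text \<open>When \<open>Q\<close> is the projection onto piecewise constants, the form
  \<open>b(Q v, Q w)\<close> may be degenerate on the discrete space. Independence of the
  eigenfunctions is therefore drawn from the left-hand side: definiteness of \<open>a_pw\<close>
  makes every \<open>Q (u j)\<close> nonzero, and orthogonality does the rest. Definiteness also
  gives the supremum its content, because a vanishing denominator would turn the quotient into 0.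

  For the exact problem the enumeration itself carries the spectral information: it supplies a
  finite basis of each eigenspace with positive value, and a value that is not listed has a trivial
  eigenspace. One more eigenfunction, orthogonal to the listed ones and with value in
  \<open>(0, lam k)\<close>, is thus a contradiction. Compactness is spent at a single place, to
  make a minimizing sequence converge strongly.

  Weak derivatives and pieces are definite descriptions, so the forms built from them are bilinear
  only on suitable subspaces. This is why a symmetric form is treated together with a carrier;
  positivity is left out of the locale and added where an argument relies on it.\<close>

locale sym_form =
  fixes S :: "'a::real_inner set" and q :: "'a \<Rightarrow> 'a \<Rightarrow> real"
  assumes subspace: "subspace S"
    and add_left: "x \<in> S \<Longrightarrow> y \<in> S \<Longrightarrow> z \<in> S \<Longrightarrow> q (x + y) z = q x z + q y z"
    and scale_left: "x \<in> S \<Longrightarrow> z \<in> S \<Longrightarrow> q (c *\<^sub>R x) z = c * q x z"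
    and sym: "x \<in> S \<Longrightarrow> z \<in> S \<Longrightarrow> q x z = q z x"
begin

lemma add_right: "x \<in> S \<Longrightarrow> y \<in> S \<Longrightarrow> z \<in> S \<Longrightarrow> q z (x + y) = q z x + q z y"
  using add_left sym subspace by (metis subspace_add)

lemma scale_right: "x \<in> S \<Longrightarrow> z \<in> S \<Longrightarrow> q z (c *\<^sub>R x) = c * q z x"
  using scale_left sym subspace by (metis subspace_scale)

lemma zero_left: "z \<in> S \<Longrightarrow> q 0 z = 0"
  using scale_left[of z z 0] by simp

lemma zero_right: "z \<in> S \<Longrightarrow> q z 0 = 0"
  using scale_right[of z z 0] by simp

lemma sum_left: "(\<And>i. i \<in> I \<Longrightarrow> f i \<in> S) \<Longrightarrow> z \<in> S \<Longrightarrow> q (\<Sum>i\<in>I. c i *\<^sub>R f i) z = (\<Sum>i\<in>I. c i * q (f i) z)"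
proof (induction I rule: infinite_finite_induct)
  case (insert x F)
  then have "(\<Sum>i\<in>F. c i *\<^sub>R f i) \<in> S" "c x *\<^sub>R f x \<in> S"
    using subspace by (auto intro!: subspace_sum subspace_scale)
  then show ?case using insert by (simp add: add_left scale_left)
qed (auto simp: zero_left)

lemma sum_right: "(\<And>i. i \<in> I \<Longrightarrow> f i \<in> S) \<Longrightarrow> z \<in> S \<Longrightarrow> q z (\<Sum>i\<in>I. c i *\<^sub>R f i) = (\<Sum>i\<in>I. c i * q z (f i))"
proof (induction I rule: infinite_finite_induct)
  case (insert x F)
  then have "(\<Sum>i\<in>F. c i *\<^sub>R f i) \<in> S" "c x *\<^sub>R f x \<in> S"
    using subspace by (auto intro!: subspace_sum subspace_scale)
  then show ?case using insert by (simp add: add_right scale_right)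
qed (auto simp: zero_right)

lemma subform: "subspace X \<Longrightarrow> X \<subseteq> S \<Longrightarrow> sym_form X q"
  by unfold_locales (auto simp: subset_iff add_left scale_left sym)

lemma square_add:
  assumes "x \<in> S" "y \<in> S"
  shows "q (x + t *\<^sub>R y) (x + t *\<^sub>R y) = q x x + 2 * t * q x y + t\<^sup>2 * q y y"
proof -
  have ty: "t *\<^sub>R y \<in> S" using assms subspace by (simp add: subspace_scale)
  show ?thesis
    using assms ty subspace_add[OF subspace assms(1) ty] sym[OF assms]
    by (simp add: add_left add_right scale_left scale_right power2_eq_square algebra_simps)
qed

lemma parallelogram:
  assumes "x \<in> S" "y \<in> S"
  shows "q (x - y) (x - y) = 2 * q x x + 2 * q y y - q (x + y) (x + y)"
  using square_add[OF assms, of 1] square_add[OF assms, of "-1"] by simp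

text \<open>First variation: \<open>q - \<rho> * inner\<close> is nonnegative on \<open>S\<close>
  and vanishes at \<open>e\<close>. Along the line \<open>e + t w\<close> it equals
  \<open>2 t d + t^2 c\<close>, which stays nonnegative near \<open>t = 0\<close> only if the linear
  coefficient \<open>d\<close> is 0.\<close>

lemma minimizer_euler:
  assumes min: "\<And>w. w \<in> S \<Longrightarrow> \<rho> * (w \<bullet> w) \<le> q w w" and e: "e \<in> S" "q e e = \<rho> * (e \<bullet> e)" and w: "w \<in> S"
  shows "q e w = \<rho> * (e \<bullet> w)"
proof -
  define d where "d = q e w - \<rho> * (e \<bullet> w)"
  define c where "c = q w w - \<rho> * (w \<bullet> w)"
  have c0: "c \<ge> 0" using min[OF w] by (simp add: c_def)
  have *: "0 \<le> 2 * t * d + t\<^sup>2 * c" for t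
  proof -
    have "e + t *\<^sub>R w \<in> S" using e w subspace by (simp add: subspace_add subspace_scale)
    from min[OF this] show ?thesis
      using square_add[OF e(1) w, of t] e(2)
      by (simp add: c_def d_def inner_add inner_commute power2_eq_square algebra_simps)
  qed
  have "d = 0"
  proof (rule ccontr)
    assume "d \<noteq> 0"
    \<comment> \<open>Close to the vertex of the parabola; the summand 1 keeps the denominator
      positive when \<open>c = 0\<close>.\<close>
    define t where "t = - d / (c + 1)"
    have t: "t * (c + 1) = - d" using c0 by (simp add: t_def)
    have "0 \<le> (2 * t * d + t\<^sup>2 * c) * (c + 1)\<^sup>2" using *[of t] by simp
    also have "\<dots> = 2 * (t * (c + 1)) * d * (c + 1) + (t * (c + 1))\<^sup>2 * c"
      by (simp add: power2_eq_square algebra_simps)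
    also have "\<dots> = - (d\<^sup>2 * (c + 2))" unfolding t by (simp add: power2_eq_square algebra_simps)
    also have "\<dots> < 0" using c0 \<open>d \<noteq> 0\<close> by (simp add: zero_less_mult_iff)
    finally show False by simp
  qed
  then show ?thesis by (simp add: d_def)
qed

end

section \<open>Orthogonal projections and dimension counts in inner product spaces\<close>

lemma orthogonal_projection_exists:
  fixes G :: "'a::real_inner set"
  assumes "finite G"
  obtains \<pi> :: "'a \<Rightarrow> 'a" where "linear \<pi>" "\<And>v. \<pi> v \<in> span G" "\<And>v g. g \<in> span G \<Longrightarrow> (v - \<pi> v) \<bullet> g = 0"
proof -
  obtain C where C: "finite C" "span C = span G" "pairwise orthogonal C"
    using basis_orthogonal[OF assms] by blast
  \<comment> \<open>The orthogonal set may contain 0; division by zero then gives the coefficient 0,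
    so that summand is harmless.\<close>
  define \<pi> where "\<pi> v = (\<Sum>c\<in>C. (v \<bullet> c / (c \<bullet> c)) *\<^sub>R c)" for v
  have "linear \<pi>"
    unfolding \<pi>_def by (rule linearI)
      (simp_all add: inner_add_left add_divide_distrib scaleR_left_distrib sum.distrib scaleR_sum_right)
  moreover have in_span: "\<pi> v \<in> span G" for v
    unfolding \<pi>_def C(2)[symmetric] by (intro span_sum span_scale span_base)
  moreover have "(v - \<pi> v) \<bullet> g = 0" if "g \<in> span G" for v g
  proof -
    have "g \<in> span C" using that C by simp
    then show ?thesis
    proof (induction rule: span_induct)
      case base
      show ?case by (simp add: subspace_def inner_add_right)
    next
      case (step d)
      have "\<pi> v \<bullet> d = (\<Sum>c\<in>C. if c = d then v \<bullet> d else 0)"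
        unfolding \<pi>_def inner_sum_left using C(3) step
        by (intro sum.cong) (auto simp: pairwise_def orthogonal_def)
      then show ?case using step C(1) by (simp add: inner_diff_left)
    qed
  qed
  ultimately show ?thesis using that by blast
qed

text \<open>Dimension count: the projection onto \<open>span G\<close> cannot be injective on the
  larger space \<open>W\<close>, and the difference of two vectors with equal image is orthogonal to
  \<open>G\<close>. Both the finite-dimensional and the exact min-max bound obtain their test vector
  here.\<close>

lemma exists_orthogonal_vector:
  fixes W G :: "'a::real_inner set"
  assumes "subspace W" "finite G" "card G < dim W"
  obtains w where "w \<in> W" "w \<noteq> 0" "\<And>g. g \<in> span G \<Longrightarrow> w \<bullet> g = 0"
proof -
  obtain \<pi> :: "'a \<Rightarrow> 'a" where p: "linear \<pi>" "\<And>v. \<pi> v \<in> span G" "\<And>v g. g \<in> span G \<Longrightarrow> (v - \<pi> v) \<bullet> g = 0"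
    using orthogonal_projection_exists[OF assms(2)] by metis
  obtain B where B: "B \<subseteq> W" "independent B" "W \<subseteq> span B" "card B = dim W"
    using basis_exists[of W] by blast
  have sB: "span B = W"
    by (metis B(1,3) assms(1) span_minimal subset_antisym)
  have "\<not> inj_on \<pi> (span B)"
  proof
    assume inj: "inj_on \<pi> (span B)"
    have "independent (\<pi> ` B)"
      using linear_independent_injective_image[OF p(1) B(2) inj] .
    from independent_span_bound[OF assms(2) this] have "card (\<pi> ` B) \<le> card G"
      using p(2) by blast
    moreover have "card (\<pi> ` B) = card B"
      using inj_on_subset[OF inj span_superset] by (rule card_image)
    ultimately show False using B(4) assms(3) by simp
  qed
  then obtain x y where xy: "x \<in> W" "y \<in> W" "x \<noteq> y" "\<pi> x = \<pi> y"
    unfolding inj_on_def sB by blast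
  have "\<pi> (x - y) = 0" using xy p(1) by (simp add: linear_diff)
  then have "(x - y) \<bullet> g = 0" if "g \<in> span G" for g using p(3)[OF that, of "x - y"] by simp
  moreover have "x - y \<in> W" using xy assms(1) by (simp add: subspace_diff)
  ultimately show ?thesis using that[of "x - y"] xy by simp
qed

text \<open>Heine-Borel inside an arbitrary inner product space. Induction over an orthogonal
  spanning set encloses the unit ball of the span in a compact subset of the span: by Pythagoras,
  the component along the new vector and the remainder both stay in their unit balls.\<close>

lemma compact_span_unit_sphere:
  fixes B :: "'a::real_inner set"
  assumes "finite B"
  shows "compact (span B \<inter> sphere 0 1)"
proof -
  have "\<exists>K. compact K \<and> span C \<inter> cball 0 1 \<subseteq> K \<and> K \<subseteq> span C"
    if "finite C" "pairwise orthogonal C" for C :: "'a set"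
    using that
  proof (induction C)
    case empty
    show ?case by (intro exI[of _ "{0}"]) auto
  next
    case (insert a C)
    then obtain K where K: "compact K" "span C \<inter> cball 0 1 \<subseteq> K" "K \<subseteq> span C"
      by (auto simp: pairwise_insert)
    show ?case
    proof (cases "a = 0")
      case True
      then show ?thesis using K by auto
    next
      case False
      \<comment> \<open>A multiple \<open>t a\<close> of norm at most 1 has coefficient in
        \<open>[-r, r]\<close>.\<close>
      define r where "r = 1 / norm a"
      define K' where "K' = (\<lambda>(t, s). t *\<^sub>R a + s) ` ({-r..r} \<times> K)"
      have "compact K'" unfolding K'_def
        by (intro compact_continuous_image compact_Times K compact_Icc) (auto intro!: continuous_intros simp: case_prod_unfold)
      moreover have "K' \<subseteq> span (insert a C)"
      proof
        fix x assume "x \<in> K'"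
        then obtain t s where x: "x = t *\<^sub>R a + s" and "s \<in> K" unfolding K'_def by auto
        then have "s \<in> span (insert a C)" using K(3) span_mono[of C "insert a C"] by blast
        then show "x \<in> span (insert a C)" unfolding x by (intro span_add span_scale[OF span_base]) auto
      qed
      moreover have "span (insert a C) \<inter> cball 0 1 \<subseteq> K'"
      proof
        fix v assume v: "v \<in> span (insert a C) \<inter> cball 0 1"
        then obtain t where t: "v - t *\<^sub>R a \<in> span C" by (auto simp: span_insert)
        define s where "s = v - t *\<^sub>R a"
        have "\<And>c. c \<in> C \<Longrightarrow> orthogonal a c"
          using insert.prems insert.hyps by (auto simp: pairwise_insert)
        then have "orthogonal a s" using t orthogonal_to_span s_def by blast
        then have "orthogonal (t *\<^sub>R a) s" by (simp add: orthogonal_clauses)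
        then have "(norm (t *\<^sub>R a + s))\<^sup>2 = (norm (t *\<^sub>R a))\<^sup>2 + (norm s)\<^sup>2"
          by (rule norm_add_Pythagorean)
        moreover have "(norm (t *\<^sub>R a + s))\<^sup>2 \<le> 1" using v by (simp add: s_def power_le_one)
        ultimately have "(norm (t *\<^sub>R a))\<^sup>2 \<le> 1" "(norm s)\<^sup>2 \<le> 1"
          using zero_le_power2[of "norm s"] zero_le_power2[of "norm (t *\<^sub>R a)"] by linarith+
        then have "norm (t *\<^sub>R a) \<le> 1" "norm s \<le> 1" by (simp_all add: power_le_one_iff)
        then have "\<bar>t\<bar> \<le> r" "s \<in> K"
          using False K(2) t by (auto simp: r_def field_simps s_def)
        then have "(t, s) \<in> {-r..r} \<times> K" by auto
        then show "v \<in> K'" unfolding K'_def by (rule rev_image_eqI) (simp add: s_def)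
      qed
      ultimately show ?thesis by blast
    qed
  qed
  moreover obtain C where "finite C" "span C = span B" "pairwise orthogonal C"
    using basis_orthogonal[OF assms] by blast
  ultimately obtain K where K: "compact K" "span B \<inter> cball 0 1 \<subseteq> K" "K \<subseteq> span B" by metis
  then have "span B \<inter> sphere 0 1 = K \<inter> sphere 0 1" by (auto simp: subset_iff)
  moreover have "closed (sphere (0::'a) 1)"
    unfolding sphere_def by (intro closed_Collect_eq continuous_intros)
  ultimately show ?thesis using K by (simp add: compact_Int_closed)
qed

text \<open>In coordinates with respect to an orthogonal spanning set, \<open>q v v\<close> is a
  quadratic polynomial in the inner products of \<open>v\<close> with finitely many vectors.\<close>

lemma sym_form_continuous_on:
  fixes B :: "'a::real_inner set"
  assumes "finite B" "sym_form (span B) q"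
  shows "continuous_on (span B) (\<lambda>v. q v v)"
proof -
  interpret sym_form "span B" q by fact
  obtain C where C: "finite C" "span C = span B" "pairwise orthogonal C"
    using basis_orthogonal[OF assms(1)] by blast
  let ?f = "\<lambda>v. \<Sum>c\<in>C. (v \<bullet> c / (c \<bullet> c)) *\<^sub>R c"
  have CB: "c \<in> span B" if "c \<in> C" for c using that C(2) span_base by blast
  have rep: "v = ?f v" if "v \<in> span B" for v
  proof -
    have "v \<in> span C" using that C(2) by simp
    then show ?thesis
    proof (induction rule: span_induct)
      case base
      have "linear ?f"
        by (rule linearI) (simp_all add: inner_add_left add_divide_distrib scaleR_left_distrib sum.distrib scaleR_sum_right)
      then have "linear (\<lambda>x. x - ?f x)" by (intro linear_compose_sub) (rule linear_ident)
      from linear_subspace_vimage[OF this subspace_single_0]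
      show ?case by (simp add: vimage_def)
    next
      case (step d)
      have "?f d = (\<Sum>c\<in>C. if c = d then d else 0)"
        using C(3) step by (intro sum.cong) (auto simp: pairwise_def orthogonal_def)
      then show ?case using C(1) step by simp
    qed
  qed
  have "q v v = (\<Sum>c\<in>C. (v \<bullet> c / (c \<bullet> c)) * (\<Sum>d\<in>C. (v \<bullet> d / (d \<bullet> d)) * q c d))" if v: "v \<in> span B" for v
  proof -
    have "q v v = q (?f v) (?f v)" using rep[OF v] by simp
    also have "\<dots> = (\<Sum>c\<in>C. (v \<bullet> c / (c \<bullet> c)) * q c (?f v))"
      using rep[OF v] v CB by (intro sum_left) auto
    also have "\<dots> = (\<Sum>c\<in>C. (v \<bullet> c / (c \<bullet> c)) * (\<Sum>d\<in>C. (v \<bullet> d / (d \<bullet> d)) * q c d))"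
      using CB by (intro sum.cong refl arg_cong2[where f="(*)"] sum_right) auto
    finally show ?thesis .
  qed
  then show ?thesis
    by (subst continuous_on_cong[OF refl]) (assumption, unfold divide_inverse, intro continuous_intros)
qed


text \<open>Homogeneity reduces the quotient to the compact unit sphere of \<open>X\<close>. The
  bound is multiplied out, so it covers \<open>v = 0\<close> as well.\<close>

lemma rayleigh_max_exists:
  fixes B :: "'a::real_inner set"
  assumes "finite B" "sym_form (span B) q" "X \<subseteq> span B" "subspace X" "closed X" "X \<noteq> {0}"
  obtains e where "e \<in> X" "norm e = 1" "\<And>v. v \<in> X \<Longrightarrow> q v v \<le> q e e * (v \<bullet> v)"
proof -
  interpret sym_form "span B" q by fact
  have "X \<inter> sphere 0 1 = (span B \<inter> sphere 0 1) \<inter> X" using assms(3) by blast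
  then have c: "compact (X \<inter> sphere 0 1)"
    using compact_span_unit_sphere[OF assms(1)] assms(5) by (simp add: compact_Int_closed)
  obtain x where x: "x \<in> X" "x \<noteq> 0" using assms(4,6) subspace_0 by blast
  have nrm: "v /\<^sub>R norm v \<in> X \<inter> sphere 0 1" if "v \<in> X" "v \<noteq> 0" for v
    using that assms(4) by (simp add: subspace_scale)
  have "continuous_on (X \<inter> sphere 0 1) (\<lambda>v. q v v)"
    using continuous_on_subset[OF sym_form_continuous_on[OF assms(1,2)]] assms(3) by blast
  then obtain e where e: "e \<in> X \<inter> sphere 0 1" "\<forall>v\<in>X \<inter> sphere 0 1. q v v \<le> q e e"
    using continuous_attains_sup[OF c] nrm[OF x] by blast
  have "q v v \<le> q e e * (v \<bullet> v)" if v: "v \<in> X" for v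
  proof (cases "v = 0")
    case True
    then show ?thesis using zero_left[of 0] subspace_0[OF subspace] by simp
  next
    case False
    define y where "y = v /\<^sub>R norm v"
    have y: "q y y \<le> q e e" "y \<in> span B" using nrm[OF v False] e(2) assms(3) unfolding y_def by blast+
    have "v = norm v *\<^sub>R y" using False by (simp add: y_def)
    then have "q v v = q (norm v *\<^sub>R y) (norm v *\<^sub>R y)" by simp
    also have "\<dots> = (norm v)\<^sup>2 * q y y"
      using y(2) subspace by (simp add: scale_left scale_right subspace_scale power2_eq_square)
    also have "\<dots> \<le> (norm v)\<^sup>2 * q e e" using y(1) by (intro mult_left_mono) auto
    finally show ?thesis by (simp add: power2_norm_eq_inner mult.commute)
  qed
  then show ?thesis using that e(1) by auto
qed

lemma rayleigh_min_exists:
  fixes B :: "'a::real_inner set"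
  assumes "finite B" "sym_form (span B) q" "X \<subseteq> span B" "subspace X" "closed X" "X \<noteq> {0}"
  obtains e where "e \<in> X" "norm e = 1" "\<And>v. v \<in> X \<Longrightarrow> q e e * (v \<bullet> v) \<le> q v v"
proof -
  interpret sym_form "span B" q by fact
  have "sym_form (span B) (\<lambda>x y. - q x y)"
    by unfold_locales (auto simp: add_left scale_left sym)
  from rayleigh_max_exists[OF assms(1) this assms(3-6)] obtain e
    where "e \<in> X" "norm e = 1" "\<And>v. v \<in> X \<Longrightarrow> - q v v \<le> - q e e * (v \<bullet> v)" by blast
  then show ?thesis using that[of e] by simp
qed

lemma closed_orthogonal_complement: "closed {w::'a::real_inner. \<forall>g\<in>G. w \<bullet> g = 0}"
proof -
  have "{w. \<forall>g\<in>G. w \<bullet> g = 0} = (\<Inter>g\<in>G. {w. w \<bullet> g = 0})" by auto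
  then show ?thesis by (auto intro!: closed_INT closed_Collect_eq continuous_intros)
qed

lemma subspace_orthogonal_complement: "subspace {w::'a::real_inner. \<forall>g\<in>G. w \<bullet> g = 0}"
  by (simp add: subspace_def inner_add_left)

lemma finite_dim_span:
  fixes W :: "'a::real_vector set"
  assumes "subspace W" "0 < dim W"
  obtains B where "finite B" "independent B" "span B = W" "card B = dim W"
proof -
  obtain B where B: "B \<subseteq> W" "independent B" "W \<subseteq> span B" "card B = dim W"
    using basis_exists[of W] by blast
  have "span B = W" by (metis B(1,3) assms(1) span_minimal subset_antisym)
  moreover have "finite B" using B(4) assms(2) card_ge_0_finite by metis
  ultimately show ?thesis using that B by blast
qed

text \<open>The span is its own double orthogonal complement, by means of the projection, and
  orthogonal complements are intersections of closed kernels.\<close>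

lemma closed_finite_dim_span:
  fixes B :: "'a::real_inner set"
  assumes "finite B"
  shows "closed (span B)"
proof -
  obtain \<pi> :: "'a \<Rightarrow> 'a" where p: "linear \<pi>" "\<And>v. \<pi> v \<in> span B" "\<And>v g. g \<in> span B \<Longrightarrow> (v - \<pi> v) \<bullet> g = 0"
    using orthogonal_projection_exists[OF assms] by metis
  let ?Z = "{z. \<forall>g\<in>span B. z \<bullet> g = 0}"
  have "span B = {w. \<forall>z\<in>?Z. w \<bullet> z = 0}"
  proof (intro subset_antisym subsetI)
    fix w assume w: "w \<in> {w. \<forall>z\<in>?Z. w \<bullet> z = 0}"
    have "w - \<pi> w \<in> ?Z" using p(3) by blast
    then have "w \<bullet> (w - \<pi> w) = 0" "(w - \<pi> w) \<bullet> \<pi> w = 0" using w p(2,3) by blast+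
    then have "(w - \<pi> w) \<bullet> (w - \<pi> w) = 0" by (simp add: inner_diff inner_commute)
    then show "w \<in> span B" using p(2)[of w] by simp
  qed (auto simp: inner_commute)
  then show ?thesis using closed_orthogonal_complement[of ?Z] by simp
qed

text \<open>Courant-Fischer by successive minimization: each new vector minimizes the Rayleigh
  quotient on the orthogonal complement of the earlier ones. The last clause records this
  minimality, which supplies the lower bound in the min-max principle.\<close>

lemma rayleigh_eigenvectors_exist:
  fixes B :: "'a::real_inner set"
  assumes "finite B" "sym_form (span B) q" "j \<le> dim (span B)"
  shows "\<exists>e :: nat \<Rightarrow> 'a. (\<forall>i<j. e i \<in> span B \<and> norm (e i) = 1) \<and>
    (\<forall>i<j. \<forall>l<i. e i \<bullet> e l = 0 \<and> q (e i) (e l) = 0 \<and> q (e l) (e l) \<le> q (e i) (e i)) \<and>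
    (\<forall>i<j. \<forall>w\<in>span B. (\<forall>l<i. w \<bullet> e l = 0) \<longrightarrow> q (e i) (e i) * (w \<bullet> w) \<le> q w w)"
  using assms(3)
proof (induction j)
  case 0
  show ?case by simp
next
  case (Suc j)
  interpret sym_form "span B" q by fact
  obtain e :: "nat \<Rightarrow> 'a" where E: "(\<forall>i<j. e i \<in> span B \<and> norm (e i) = 1) \<and>
    (\<forall>i<j. \<forall>l<i. e i \<bullet> e l = 0 \<and> q (e i) (e l) = 0 \<and> q (e l) (e l) \<le> q (e i) (e i)) \<and>
    (\<forall>i<j. \<forall>w\<in>span B. (\<forall>l<i. w \<bullet> e l = 0) \<longrightarrow> q (e i) (e i) * (w \<bullet> w) \<le> q w w)"
    using Suc.IH[OF Suc_leD[OF Suc.prems]] by (elim exE)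
  have e: "\<And>i. i < j \<Longrightarrow> e i \<in> span B \<and> norm (e i) = 1"
    "\<And>i l. i < j \<Longrightarrow> l < i \<Longrightarrow> e i \<bullet> e l = 0 \<and> q (e i) (e l) = 0 \<and> q (e l) (e l) \<le> q (e i) (e i)"
    "\<And>i w. i < j \<Longrightarrow> w \<in> span B \<Longrightarrow> (\<And>l. l < i \<Longrightarrow> w \<bullet> e l = 0) \<Longrightarrow> q (e i) (e i) * (w \<bullet> w) \<le> q w w"
    using E by simp_all
  define Y where "Y i = span B \<inter> {w. \<forall>g\<in>e ` {..<i}. w \<bullet> g = 0}" for i
  have Y: "subspace (Y i)" "closed (Y i)" "Y i \<subseteq> span B" for i
    unfolding Y_def
    by (intro subspace_inter subspace_span subspace_orthogonal_complement closed_orthogonal_complement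
        closed_Int closed_finite_dim_span assms(1) Int_lower1)+
  have "card (e ` {..<j}) < dim (span B)"
    using Suc.prems card_image_le[of "{..<j}" e] by simp
  then obtain w where "w \<in> span B" "w \<noteq> 0" "\<And>g. g \<in> span (e ` {..<j}) \<Longrightarrow> w \<bullet> g = 0"
    using exists_orthogonal_vector[OF subspace_span, of "e ` {..<j}" B] by auto
  then have "w \<in> Y j" "w \<noteq> 0" by (auto simp: Y_def span_base)
  then have "Y j \<noteq> {0}" by blast
  then obtain f where f: "f \<in> Y j" "norm f = 1" "\<And>v. v \<in> Y j \<Longrightarrow> q f f * (v \<bullet> v) \<le> q v v"
    using rayleigh_min_exists[OF assms(1,2) Y(3,1,2)] by blast
  have fe: "f \<bullet> e l = 0" "f \<in> span B" if "l < j" for l using f(1) that by (auto simp: Y_def)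
  have min: "q (e l) (e l) * (w \<bullet> w) \<le> q w w" if "l < j" "w \<in> Y l" for l w
    using e(3)[OF that(1)] that(2) by (auto simp: Y_def)
  have fY: "f \<in> Y l" if "l < j" for l using f(1) that by (auto simp: Y_def)
  have ff: "f \<bullet> f = 1" using f(2) by (simp add: dot_square_norm)
  \<comment> \<open>The Euler equation is used for \<open>e l\<close>, not for \<open>f\<close>: the
    older vector is minimal on the larger space \<open>Y l\<close>, which contains \<open>f\<close>,
    so \<open>f\<close> is an admissible direction.\<close>
  have qfe: "q f (e l) = 0" if l: "l < j" for l
  proof -
    interpret Y: sym_form "Y l" q by (rule subform[OF Y(1,3)])
    have "e l \<in> Y l" using e(1,2) l by (auto simp: Y_def)
    then have "q (e l) f = q (e l) (e l) * (e l \<bullet> f)"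
      using e(1)[OF l] by (intro Y.minimizer_euler[OF _ _ _ fY[OF l]] min[OF l]) (simp_all add: dot_square_norm)
    moreover have "q f (e l) = q (e l) f" using fe(2)[OF l] e(1)[OF l] by (intro sym) auto
    ultimately show ?thesis using fe(1)[OF l] by (simp add: inner_commute[of "e l" f])
  qed
  have mono: "q (e l) (e l) \<le> q f f" if "l < j" for l using min[OF that fY[OF that]] ff by simp
  have minf: "q f f * (w \<bullet> w) \<le> q w w" if "w \<in> span B" "\<And>l. l < j \<Longrightarrow> w \<bullet> e l = 0" for w
    using f(3)[of w] that by (auto simp: Y_def)
  have fB: "f \<in> span B" using f(1) by (simp add: Y_def)
  show ?case
  proof (intro exI[of _ "e(j := f)"] conjI allI impI ballI)
    fix i assume "i < Suc j"
    then show "(e(j := f)) i \<in> span B" "norm ((e(j := f)) i) = 1"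
      using e(1) fB f(2) by (auto simp: less_Suc_eq)
  next
    fix i l assume "i < Suc j" "l < i"
    then show "(e(j := f)) i \<bullet> (e(j := f)) l = 0" "q ((e(j := f)) i) ((e(j := f)) l) = 0"
      "q ((e(j := f)) l) ((e(j := f)) l) \<le> q ((e(j := f)) i) ((e(j := f)) i)"
      using e(2)[of i l] fe(1)[of l] qfe[of l] mono[of l] by (auto simp: less_Suc_eq)
  next
    fix i w assume i: "i < Suc j" and w: "w \<in> span B" "\<forall>l<i. w \<bullet> (e(j := f)) l = 0"
    then show "q ((e(j := f)) i) ((e(j := f)) i) * (w \<bullet> w) \<le> q w w"
      using e(3)[of i w] minf[of w] by (auto simp: less_Suc_eq)
  qed
qed

text \<open>The value is the \<open>k\<close>-th Rayleigh-Ritz value. The span of the first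
  \<open>k\<close> minimizers bounds it from above; conversely every \<open>k\<close>-dimensional
  subspace contains a vector orthogonal to the first \<open>k - 1\<close> minimizers. An optimal
  subspace is returned too, because a lower bound for the quotient on that subspace passes to the
  min-max value.\<close>

lemma min_max_exists:
  fixes B :: "'a::real_inner set"
  assumes B: "finite B" and sf: "sym_form (span B) q" and k: "1 \<le> k" "k \<le> dim (span B)"
    and R: "\<And>v. R v = q v v / (v \<bullet> v)"
  obtains W \<mu> where "is_min_max R (span B) k \<mu>" "subspace W" "W \<subseteq> span B" "dim W = k"
    "\<And>w. w \<in> W - {0} \<Longrightarrow> R w \<le> \<mu>"
proof -
  interpret sym_form "span B" q by fact
  obtain e :: "nat \<Rightarrow> 'a" where E: "(\<forall>i<k. e i \<in> span B \<and> norm (e i) = 1) \<and>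
    (\<forall>i<k. \<forall>l<i. e i \<bullet> e l = 0 \<and> q (e i) (e l) = 0 \<and> q (e l) (e l) \<le> q (e i) (e i)) \<and>
    (\<forall>i<k. \<forall>w\<in>span B. (\<forall>l<i. w \<bullet> e l = 0) \<longrightarrow> q (e i) (e i) * (w \<bullet> w) \<le> q w w)"
    using rayleigh_eigenvectors_exist[OF B sf k(2)] by (elim exE)
  have e: "\<And>i. i < k \<Longrightarrow> e i \<in> span B \<and> norm (e i) = 1"
    "\<And>i l. i < k \<Longrightarrow> l < i \<Longrightarrow> e i \<bullet> e l = 0 \<and> q (e i) (e l) = 0 \<and> q (e l) (e l) \<le> q (e i) (e i)"
    "\<And>i w. i < k \<Longrightarrow> w \<in> span B \<Longrightarrow> (\<And>l. l < i \<Longrightarrow> w \<bullet> e l = 0) \<Longrightarrow> q (e i) (e i) * (w \<bullet> w) \<le> q w w"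
    using E by simp_all
  \<comment> \<open>The minimizers are indexed from 0, so index \<open>k - 1\<close> is the
    \<open>k\<close>-th one.\<close>
  define \<mu> where "\<mu> = q (e (k-1)) (e (k-1))"
  define W where "W = span (e ` {..<k})"
  have orth: "e i \<bullet> e l = (if i = l then 1 else 0)" "i \<noteq> l \<Longrightarrow> q (e i) (e l) = 0"
    if "i < k" "l < k" for i l
    using e(1)[OF that(1)] e(1)[OF that(2)] e(2)[OF that(1), of l] e(2)[OF that(2), of i] sym[of "e i" "e l"]
    by (cases i l rule: linorder_cases; simp add: dot_square_norm inner_commute)+
  have inj: "inj_on e {..<k}"
    by (rule inj_onI) (metis lessThan_iff orth(1) zero_neq_one)
  have "independent (e ` {..<k})"
  proof (rule pairwise_orthogonal_independent)
    show "pairwise orthogonal (e ` {..<k})"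
      using orth(1) by (auto simp: pairwise_def orthogonal_def)
    show "0 \<notin> e ` {..<k}" using e(1) by force
  qed
  then have dimW: "dim W = k"
    unfolding W_def dim_span by (simp add: dim_eq_card_independent card_image[OF inj])
  have WB: "W \<subseteq> span B" unfolding W_def using e(1) by (intro span_minimal) auto
  have ub: "R w \<le> \<mu>" if w: "w \<in> W - {0}" for w
  proof -
    have "w \<in> span (e ` {..<k})" using w by (simp add: W_def)
    then obtain c where "w = (\<Sum>v\<in>e ` {..<k}. c v *\<^sub>R v)"
      by (auto simp: span_finite)
    then have w': "w = (\<Sum>i<k. c (e i) *\<^sub>R e i)" by (simp add: sum.reindex[OF inj])
    have eq: "q w w = (\<Sum>i<k. (c (e i))\<^sup>2 * q (e i) (e i))"
    proof -
      have "q w w = (\<Sum>i<k. c (e i) * q (e i) w)"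
        using w WB e(1) by (subst (1) w') (intro sum_left, auto)
      also have "\<dots> = (\<Sum>i<k. c (e i) * (\<Sum>l<k. c (e l) * q (e i) (e l)))"
        unfolding w' using e(1) by (intro sum.cong refl arg_cong2[where f="(*)"] sum_right) auto
      also have "\<dots> = (\<Sum>i<k. c (e i) * (\<Sum>l<k. if l = i then c (e i) * q (e i) (e i) else 0))"
        by (intro sum.cong refl arg_cong2[where f="(*)"]) (auto simp: orth(2))
      also have "\<dots> = (\<Sum>i<k. (c (e i))\<^sup>2 * q (e i) (e i))"
        by (intro sum.cong) (auto simp: power2_eq_square)
      finally show ?thesis .
    qed
    have eqn: "w \<bullet> w = (\<Sum>i<k. (c (e i))\<^sup>2)"
    proof -
      have "w \<bullet> w = (\<Sum>i<k. c (e i) * (\<Sum>l<k. c (e l) * (e i \<bullet> e l)))"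
        unfolding w' inner_sum_left by (simp add: inner_sum_right sum_distrib_left mult.left_commute)
      also have "\<dots> = (\<Sum>i<k. c (e i) * (\<Sum>l<k. if l = i then c (e i) else 0))"
        by (intro sum.cong refl arg_cong2[where f="(*)"]) (auto simp: orth(1))
      also have "\<dots> = (\<Sum>i<k. (c (e i))\<^sup>2)"
        by (intro sum.cong) (auto simp: power2_eq_square)
      finally show ?thesis .
    qed
    have "q (e i) (e i) \<le> \<mu>" if "i < k" for i
      using e(2)[of "k-1" i] that k(1) by (cases "i = k - 1") (auto simp: \<mu>_def)
    then have "q w w \<le> \<mu> * (w \<bullet> w)"
      unfolding eq eqn sum_distrib_left
      by (intro sum_mono) (simp add: mult.commute[of "(c (e _))\<^sup>2"] mult_right_mono)
    then show ?thesis using w by (simp add: R pos_divide_le_eq)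
  qed
  have lb: "\<exists>w\<in>X - {0}. \<mu> \<le> R w" if X: "subspace X" "X \<subseteq> span B" "dim X = k" for X
  proof -
    have "card (e ` {..<k-1}) < dim X" using X k card_image_le[of "{..<k-1}" e] by simp
    then obtain w where w: "w \<in> X" "w \<noteq> 0" "\<And>g. g \<in> span (e ` {..<k-1}) \<Longrightarrow> w \<bullet> g = 0"
      using exists_orthogonal_vector[OF X(1), of "e ` {..<k-1}"] by auto
    have "\<mu> * (w \<bullet> w) \<le> q w w"
      unfolding \<mu>_def using w X k by (intro e(3)) (auto simp: span_base)
    then show ?thesis using w(1,2) by (intro bexI[of _ w]) (auto simp: R pos_le_divide_eq)
  qed
  have max: "\<exists>M. is_max_value R (X - {0}) M" if X: "subspace X" "X \<subseteq> span B" "dim X = k" for X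
  proof -
    obtain C where C: "finite C" "span C = X"
      using finite_dim_span[OF X(1)] X(3) k(1) by (metis less_le_trans zero_less_one)
    have "X \<noteq> {0}" using lb[OF X] by auto
    then obtain f where f: "f \<in> X" "norm f = 1" "\<And>v. v \<in> X \<Longrightarrow> q v v \<le> q f f * (v \<bullet> v)"
      using rayleigh_max_exists[OF B sf X(2,1)] closed_finite_dim_span[OF C(1)] C(2) by blast
    have "is_max_value R (X - {0}) (R f)"
      unfolding is_max_value_def
    proof (intro conjI ballI)
      show "\<exists>x\<in>X - {0}. R x = R f" using f by (intro bexI[of _ f]) auto
      show "R v \<le> R f" if "v \<in> X - {0}" for v
        using f(2) f(3)[of v] that by (simp add: R pos_divide_le_eq dot_square_norm)
    qed
    then show ?thesis by blast
  qed
  define g where "g X = (SOME M. is_max_value R (X - {0}) M)" for X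
  have g: "is_max_value R (X - {0}) (g X)" if "subspace X" "X \<subseteq> span B" "dim X = k" for X
    unfolding g_def using max[OF that] by (rule someI_ex)
  have "\<mu> \<le> g X" if "subspace X" "X \<subseteq> span B" "dim X = k" for X
    using g[OF that] lb[OF that] unfolding is_max_value_def by force
  moreover have sW: "subspace W" by (simp add: W_def)
  moreover obtain x where "x \<in> W - {0}" "R x = g W"
    using g[OF sW WB dimW] unfolding is_max_value_def by blast
  then have "g W \<le> \<mu>" using ub by metis
  ultimately have "is_min_max R (span B) k \<mu>"
    unfolding is_min_max_def is_min_value_def using g WB dimW by (intro exI[of _ g]) (auto intro!: exI[of _ W] antisym)
  then show ?thesis using that sW WB dimW ub by blast
qed

section \<open>Completeness of \<open>L\<^sup>2\<close>\<close>

lemma square_integrable_rep: "square_integrable (rep_L2 v)"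
  using Quotient3_rep_reflp[OF Quotient3_L2, of v] by simp

lemma rep_abs_L2: "square_integrable f \<Longrightarrow> AE x in lebesgue. rep_L2 (abs_L2 f) x = f x"
  using Quotient3_rep_abs[OF Quotient3_L2, of f] by simp

lemma L2_eq_iff: "v = w \<longleftrightarrow> (AE x in lebesgue. rep_L2 v x = rep_L2 w x)"
  using Quotient3_rel_rep[OF Quotient3_L2, of v w] square_integrable_rep by auto

lemma abs_rep_L2: "abs_L2 (rep_L2 v) = v"
  by (rule Quotient3_abs_rep[OF Quotient3_L2])

lemma plus_abs_L2:
  "square_integrable f \<Longrightarrow> square_integrable g \<Longrightarrow> abs_L2 f + abs_L2 g = abs_L2 (\<lambda>x. f x + g x)"
  by (rule plus_L2.abs_eq) auto

lemma scaleR_abs_L2: "square_integrable f \<Longrightarrow> c *\<^sub>R abs_L2 f = abs_L2 (\<lambda>x. c * f x)"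
  by (rule scaleR_L2.abs_eq) auto

lemma inner_abs_L2:
  "square_integrable f \<Longrightarrow> square_integrable g \<Longrightarrow> abs_L2 f \<bullet> abs_L2 g = (LINT x|lebesgue. f x * g x)"
  by (rule inner_L2.abs_eq) auto

lemma rep_add: "AE x in lebesgue. rep_L2 (v + w) x = rep_L2 v x + rep_L2 w x"
  using rep_abs_L2[OF square_integrable_add[OF square_integrable_rep square_integrable_rep], of v w]
  by (simp add: plus_abs_L2[OF square_integrable_rep square_integrable_rep, symmetric] abs_rep_L2)

lemma rep_scaleR: "AE x in lebesgue. rep_L2 (c *\<^sub>R v) x = c * rep_L2 v x"
  using rep_abs_L2[OF square_integrable_scale[OF square_integrable_rep], of c v]
  by (simp add: scaleR_abs_L2[OF square_integrable_rep, symmetric] abs_rep_L2)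

lemma rep_zero: "AE x in lebesgue. rep_L2 0 x = 0"
  using rep_abs_L2[OF square_integrable_0] by (simp add: zero_L2_def)

lemma rep_diff: "AE x in lebesgue. rep_L2 (v - w) x = rep_L2 v x - rep_L2 w x"
proof -
  have "v - w = v + (-1) *\<^sub>R w" by simp
  then show ?thesis using rep_add[of v "(-1) *\<^sub>R w"] rep_scaleR[of "-1" w] by auto
qed

lemma inner_rep: "v \<bullet> w = (LINT x|lebesgue. rep_L2 v x * rep_L2 w x)"
  using inner_abs_L2[OF square_integrable_rep square_integrable_rep, of v w] by (simp add: abs_rep_L2)

lemma inner_rep_abs: "square_integrable f \<Longrightarrow> v \<bullet> abs_L2 f = (LINT x|lebesgue. rep_L2 v x * f x)"
  using inner_abs_L2[OF square_integrable_rep, of f v] by (simp add: abs_rep_L2)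

lemma measurable_rep: "rep_L2 v \<in> borel_measurable lebesgue"
  using square_integrable_rep[of v] by (simp add: square_integrable_def)

lemma square_integrable_iff_nn_integral:
  "square_integrable f \<longleftrightarrow> f \<in> borel_measurable lebesgue \<and> (\<integral>\<^sup>+x. ennreal ((f x)\<^sup>2) \<partial>lebesgue) < \<infinity>"
  unfolding square_integrable_def by (auto simp: integrable_iff_bounded intro!: borel_measurable_power)

lemma norm_abs_L2_square:
  "square_integrable f \<Longrightarrow> ennreal ((norm (abs_L2 f))\<^sup>2) = (\<integral>\<^sup>+x. ennreal ((f x)\<^sup>2) \<partial>lebesgue)"
  unfolding power2_norm_eq_inner
  by (subst nn_integral_eq_integral) (auto simp: inner_abs_L2 square_integrable_def power2_eq_square)

lemma norm_L2_square: "ennreal ((norm v)\<^sup>2) = (\<integral>\<^sup>+x. ennreal ((rep_L2 v x)\<^sup>2) \<partial>lebesgue)"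
  using norm_abs_L2_square[OF square_integrable_rep, of v] by (simp add: abs_rep_L2)

lemma norm_diff_L2_square:
  "ennreal ((norm (v - w))\<^sup>2) = (\<integral>\<^sup>+x. ennreal ((rep_L2 v x - rep_L2 w x)\<^sup>2) \<partial>lebesgue)"
  unfolding norm_L2_square by (rule nn_integral_cong_AE) (use rep_diff[of v w] in auto)

lemma fast_Cauchy_subsequence:
  fixes X :: "nat \<Rightarrow> 'a::metric_space"
  assumes "Cauchy X" and e: "\<And>k. 0 < e k"
  obtains r :: "nat \<Rightarrow> nat" where "strict_mono r" "\<And>k. dist (X (r (Suc k))) (X (r k)) < e k"
proof -
  have "\<exists>M. \<forall>m\<ge>M. \<forall>n\<ge>M. dist (X m) (X n) < e k" for k
    using assms(1) e[of k] unfolding Cauchy_def by blast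
  then obtain M where M: "\<And>k m n. m \<ge> M k \<Longrightarrow> n \<ge> M k \<Longrightarrow> dist (X m) (X n) < e k" by metis
  define r where "r = rec_nat (M 0) (\<lambda>k y. max (Suc y) (M (Suc k)))"
  have r0: "r 0 = M 0" and rS: "\<And>k. r (Suc k) = max (Suc (r k)) (M (Suc k))" by (simp_all add: r_def)
  have "strict_mono r" by (simp add: strict_mono_Suc_iff rS less_max_iff_disj)
  moreover have ge: "r k \<ge> M k" for k by (cases k) (auto simp: r0 rS)
  moreover have "r (Suc k) \<ge> M k" for k using ge[of k] by (simp add: rS max_def)
  ultimately show ?thesis using that M by blast
qed

text \<open>Riesz-Fischer with weights: steps of size \<open>4^-k\<close> make the integral of the
  sum of \<open>4^k (g k)^2\<close> finite. At almost every point this sum is a finite number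
  \<open>G\<close>, hence \<open>|g k| <= sqrt G * 2^-k\<close>, and the telescoping series
  converges absolutely.\<close>

lemma L2_AE_convergent_subsequence:
  fixes X :: "nat \<Rightarrow> 'a::euclidean_space L2"
  assumes "Cauchy X"
  obtains r :: "nat \<Rightarrow> nat" where "strict_mono r" "AE x in lebesgue. convergent (\<lambda>k. rep_L2 (X (r k)) x)"
proof -
  obtain r :: "nat \<Rightarrow> nat" where r: "strict_mono r" "\<And>k. dist (X (r (Suc k))) (X (r k)) < (1/4)^k"
    using fast_Cauchy_subsequence[OF assms, of "\<lambda>k. (1/4)^k"] by auto
  define f where "f k = rep_L2 (X (r k))" for k
  define g where "g k x = f (Suc k) x - f k x" for k x
  have fm [measurable]: "f k \<in> borel_measurable lebesgue" for k unfolding f_def by (rule measurable_rep)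
  have gm [measurable]: "g k \<in> borel_measurable lebesgue" for k unfolding g_def by measurable
  have gk: "(\<integral>\<^sup>+x. ennreal (4^k * (g k x)\<^sup>2) \<partial>lebesgue) \<le> ennreal ((1/4)^k)" for k
  proof -
    have "(\<integral>\<^sup>+x. ennreal (4^k * (g k x)\<^sup>2) \<partial>lebesgue) = ennreal (4^k) * (\<integral>\<^sup>+x. ennreal ((g k x)\<^sup>2) \<partial>lebesgue)"
      by (subst nn_integral_cmult[symmetric]) (auto simp: ennreal_mult)
    also have "\<dots> = ennreal (4^k * (norm (X (r (Suc k)) - X (r k)))\<^sup>2)"
      by (simp add: norm_diff_L2_square g_def f_def ennreal_mult)
    also have "\<dots> \<le> ennreal (4^k * ((1/4)^k)\<^sup>2)"
      using r(2)[of k] by (intro ennreal_leI mult_left_mono power_mono) (auto simp: dist_norm)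
    also have "4^k * ((1/4::real)^k)\<^sup>2 = (1/4)^k" by (simp add: power2_eq_square power_one_over field_simps)
    finally show ?thesis .
  qed
  have "(\<integral>\<^sup>+x. (\<Sum>k. ennreal (4^k * (g k x)\<^sup>2)) \<partial>lebesgue) = (\<Sum>k. \<integral>\<^sup>+x. ennreal (4^k * (g k x)\<^sup>2) \<partial>lebesgue)"
    by (rule nn_integral_suminf) measurable
  also have "\<dots> \<le> (\<Sum>k. ennreal ((1/4)^k))" by (intro suminf_le gk) auto
  also have "\<dots> < \<infinity>"
    by (subst suminf_ennreal2) (auto intro: summable_geometric)
  finally have "(\<integral>\<^sup>+x. (\<Sum>k. ennreal (4^k * (g k x)\<^sup>2)) \<partial>lebesgue) \<noteq> \<infinity>" by simp
  then have "AE x in lebesgue. (\<Sum>k. ennreal (4^k * (g k x)\<^sup>2)) \<noteq> \<infinity>"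
    by (intro nn_integral_noteq_infinite) measurable
  then have "AE x in lebesgue. convergent (\<lambda>k. f k x)"
  proof (rule AE_mp, intro AE_I2 impI)
    fix x assume fin: "(\<Sum>k. ennreal (4^k * (g k x)\<^sup>2)) \<noteq> \<infinity>"
    define G where "G = enn2real (\<Sum>k. ennreal (4^k * (g k x)\<^sup>2))"
    have G: "(\<Sum>k. ennreal (4^k * (g k x)\<^sup>2)) = ennreal G" "0 \<le> G"
      using fin unfolding G_def by (simp_all add: ennreal_enn2real less_top)
    have bd: "\<bar>g k x\<bar> \<le> sqrt G * (1/2)^k" for k
    proof -
      have "ennreal (4^k * (g k x)\<^sup>2) \<le> ennreal G"
        unfolding G(1)[symmetric]
        using sum_le_suminf[OF summableI, of "{k}" "\<lambda>k. ennreal (4^k * (g k x)\<^sup>2)"]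
        by (simp only: finite.intros zero_le sum.insert sum.empty empty_iff not_False_eq_True add_0_right simp_thms)
      then have "4^k * (g k x)\<^sup>2 \<le> G" using G(2) by simp
      then have "(2^k * \<bar>g k x\<bar>)\<^sup>2 \<le> G"
        using power_even_eq[of "2::real" k] power_mult[of "2::real" 2 k] by (simp add: power_mult_distrib)
      then have "2^k * \<bar>g k x\<bar> \<le> sqrt G" by (rule real_le_rsqrt)
      then show ?thesis by (simp add: power_one_over field_simps)
    qed
    have "summable (\<lambda>k. g k x)"
      by (rule summable_comparison_test'[where N=0, OF summable_mult[OF summable_geometric[of "1/2::real"]]])
        (use bd in auto)
    then have "convergent (\<lambda>n. \<Sum>k<n. g k x)" by (simp add: summable_iff_convergent)
    moreover have "(\<Sum>k<n. g k x) = f n x - f 0 x" for n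
      unfolding g_def by (rule sum_lessThan_telescope)
    ultimately have "convergent (\<lambda>n. f n x - f 0 x)" by simp
    from convergent_add[OF this convergent_const[of "f 0 x"]] show "convergent (\<lambda>n. f n x)" by simp
  qed
  then show ?thesis using that r(1) by (simp add: f_def)
qed

text \<open>The pointwise limit \<open>F\<close> of the subsequence is the candidate, and Fatou
  turns distances between members of the subsequence into distances to \<open>F\<close>. A Cauchy
  sequence with a convergent subsequence converges.\<close>

lemma L2_complete:
  fixes X :: "nat \<Rightarrow> 'a::euclidean_space L2"
  assumes "Cauchy X"
  shows "\<exists>L. X \<longlonglongrightarrow> L"
proof -
  obtain r :: "nat \<Rightarrow> nat" where r: "strict_mono r" "AE x in lebesgue. convergent (\<lambda>k. rep_L2 (X (r k)) x)"
    using L2_AE_convergent_subsequence[OF assms] .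
  define f where "f k = rep_L2 (X (r k))" for k
  define F where "F x = lim (\<lambda>k. f k x)" for x
  have fm [measurable]: "f k \<in> borel_measurable lebesgue" for k unfolding f_def by (rule measurable_rep)
  have Fm [measurable]: "F \<in> borel_measurable lebesgue" unfolding F_def by measurable
  have fatou: "(\<integral>\<^sup>+x. ennreal ((F x - f m x)\<^sup>2) \<partial>lebesgue) \<le> ennreal (e\<^sup>2)"
    if "\<forall>k\<ge>m. dist (X (r k)) (X (r m)) \<le> e" for m e
  proof -
    have "(\<integral>\<^sup>+x. ennreal ((F x - f m x)\<^sup>2) \<partial>lebesgue) =
      (\<integral>\<^sup>+x. liminf (\<lambda>k. ennreal ((f k x - f m x)\<^sup>2)) \<partial>lebesgue)"
    proof (rule nn_integral_cong_AE, rule AE_mp[OF r(2)], intro AE_I2 impI)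
      fix x assume "convergent (\<lambda>k. rep_L2 (X (r k)) x)"
      then have "(\<lambda>k. f k x) \<longlonglongrightarrow> F x" by (simp add: F_def f_def convergent_LIMSEQ_iff)
      then have "(\<lambda>k. ennreal ((f k x - f m x)\<^sup>2)) \<longlonglongrightarrow> ennreal ((F x - f m x)\<^sup>2)"
        by (intro tendsto_ennrealI tendsto_intros)
      then show "ennreal ((F x - f m x)\<^sup>2) = liminf (\<lambda>k. ennreal ((f k x - f m x)\<^sup>2))"
        by (intro lim_imp_Liminf[symmetric]) auto
    qed
    also have "\<dots> \<le> liminf (\<lambda>k. \<integral>\<^sup>+x. ennreal ((f k x - f m x)\<^sup>2) \<partial>lebesgue)"
      by (rule nn_integral_liminf) measurable
    also have "\<dots> = liminf (\<lambda>k. ennreal ((dist (X (r k)) (X (r m)))\<^sup>2))"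
      by (simp add: f_def dist_norm norm_diff_L2_square)
    also have "\<dots> \<le> ennreal (e\<^sup>2)"
      by (rule Liminf_le)
        (use that in \<open>auto simp: eventually_sequentially intro!: exI[of _ m] ennreal_leI power_mono\<close>)
    finally show ?thesis .
  qed
  have cr: "\<exists>N. \<forall>m\<ge>N. \<forall>k\<ge>m. dist (X (r k)) (X (r m)) \<le> e" if "0 < e" for e
  proof -
    obtain N where N: "\<And>m n. m \<ge> N \<Longrightarrow> n \<ge> N \<Longrightarrow> dist (X m) (X n) < e"
      using metric_CauchyD[OF assms \<open>0 < e\<close>] by blast
    have "N \<le> r k" if "N \<le> k" for k using seq_suble[OF r(1), of k] that by simp
    then show ?thesis using N by (meson le_trans less_imp_le)
  qed
  \<comment> \<open>The distance bound 1 shows that \<open>F - f N\<close> is square integrable;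
    adding \<open>f N\<close> gives the same for \<open>F\<close>, which makes
    \<open>abs_L2 F\<close> meaningful.\<close>
  obtain N where "\<forall>m\<ge>N. \<forall>k\<ge>m. dist (X (r k)) (X (r m)) \<le> 1" using cr[of 1] by auto
  then have "(\<integral>\<^sup>+x. ennreal ((F x - f N x)\<^sup>2) \<partial>lebesgue) \<le> ennreal (1\<^sup>2)" by (intro fatou) simp
  also have "\<dots> < \<infinity>" by simp
  finally have "square_integrable (\<lambda>x. F x - f N x)"
    by (simp add: square_integrable_iff_nn_integral)
  from square_integrable_add[OF this square_integrable_rep[of "X (r N)"]]
  have F: "square_integrable F" by (simp add: f_def)
  have dF: "ennreal ((dist (abs_L2 F) (X (r m)))\<^sup>2) = (\<integral>\<^sup>+x. ennreal ((F x - f m x)\<^sup>2) \<partial>lebesgue)" for m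
    unfolding dist_norm norm_diff_L2_square f_def
    by (rule nn_integral_cong_AE) (use rep_abs_L2[OF F] in auto)
  have "(X \<circ> r) \<longlonglongrightarrow> abs_L2 F"
  proof (rule metric_LIMSEQ_I)
    fix e :: real assume "0 < e"
    then obtain N where N: "\<forall>m\<ge>N. \<forall>k\<ge>m. dist (X (r k)) (X (r m)) \<le> e / 2" using cr[of "e/2"] by (meson half_gt_zero)
    have "dist ((X \<circ> r) m) (abs_L2 F) < e" if "m \<ge> N" for m
    proof -
      have "ennreal ((dist (abs_L2 F) (X (r m)))\<^sup>2) \<le> ennreal ((e/2)\<^sup>2)"
        unfolding dF using N that by (intro fatou) simp
      then have "(dist (abs_L2 F) (X (r m)))\<^sup>2 \<le> (e/2)\<^sup>2" by (rule ennreal_le_iff[THEN iffD1, rotated]) simp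
      then have "dist (abs_L2 F) (X (r m)) \<le> e/2" by (rule power2_le_imp_le) (use \<open>0 < e\<close> in simp)
      then show ?thesis using \<open>0 < e\<close> by (simp add: dist_commute)
    qed
    then show "\<exists>no. \<forall>n\<ge>no. dist ((X \<circ> r) n) (abs_L2 F) < e" by blast
  qed
  from Cauchy_converges_subseq[OF assms r(1) this] show ?thesis by blast
qed

section \<open>The closed subspace of functions supported in a domain\<close>

lemma L2_on_subspace: "subspace (L2_on \<Omega>)"
proof (rule subspaceI)
  show "0 \<in> L2_on \<Omega>" using rep_zero by (auto simp: L2_on_def)
next
  fix v w assume "v \<in> L2_on \<Omega>" "w \<in> L2_on \<Omega>"
  then show "v + w \<in> L2_on \<Omega>" using rep_add[of v w] unfolding L2_on_def by auto
next
  fix v c assume "v \<in> L2_on \<Omega>"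
  then show "c *\<^sub>R v \<in> L2_on \<Omega>" using rep_scaleR[of c v] unfolding L2_on_def by auto
qed

lemma square_integrable_indicator_mult:
  assumes "square_integrable f" "S \<in> sets lebesgue"
  shows "square_integrable (\<lambda>x. indicator S x * f x)"
proof -
  have [measurable]: "f \<in> borel_measurable lebesgue" "S \<in> sets lebesgue" using assms by (auto simp: square_integrable_def)
  have "integrable lebesgue (\<lambda>x. (indicator S x * f x)\<^sup>2)"
    by (rule Bochner_Integration.integrable_bound[of _ "\<lambda>x. (f x)\<^sup>2"])
      (use assms in \<open>auto simp: square_integrable_def indicator_def\<close>)
  then show ?thesis by (simp add: square_integrable_def)
qed

text \<open>Test with the part \<open>f\<close> of \<open>v\<close> outside the domain: every
  \<open>X n\<close> is orthogonal to it, hence so is \<open>v\<close>, while the inner product of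
  \<open>v\<close> with \<open>f\<close> is the squared norm of \<open>f\<close>.\<close>

lemma L2_on_closed:
  assumes "\<Omega> \<in> sets lebesgue" "\<And>n. X n \<in> L2_on \<Omega>" "X \<longlonglongrightarrow> v"
  shows "v \<in> L2_on \<Omega>"
proof -
  define f where "f x = indicator (- \<Omega>) x * rep_L2 v x" for x
  have "- \<Omega> \<in> sets lebesgue" using assms(1) by (simp add: Compl_in_sets_lebesgue)
  then have f: "square_integrable f"
    unfolding f_def by (intro square_integrable_indicator_mult square_integrable_rep)
  have "X n \<bullet> abs_L2 f = 0" for n
  proof -
    have "X n \<bullet> abs_L2 f = (LINT x|(lebesgue::'a measure). 0)"
      unfolding inner_rep_abs[OF f]
    proof (rule integral_cong_AE)
      show "(\<lambda>x. rep_L2 (X n) x * f x) \<in> borel_measurable lebesgue"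
        using f measurable_rep by (intro borel_measurable_times) (auto simp: square_integrable_def)
      show "AE x in lebesgue. rep_L2 (X n) x * f x = 0"
        using assms(2)[of n] unfolding L2_on_def f_def mem_Collect_eq
        by (rule AE_mp) (rule AE_I2, auto simp: indicator_def)
    qed simp
    then show ?thesis by simp
  qed
  moreover have "(\<lambda>n. X n \<bullet> abs_L2 f) \<longlonglongrightarrow> v \<bullet> abs_L2 f" by (intro tendsto_intros assms(3))
  ultimately have 0: "v \<bullet> abs_L2 f = 0" by (simp add: LIMSEQ_const_iff)
  have "abs_L2 f \<bullet> abs_L2 f = v \<bullet> abs_L2 f"
    unfolding inner_abs_L2[OF f f] inner_rep_abs[OF f, of v]
    by (intro Bochner_Integration.integral_cong refl) (auto simp: f_def indicator_def)
  then have "abs_L2 f = 0" using 0 by simp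
  then have "AE x in lebesgue. rep_L2 (abs_L2 f) x = 0" using rep_zero by simp
  then have "AE x in lebesgue. x \<notin> \<Omega> \<longrightarrow> rep_L2 v x = 0"
    using rep_abs_L2[OF f] by eventually_elim (auto simp: f_def indicator_def)
  then show ?thesis by (simp add: L2_on_def)
qed

section \<open>Smooth functions and bumps\<close>

lemma grad_eqI: "(f has_derivative f') (at x) \<Longrightarrow> grad f x $ j = f' (axis j 1)"
  using frechet_derivative_at[of f f' x] by (simp add: grad_def)

lemma frechet_derivative_eq_grad:
  fixes f :: "real^'n \<Rightarrow> real"
  assumes "f differentiable (at x)"
  shows "frechet_derivative f (at x) h = grad f x \<bullet> h"
proof -
  interpret bounded_linear "frechet_derivative f (at x)"
    using assms frechet_derivative_works has_derivative_bounded_linear by blast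
  have "frechet_derivative f (at x) h = frechet_derivative f (at x) (\<Sum>j\<in>UNIV. h $ j *\<^sub>R axis j 1)"
    by (simp add: basis_expansion flip: scalar_mult_eq_scaleR)
  also have "\<dots> = grad f x \<bullet> h" by (simp add: sum scaleR inner_vec_def grad_def mult.commute)
  finally show ?thesis .
qed

lemma has_derivative_grad:
  fixes f :: "real^'n \<Rightarrow> real"
  assumes "f differentiable (at x)"
  shows "(f has_derivative (\<lambda>h. grad f x \<bullet> h)) (at x)"
proof -
  have "frechet_derivative f (at x) = (\<lambda>h. grad f x \<bullet> h)"
    using frechet_derivative_eq_grad[OF assms] by blast
  then show ?thesis using assms frechet_derivative_works[of f "at x"] by simp
qed

lemma grad_eq_zero_if_locally_constant:
  fixes f :: "real^'n \<Rightarrow> real"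
  assumes "open U" "x \<in> U" "\<And>y. y \<in> U \<Longrightarrow> f y = c"
  shows "grad f x = 0"
proof -
  have "(f has_derivative (\<lambda>_. 0)) (at x)"
    by (rule has_derivative_transform_within_open[OF has_derivative_const[of c] assms(1,2)]) (simp add: assms(3))
  from grad_eqI[OF this] show ?thesis by (simp add: vec_eq_iff)
qed

lemma times_differentiable_continuous: "times_differentiable k f \<Longrightarrow> continuous_on UNIV f"
  by (cases k) (auto intro: differentiable_imp_continuous_within simp: continuous_on_eq_continuous_within)

lemma times_differentiable_Suc_D: "times_differentiable (Suc k) f \<Longrightarrow> times_differentiable k f"
proof (induction k arbitrary: f)
  case 0
  from times_differentiable_continuous[OF this] show ?case by simp
qed auto

lemma times_differentiable_const: "times_differentiable k (\<lambda>_::real^'n. c)"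
proof (induction k arbitrary: c)
  case (Suc k)
  have "grad (\<lambda>_. c) x $ j = 0" for x :: "real^'n" and j
    by (rule grad_eqI[OF has_derivative_const])
  then show ?case using Suc[of 0] by simp
qed simp

lemma times_differentiable_add:
  "times_differentiable k f \<Longrightarrow> times_differentiable k g \<Longrightarrow> times_differentiable k (\<lambda>x. f x + g x)"
proof (induction k arbitrary: f g)
  case (Suc k)
  then have d: "f differentiable (at x)" "g differentiable (at x)" for x by auto
  have "grad (\<lambda>x. f x + g x) x $ j = grad f x $ j + grad g x $ j" for x j
    using grad_eqI[OF has_derivative_add[OF has_derivative_grad[OF d(1)] has_derivative_grad[OF d(2)]]]
    by (simp add: inner_axis)
  then show ?case using Suc by simp
qed (simp add: continuous_on_add)

lemma times_differentiable_mult: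
  "times_differentiable k f \<Longrightarrow> times_differentiable k g \<Longrightarrow> times_differentiable k (\<lambda>x. f x * g x)"
proof (induction k arbitrary: f g)
  case (Suc k)
  then have d: "f differentiable (at x)" "g differentiable (at x)" for x by auto
  have "grad (\<lambda>x. f x * g x) x $ j = f x * grad g x $ j + grad f x $ j * g x" for x j
    using grad_eqI[OF has_derivative_mult[OF has_derivative_grad[OF d(1)] has_derivative_grad[OF d(2)]]]
    by (simp add: inner_axis)
  moreover have "times_differentiable k f" "times_differentiable k g"
    using Suc.prems by (auto intro: times_differentiable_Suc_D)
  ultimately show ?case
    using Suc by (auto intro!: times_differentiable_add Suc.IH)
qed (simp add: continuous_on_mult)

lemma times_differentiable_sum:
  "(\<And>i. i \<in> I \<Longrightarrow> times_differentiable k (f i)) \<Longrightarrow> times_differentiable k (\<lambda>x. \<Sum>i\<in>I. f i x)"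
  by (induction I rule: infinite_finite_induct)
    (auto intro: times_differentiable_const times_differentiable_add)

lemma times_differentiable_prod:
  "(\<And>i. i \<in> I \<Longrightarrow> times_differentiable k (f i)) \<Longrightarrow> times_differentiable k (\<lambda>x. \<Prod>i\<in>I. f i x)"
  by (induction I rule: infinite_finite_induct)
    (auto intro: times_differentiable_const times_differentiable_mult)

text \<open>A whole chain of derivatives is given, because a partial derivative of
  \<open>D n\<close> is \<open>D (Suc n)\<close> up to a factor 0 or 1 and the induction must
  continue with it.\<close>

lemma times_differentiable_component:
  fixes D :: "nat \<Rightarrow> real \<Rightarrow> real"
  assumes "\<And>n t. (D n has_real_derivative D (Suc n) t) (at t)"
  shows "times_differentiable k (\<lambda>x::real^'n. D n (x $ i))"
proof (induction k arbitrary: n)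
  case 0
  have "continuous_on UNIV (D n)"
    using assms by (intro continuous_at_imp_continuous_on ballI) (rule DERIV_isCont)
  from continuous_on_compose2[OF this, of UNIV "\<lambda>x::real^'n. x $ i"]
  show ?case by (simp add: continuous_on_component)
next
  case (Suc k)
  have *: "((\<lambda>x::real^'n. D n (x $ i)) has_derivative (\<lambda>h. D (Suc n) (x $ i) * h $ i)) (at x)" for x
    using assms[of n "x $ i"] unfolding has_field_derivative_def
    by (rule has_derivative_compose[OF bounded_linear_imp_has_derivative[OF bounded_linear_vec_nth]])
  have "grad (\<lambda>x::real^'n. D n (x $ i)) x $ j = (if i = j then 1 else 0) * D (Suc n) (x $ i)" for x j
    using grad_eqI[OF *] by (simp add: axis_def)
  then show ?case using * Suc
    by (auto simp: differentiable_def intro!: times_differentiable_mult times_differentiable_const)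
qed

text \<open>The derivatives of \<open>exp (-1/t)\<close>, extended by \<open>0\<close> to \<open>t \<le> 0\<close>, have the form
  \<open>p (1/t) * exp (-1/t)\<close> with polynomials \<open>p\<close>.\<close>

primrec bump_poly :: "nat \<Rightarrow> real poly" where
  "bump_poly 0 = 1"
| "bump_poly (Suc n) = [:0, 0, 1:] * (bump_poly n - pderiv (bump_poly n))"

definition bump_deriv :: "nat \<Rightarrow> real \<Rightarrow> real" where
  "bump_deriv n t = (if t \<le> 0 then 0 else poly (bump_poly n) (1 / t) * exp (- (1 / t)))"

text \<open>The free power \<open>s ^ k\<close> lets the induction over coefficients run: splitting
  off the constant coefficient raises \<open>k\<close> by one.\<close>

lemma tendsto_poly_exp_at_top: "((\<lambda>s. s ^ k * poly p s * exp (- s)) \<longlongrightarrow> (0::real)) at_top"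
proof (induction p arbitrary: k)
  case (pCons a p)
  have "((\<lambda>s. a * (s ^ k / exp s) + s ^ Suc k * poly p s * exp (- s)) \<longlongrightarrow> a * 0 + (0::real)) at_top"
    by (intro tendsto_intros tendsto_power_div_exp_0 pCons.IH)
  then show ?case by (simp add: exp_minus field_simps)
qed simp

lemma bump_deriv_has_derivative: "(bump_deriv n has_real_derivative bump_deriv (Suc n) t) (at t)"
proof (cases t "0::real" rule: linorder_cases)
  case less
  have "((\<lambda>_. 0) has_real_derivative 0) (at t)" by simp
  then have "(bump_deriv n has_real_derivative 0) (at t)"
    by (rule has_field_derivative_transform_within_open[of _ _ _ "{..<0}"])
      (use less in \<open>auto simp: bump_deriv_def\<close>)
  then show ?thesis using less by (simp add: bump_deriv_def)
next
  case greater
  have "((\<lambda>t. poly (bump_poly n) (1 / t) * exp (- (1 / t))) has_real_derivative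
      poly (bump_poly (Suc n)) (1 / t) * exp (- (1 / t))) (at t)"
    using greater by (auto intro!: derivative_eq_intros DERIV_chain2[OF poly_DERIV]
        simp: field_simps power2_eq_square)
  then have "(bump_deriv n has_real_derivative poly (bump_poly (Suc n)) (1 / t) * exp (- (1 / t))) (at t)"
    by (rule has_field_derivative_transform_within_open[of _ _ _ "{0<..}"])
      (use greater in \<open>auto simp: bump_deriv_def\<close>)
  then show ?thesis using greater by (simp add: bump_deriv_def)
next
  case equal
  have "((\<lambda>h. bump_deriv n h / h) \<longlongrightarrow> 0) (at_right 0)"
  proof -
    \<comment> \<open>Substituting \<open>s = 1 / h\<close> turns the difference quotient at 0 into
      a polynomial in \<open>s\<close> times \<open>exp (- s)\<close>; the exponent 1 is the factor
      \<open>1 / h\<close>.\<close>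
    have "((\<lambda>h. (inverse h) ^ 1 * poly (bump_poly n) (inverse h) * exp (- inverse h)) \<longlongrightarrow> 0) (at_right 0)"
      by (rule filterlim_compose[OF tendsto_poly_exp_at_top filterlim_inverse_at_top_right])
    moreover have "eventually (\<lambda>h. (inverse h) ^ 1 * poly (bump_poly n) (inverse h) * exp (- inverse h)
        = bump_deriv n h / h) (at_right (0::real))"
      by (intro eventually_at_rightI[of 0 1]) (auto simp: bump_deriv_def field_simps)
    ultimately show ?thesis by (rule Lim_transform_eventually)
  qed
  moreover have "((\<lambda>h. bump_deriv n h / h) \<longlongrightarrow> 0) (at_left 0)"
    by (rule Lim_transform_eventually[OF tendsto_const])
      (auto simp: bump_deriv_def intro!: eventually_at_leftI[of "-1"])
  ultimately have "((\<lambda>h. bump_deriv n h / h) \<longlongrightarrow> 0) (at 0)"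
    by (simp add: filterlim_split_at)
  moreover have "bump_deriv n 0 = 0" "bump_deriv (Suc n) 0 = 0" by (simp_all add: bump_deriv_def)
  ultimately show ?thesis unfolding equal DERIV_def by simp
qed

text \<open>The factor \<open>c\<close> sharpens the flanks: \<open>exp (-1 / (c t))\<close> tends
  to 1 for each \<open>t > 0\<close>, so for growing \<open>c\<close> the bumps converge pointwise
  to the indicator of the open box, with unchanged support.\<close>

definition box_bump :: "real^'n \<Rightarrow> real^'n \<Rightarrow> real \<Rightarrow> real^'n \<Rightarrow> real" where
  "box_bump a b c x = (\<Prod>i\<in>UNIV. bump_deriv 0 (c * (x $ i - a $ i)) * bump_deriv 0 (c * (b $ i - x $ i)))"

lemma bump_deriv_0: "bump_deriv 0 t = (if t \<le> 0 then 0 else exp (- (1 / t)))"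
  by (simp add: bump_deriv_def)

lemma box_bump_nonzero_iff: "0 < c \<Longrightarrow> box_bump a b c x \<noteq> 0 \<longleftrightarrow> x \<in> box a b"
  by (auto simp: box_bump_def bump_deriv_0 mem_box_cart mult_le_0_iff not_le)

lemma box_bump_bounds: "0 \<le> box_bump a b c x" "box_bump a b c x \<le> 1"
  unfolding box_bump_def
  by (auto intro!: prod_nonneg prod_le_1 mult_nonneg_nonneg mult_le_one simp: bump_deriv_0)

lemma box_bump_smooth: "times_differentiable k (box_bump a b c)"
proof -
  have chain: "((\<lambda>t. s ^ n * bump_deriv n (s * t + d)) has_real_derivative s ^ Suc n * bump_deriv (Suc n) (s * t + d)) (at t)" for n s d t
  proof -
    have "((\<lambda>t. bump_deriv n (s * t + d)) has_real_derivative bump_deriv (Suc n) (s * t + d) * s) (at t)"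
      by (rule DERIV_chain2[OF bump_deriv_has_derivative]) (auto intro!: derivative_eq_intros)
    from DERIV_cmult[OF this, of "s ^ n"] show ?thesis by (simp add: mult_ac)
  qed
  have "times_differentiable k (\<lambda>x::real^'n. bump_deriv 0 (s * x $ i + d))" for s d i
    using times_differentiable_component[of "\<lambda>n t. s ^ n * bump_deriv n (s * t + d)", OF chain, of k 0 i] by simp
  from this[of c _ "- c * a $ _"] this[of "- c" _ "c * b $ _"] show ?thesis
    unfolding box_bump_def by (intro times_differentiable_prod times_differentiable_mult) (simp_all add: algebra_simps)
qed

lemma box_bump_tendsto: "(\<lambda>n. box_bump a b (real (Suc n)) x) \<longlonglongrightarrow> indicator (box a b) x"
proof (cases "x \<in> box a b")
  case True
  have *: "(\<lambda>n. bump_deriv 0 (real (Suc n) * t)) \<longlonglongrightarrow> 1" if t: "0 < t" for t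
  proof -
    have "(\<lambda>n. exp (- (1 / t * inverse (real (Suc n))))) \<longlonglongrightarrow> exp (- (1 / t * 0))"
      by (intro tendsto_intros LIMSEQ_inverse_real_of_nat)
    moreover have "bump_deriv 0 (real (Suc n) * t) = exp (- (1 / t * inverse (real (Suc n))))" for n
      using t mult_pos_pos[of "real (Suc n)" t] by (simp add: bump_deriv_0 field_simps)
    ultimately show ?thesis by simp
  qed
  have "(\<lambda>n. box_bump a b (real (Suc n)) x) \<longlonglongrightarrow> (\<Prod>i\<in>(UNIV::'a set). 1 * 1)"
    unfolding box_bump_def using True by (intro tendsto_prod tendsto_mult *) (auto simp: mem_box_cart)
  then show ?thesis using True by simp
next
  case False
  then have "box_bump a b (real (Suc n)) x = 0" for n using box_bump_nonzero_iff[of "real (Suc n)" a b x] by auto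
  then show ?thesis using False by simp
qed

lemma box_bump_test_function:
  assumes "0 < c" "cbox a b \<subseteq> \<Omega>"
  shows "box_bump a b c \<in> test_functions \<Omega>"
proof -
  have eq: "{x. box_bump a b c x \<noteq> 0} = box a b" using box_bump_nonzero_iff[OF assms(1)] by blast
  have "closure (box a b) \<subseteq> cbox a b" by (rule closure_minimal) (auto simp: box_subset_cbox)
  then show ?thesis
    using assms(2) box_bump_smooth by (auto simp: test_functions_def eq compact_closure bounded_box)
qed

section \<open>Weak derivatives\<close>

text \<open>Dynkin argument: open boxes form an intersection-stable generator of the Borel sets, and
  the vanishing total integral handles complements. Integrating over the sets where the function has
  one sign then yields 0 almost everywhere.\<close>

lemma AE_zero_if_box_integrals_zero:
  fixes f :: "'a::euclidean_space \<Rightarrow> real"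
  assumes f: "integrable lebesgue f" and total: "(LINT x|lebesgue. f x) = 0"
    and boxes: "\<And>a b. (LINT x:box a b|lebesgue. f x) = 0"
  shows "AE x in lebesgue. f x = 0"
proof -
  have si: "set_integrable lebesgue A f" if "A \<in> sets borel" for A
    using f that unfolding set_integrable_def by (intro integrable_mult_indicator) auto
  have stable: "Int_stable (range (\<lambda>(a, b). box a b :: 'a set))"
    by (auto simp: Int_stable_def box_Int_box)
  have closed: "range (\<lambda>(a, b). box a b :: 'a set) \<subseteq> Pow UNIV" by simp
  have "(LINT x:A|lebesgue. f x) = 0" if "A \<in> sigma_sets UNIV (range (\<lambda>(a, b). box a b))" for A
    using stable closed that
  proof (induction rule: sigma_sets_induct_disjoint)
    fix A assume "A \<in> range (\<lambda>(a, b). box a b :: 'a set)"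
    then show "(LINT x:A|lebesgue. f x) = 0" using boxes by auto
  next
    show "(LINT x:{}|lebesgue. f x) = 0" by (simp add: set_lebesgue_integral_def)
  next
    fix A :: "'a set" assume A: "A \<in> sigma_sets UNIV (range (\<lambda>(a, b). box a b))" "(LINT x:A|lebesgue. f x) = 0"
    then have A': "A \<in> sets borel" unfolding borel_eq_box by simp
    have "(LINT x:A \<union> (UNIV - A)|lebesgue. f x) = (LINT x:A|lebesgue. f x) + (LINT x:UNIV - A|lebesgue. f x)"
      by (rule set_integral_Un) (use A' in \<open>auto intro!: si\<close>)
    then show "(LINT x:UNIV - A|lebesgue. f x) = 0" using A(2) total by (simp add: set_lebesgue_integral_def)
  next
    fix A :: "nat \<Rightarrow> 'a set"
    assume A: "disjoint_family A" "range A \<subseteq> sigma_sets UNIV (range (\<lambda>(a, b). box a b))"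
      "\<And>i. (LINT x:A i|lebesgue. f x) = 0"
    have A': "A i \<in> sets borel" for i using A(2) unfolding borel_eq_box by auto
    have "(LINT x:(\<Union>i. A i)|lebesgue. f x) = (\<Sum>i. (LINT x:A i|lebesgue. f x))"
      using A' A(1) by (intro lebesgue_integral_countable_add si) (auto simp: disjoint_family_on_def)
    then show "(LINT x:(\<Union>i. A i)|lebesgue. f x) = 0" using A(3) by simp
  qed
  then have zero: "(LINT x:A|lebesgue. f x) = 0" if "A \<in> sets borel" for A
    using that unfolding borel_eq_box by simp
  \<comment> \<open>The integrals are known to vanish over Borel sets only, so the sign sets are
    taken from a Borel representative.\<close>
  obtain f' where f': "f' \<in> borel_measurable lborel" "AE x in lborel. f x = f' x"
    using completion_ex_borel_measurable_real[OF borel_measurable_integrable[OF f]] by blast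
  have ae: "AE x in lebesgue. f x = f' x" using f'(2) by (rule AE_completion)
  have *: "AE x in lebesgue. indicator A x * f x = 0"
    if A: "A \<in> sets borel" and s: "s = 1 \<or> s = - 1" "\<And>x. x \<in> A \<Longrightarrow> 0 \<le> s * f' x" for A s
  proof -
    have i: "integrable lebesgue (\<lambda>x. s * (indicator A x * f x))"
      using si[OF A] by (simp add: set_integrable_def)
    have "(LINT x|lebesgue. s * (indicator A x * f x)) = 0"
      using zero[OF A] by (simp add: set_lebesgue_integral_def)
    moreover have "AE x in lebesgue. 0 \<le> s * (indicator A x * f x)"
      using ae by eventually_elim (use s in \<open>auto simp: indicator_def\<close>)
    ultimately have "AE x in lebesgue. s * (indicator A x * f x) = 0"
      using integral_nonneg_eq_0_iff_AE[OF i] by simp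
    then show ?thesis by eventually_elim (use s in auto)
  qed
  have [measurable]: "f' \<in> borel_measurable borel" using f'(1) by simp
  have m: "{x. 0 \<le> f' x} \<in> sets borel" "{x. f' x \<le> 0} \<in> sets borel" by measurable
  have "AE x in lebesgue. indicator {x. 0 \<le> f' x} x * f x = 0" "AE x in lebesgue. indicator {x. f' x \<le> 0} x * f x = 0"
    by (rule *[of _ 1] *[of _ "-1"]; simp add: m)+
  then show ?thesis by eventually_elim (auto simp: indicator_def split: if_splits)
qed

lemma integral_eq_L2_inner:
  assumes "square_integrable f" "\<And>x. x \<notin> \<Omega> \<Longrightarrow> f x = 0"
  shows "(LINT x:\<Omega>|lebesgue. rep_L2 v x * f x) = v \<bullet> abs_L2 f"
  unfolding inner_rep_abs[OF assms(1)] set_lebesgue_integral_def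
  using assms(2) by (intro Bochner_Integration.integral_cong) (auto simp: indicator_def)

lemma abs_L2_in_L2_on:
  assumes "square_integrable f" "\<And>x. x \<notin> \<Omega> \<Longrightarrow> f x = 0"
  shows "abs_L2 f \<in> L2_on \<Omega>"
  using rep_abs_L2[OF assms(1)] assms(2) unfolding L2_on_def by auto

lemma borel_measurable_continuous_UNIV: "continuous_on UNIV f \<Longrightarrow> f \<in> borel_measurable lborel"
  by (simp add: borel_measurable_continuous_onI)

lemma integrable_continuous_compact_support:
  fixes f :: "'a::euclidean_space \<Rightarrow> real"
  assumes "continuous_on UNIV f" "compact S" "\<And>x. x \<notin> S \<Longrightarrow> f x = 0"
  shows "integrable lborel f" "integrable lebesgue f"
proof -
  have eq: "(\<lambda>x. indicator S x *\<^sub>R f x) = f" by (rule ext) (use assms(3) in \<open>auto simp: indicator_def\<close>)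
  show 1: "integrable lborel f"
    using borel_integrable_compact[OF assms(2) continuous_on_subset[OF assms(1)]] unfolding eq by simp
  then show "integrable lebesgue f"
    using integrable_completion[OF borel_measurable_continuous_UNIV[OF assms(1)]] by blast
qed

lemma square_integrable_continuous_compact_support:
  fixes f :: "'a::euclidean_space \<Rightarrow> real"
  assumes "continuous_on UNIV f" "compact S" "\<And>x. x \<notin> S \<Longrightarrow> f x = 0"
  shows "square_integrable f"
  unfolding square_integrable_def
proof
  show "f \<in> borel_measurable lebesgue"
    using integrable_continuous_compact_support(2)[OF assms] by (rule borel_measurable_integrable)
  show "integrable lebesgue (\<lambda>x. (f x)\<^sup>2)"
    using assms by (intro integrable_continuous_compact_support(2)[of _ S] continuous_intros) auto
qed

lemma test_functionD:
  assumes "\<phi> \<in> test_functions \<Omega>"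
  shows "times_differentiable k \<phi>" "continuous_on UNIV \<phi>" "\<phi> differentiable (at x)"
    "compact (closure {x. \<phi> x \<noteq> 0})" "x \<notin> closure {x. \<phi> x \<noteq> 0} \<Longrightarrow> \<phi> x = 0"
    "x \<notin> \<Omega> \<Longrightarrow> \<phi> x = 0" "square_integrable \<phi>"
proof -
  show td: "times_differentiable k \<phi>" for k using assms by (simp add: test_functions_def)
  show c: "continuous_on UNIV \<phi>" using times_differentiable_continuous[OF td] .
  show "\<phi> differentiable (at x)" using td[of "Suc 0"] by simp
  show comp: "compact (closure {x. \<phi> x \<noteq> 0})" using assms by (simp add: test_functions_def)
  show z: "x \<notin> closure {x. \<phi> x \<noteq> 0} \<Longrightarrow> \<phi> x = 0" for x using closure_subset[of "{x. \<phi> x \<noteq> 0}"] by blast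
  have "closure {x. \<phi> x \<noteq> 0} \<subseteq> \<Omega>" using assms by (simp add: test_functions_def)
  then show "x \<notin> \<Omega> \<Longrightarrow> \<phi> x = 0" using z by blast
  show "square_integrable \<phi>" using square_integrable_continuous_compact_support[OF c comp z] .
qed

lemma compact_closure_subset:
  fixes A :: "'a::heine_borel set"
  shows "compact (closure B) \<Longrightarrow> closure A \<subseteq> closure B \<Longrightarrow> compact (closure A)"
  using compact_Int_closed[of "closure B" "closure A"] by (simp add: Int_absorb1)

lemma test_function_grad:
  assumes "\<phi> \<in> test_functions \<Omega>"
  shows "(\<lambda>x. grad \<phi> x $ j) \<in> test_functions \<Omega>"
proof -
  have z: "grad \<phi> x $ j = 0" if "x \<notin> closure {x. \<phi> x \<noteq> 0}" for x
  proof -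
    have "grad \<phi> x = 0"
    proof (rule grad_eq_zero_if_locally_constant)
      show "open (- closure {x. \<phi> x \<noteq> 0})" by (rule open_Compl) (rule closed_closure)
      show "x \<in> - closure {x. \<phi> x \<noteq> 0}" using that by simp
      show "\<phi> y = 0" if "y \<in> - closure {x. \<phi> x \<noteq> 0}" for y
        using test_functionD(5)[OF assms, of y] that by blast
    qed
    then show ?thesis by simp
  qed
  have "closure {x. grad \<phi> x $ j \<noteq> 0} \<subseteq> closure {x. \<phi> x \<noteq> 0}"
    using z by (intro closure_minimal closed_closure subsetI) (metis mem_Collect_eq)
  moreover have "times_differentiable k (\<lambda>x. grad \<phi> x $ j)" for k using test_functionD(1)[OF assms, of "Suc k"] by simp
  ultimately show ?thesis
    using assms unfolding test_functions_def
    using compact_closure_subset by blast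
qed

lemma test_function_mult:
  assumes "\<phi> \<in> test_functions \<Omega>" "\<psi> \<in> test_functions \<Omega>"
  shows "(\<lambda>x. \<phi> x * \<psi> x) \<in> test_functions \<Omega>"
proof -
  have "closure {x. \<phi> x * \<psi> x \<noteq> 0} \<subseteq> closure {x. \<phi> x \<noteq> 0}" by (intro closure_mono) auto
  then show ?thesis
    using assms unfolding test_functions_def
    using compact_closure_subset times_differentiable_mult by blast
qed

text \<open>Fundamental lemma of the calculus of variations. Dominated convergence of box bumps
  gives vanishing integrals over boxes whose closure lies in the domain; the function then vanishes
  on each such closed box, and countably many of them exhaust the open set.\<close>

lemma L2_eq_zero_if_orthogonal_to_test_functions:
  fixes g :: "(real^'n) L2"
  assumes "open \<Omega>" "g \<in> L2_on \<Omega>" "\<And>\<phi>. \<phi> \<in> test_functions \<Omega> \<Longrightarrow> g \<bullet> abs_L2 \<phi> = 0"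
  shows "g = 0"
proof -
  have cbox_int: "integrable lebesgue (\<lambda>x. indicator (cbox a b) x * rep_L2 g x)" for a b
  proof -
    have "square_integrable (\<lambda>x::real^'n. indicator (cbox a b) x)"
      unfolding square_integrable_def
      using emeasure_compact_finite[OF compact_cbox, of a b]
      by (auto simp: power2_eq_square indicator_inter_arith[symmetric] intro!: integrable_real_indicator borel_measurable_indicator)
    from square_integrable_mult[OF this square_integrable_rep] show ?thesis .
  qed
  have box: "(LINT x:box a b|lebesgue. rep_L2 g x) = 0" if ab: "cbox a b \<subseteq> \<Omega>" for a b
  proof -
    have t: "box_bump a b (real (Suc n)) \<in> test_functions \<Omega>" for n by (rule box_bump_test_function) (auto simp: ab)
    have "(\<lambda>n. LINT x|lebesgue. rep_L2 g x * box_bump a b (real (Suc n)) x)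
        \<longlonglongrightarrow> (LINT x|lebesgue. rep_L2 g x * indicator (box a b) x)"
    proof (rule integral_dominated_convergence[where w="\<lambda>x. \<bar>indicator (cbox a b) x * rep_L2 g x\<bar>"])
      show "(\<lambda>x. rep_L2 g x * indicator (box a b) x) \<in> borel_measurable lebesgue"
        by (intro borel_measurable_times measurable_rep borel_measurable_indicator) auto
      show "(\<lambda>x. rep_L2 g x * box_bump a b (real (Suc n)) x) \<in> borel_measurable lebesgue" for n
        using test_functionD(7)[OF t[of n]]
        by (intro borel_measurable_times measurable_rep) (simp add: square_integrable_def)
      show "integrable lebesgue (\<lambda>x. \<bar>indicator (cbox a b) x * rep_L2 g x\<bar>)"
        using cbox_int by (rule integrable_abs)
      show "AE x in lebesgue. (\<lambda>n. rep_L2 g x * box_bump a b (real (Suc n)) x) \<longlonglongrightarrow> rep_L2 g x * indicator (box a b) x"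
        by (intro AE_I2 tendsto_intros box_bump_tendsto)
      show "AE x in lebesgue. norm (rep_L2 g x * box_bump a b (real (Suc n)) x) \<le> \<bar>indicator (cbox a b) x * rep_L2 g x\<bar>" for n
      proof (rule AE_I2)
        fix x
        show "norm (rep_L2 g x * box_bump a b (real (Suc n)) x) \<le> \<bar>indicator (cbox a b) x * rep_L2 g x\<bar>"
          using box_bump_nonzero_iff[of "real (Suc n)" a b x] box_bump_bounds[of a b "real (Suc n)" x] box_subset_cbox[of a b]
          by (cases "x \<in> box a b") (auto simp: abs_mult mult_left_le)
      qed
    qed
    moreover have "(LINT x|lebesgue. rep_L2 g x * box_bump a b (real (Suc n)) x) = 0" for n
      using assms(3)[OF t[of n]] inner_rep_abs[OF test_functionD(7)[OF t[of n]], of g] by simp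
    ultimately show ?thesis by (simp add: LIMSEQ_const_iff set_lebesgue_integral_def mult.commute)
  qed
  have cbox: "AE x in lebesgue. x \<in> cbox a b \<longrightarrow> rep_L2 g x = 0" if ab: "cbox a b \<subseteq> \<Omega>" for a b
  proof -
    have bc: "AE x in lebesgue. x \<in> cbox a b \<longleftrightarrow> x \<in> box a b"
    proof -
      have "cbox a b - box a b \<in> null_sets lebesgue"
        by (intro null_sets_completionI null_sets_cbox_Diff_box)
      then have "AE x in lebesgue. x \<notin> cbox a b - box a b" by (rule AE_not_in)
      then show ?thesis by eventually_elim (use box_subset_cbox in blast)
    qed
    \<comment> \<open>The cut-off to a bounded box makes the square integrable representative
      integrable.\<close>
    let ?f = "\<lambda>x. indicator (cbox a b) x * rep_L2 g x"
    have "AE x in lebesgue. ?f x = 0"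
    proof (rule AE_zero_if_box_integrals_zero[OF cbox_int])
      have "(LINT x|lebesgue. ?f x) = (LINT x:box a b|lebesgue. rep_L2 g x)"
        unfolding set_lebesgue_integral_def
      proof (rule integral_cong_AE)
        show "AE x in lebesgue. ?f x = indicat_real (box a b) x *\<^sub>R rep_L2 g x"
          using bc by eventually_elim (auto simp: indicator_def)
      qed (auto intro!: borel_measurable_times measurable_rep borel_measurable_indicator)
      then show "(LINT x|lebesgue. ?f x) = 0" using box[OF ab] by simp
    next
      fix c d
      obtain p q where pq: "box a b \<inter> box c d = box p q" unfolding box_Int_box by blast
      have "(LINT x:box c d|lebesgue. ?f x) = (LINT x:box p q|lebesgue. rep_L2 g x)"
        unfolding set_lebesgue_integral_def
      proof (rule integral_cong_AE)
        show "AE x in lebesgue. indicat_real (box c d) x *\<^sub>R ?f x = indicat_real (box p q) x *\<^sub>R rep_L2 g x"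
          using bc by eventually_elim (auto simp: indicator_def simp flip: pq)
      qed (auto intro!: borel_measurable_times measurable_rep borel_measurable_indicator)
      also have "\<dots> = 0"
      proof (cases "box p q = {}")
        case False
        \<comment> \<open>For a nonempty box the closed box is the closure, so it stays inside
          \<open>cbox a b\<close> and hence inside the domain.\<close>
        then have "cbox p q = closure (box p q)" by simp
        also have "\<dots> \<subseteq> closure (cbox a b)" using pq box_subset_cbox by (intro closure_mono) blast
        finally show ?thesis using ab by (intro box) simp
      qed (simp add: set_lebesgue_integral_def)
      finally show "(LINT x:box c d|lebesgue. ?f x) = 0" .
    qed
    then show ?thesis by eventually_elim (auto simp: indicator_def)
  qed
  obtain \<D> where D: "countable \<D>" "\<D> \<subseteq> Pow \<Omega>" "\<And>X. X \<in> \<D> \<Longrightarrow> \<exists>a b. X = cbox a b" "\<Union>\<D> = \<Omega>"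
    using open_countable_Union_open_cbox[OF assms(1)] by metis
  have "AE x in lebesgue. \<forall>X\<in>\<D>. x \<in> X \<longrightarrow> rep_L2 g x = 0"
    unfolding AE_ball_countable[OF D(1)] using D(2,3) cbox by blast
  moreover have "AE x in lebesgue. x \<notin> \<Omega> \<longrightarrow> rep_L2 g x = 0" using assms(2) by (simp add: L2_on_def)
  ultimately have "AE x in lebesgue. rep_L2 g x = 0" by eventually_elim (use D(4) in blast)
  then show ?thesis unfolding L2_eq_iff using rep_zero by eventually_elim simp
qed


section \<open>Translation invariance and integration by parts\<close>

lemma lborel_translate:
  fixes f :: "'a::euclidean_space \<Rightarrow> real"
  assumes "integrable lborel f"
  shows "integrable lborel (\<lambda>x. f (x + c))" "(LINT x|lborel. f (x + c)) = (LINT x|lborel. f x)"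
proof -
  have f: "integrable (distr lborel borel ((+) c)) f" using assms by (simp add: lborel_distr_plus)
  have m: "(+) c \<in> lborel \<rightarrow>\<^sub>M borel" by simp
  show "integrable lborel (\<lambda>x. f (x + c))" using integrable_distr[OF m f] by (simp add: add.commute)
  have "(LINT x|lborel. f x) = integral\<^sup>L (distr lborel borel ((+) c)) f" by (simp add: lborel_distr_plus)
  also have "\<dots> = (LINT x|lborel. f (c + x))"
    using assms by (intro integral_distr m) (auto dest: borel_measurable_integrable)
  finally show "(LINT x|lborel. f (x + c)) = (LINT x|lborel. f x)" by (simp add: add.commute)
qed

lemma has_real_derivative_along_line:
  fixes \<phi> :: "real^'n \<Rightarrow> real"
  assumes "\<And>x. \<phi> differentiable (at x)"
  shows "((\<lambda>t. \<phi> (x + t *\<^sub>R v)) has_real_derivative grad \<phi> (x + t *\<^sub>R v) \<bullet> v) (at t)"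
proof -
  have "((\<lambda>t. x + t *\<^sub>R v) has_derivative (\<lambda>s. s *\<^sub>R v)) (at t)"
    by (auto intro!: derivative_eq_intros)
  from has_derivative_compose[OF this has_derivative_grad[OF assms]] show ?thesis
    unfolding has_field_derivative_def by (rule has_derivative_eq_rhs) auto
qed

lemma test_function_bounded:
  assumes "\<phi> \<in> test_functions \<Omega>"
  obtains M where "0 < M" "\<And>x. \<bar>\<phi> x\<bar> \<le> M"
proof -
  have "bounded (\<phi> ` closure {x. \<phi> x \<noteq> 0})"
    using continuous_on_subset[OF test_functionD(2)[OF assms] subset_UNIV] test_functionD(4)[OF assms]
    by (intro compact_imp_bounded compact_continuous_image)
  then obtain M where M: "0 < M" "\<forall>y\<in>\<phi> ` closure {x. \<phi> x \<noteq> 0}. norm y \<le> M"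
    unfolding bounded_pos by blast
  have "\<bar>\<phi> x\<bar> \<le> M" for x
  proof (cases "x \<in> closure {x. \<phi> x \<noteq> 0}")
    case True
    then have "\<phi> x \<in> \<phi> ` closure {x. \<phi> x \<noteq> 0}" by (rule imageI)
    then show ?thesis using M(2) by (metis real_norm_def)
  next
    case False
    then show ?thesis using M(1) test_functionD(5)[OF assms False] by linarith
  qed
  then show ?thesis using that M(1) by blast
qed

lemma test_function_integrable:
  assumes "\<phi> \<in> test_functions \<Omega>"
  shows "integrable lborel \<phi>" "integrable lebesgue \<phi>" "\<phi> \<in> borel_measurable borel"
  using integrable_continuous_compact_support[OF test_functionD(2,4,5)[OF assms]]
    borel_measurable_continuous_UNIV[OF test_functionD(2)[OF assms]] by auto

text \<open>By translation invariance every difference quotient has integral 0, and the quotients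
  converge boundedly to the partial derivative.\<close>

lemma integral_partial_derivative_zero:
  assumes \<phi>: "\<phi> \<in> test_functions \<Omega>"
  shows "(LINT x|lborel. grad \<phi> x $ j) = 0"
proof -
  define h where "h n = inverse (real (Suc n))" for n
  have h: "0 < h n" "h n \<le> 1" for n by (simp_all add: h_def field_simps)
  define s where "s n x = (\<phi> (x + h n *\<^sub>R axis j 1) - \<phi> x) / h n" for n x
  have td: "\<phi> differentiable (at x)" for x by (rule test_functionD(3)[OF \<phi>])
  obtain M where M: "0 < M" "\<And>x. \<bar>grad \<phi> x $ j\<bar> \<le> M"
    using test_function_bounded[OF test_function_grad[OF \<phi>]] by blast
  obtain R where R: "\<And>x. x \<in> closure {x. \<phi> x \<noteq> 0} \<Longrightarrow> norm x \<le> R"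
    using compact_imp_bounded[OF test_functionD(4)[OF \<phi>]] unfolding bounded_iff by blast
  have zero: "\<phi> x = 0" if "R < norm x" for x using R[of x] test_functionD(5)[OF \<phi>, of x] that by force
  have int0: "(LINT x|lborel. s n x) = 0" for n
    using lborel_translate[OF test_function_integrable(1)[OF \<phi>]] test_function_integrable(1)[OF \<phi>]
    unfolding s_def by simp
  have "(\<lambda>n. LINT x|lborel. s n x) \<longlonglongrightarrow> (LINT x|lborel. grad \<phi> x $ j)"
  \<comment> \<open>The mean value theorem gives the bound \<open>M\<close>. The support radius
    \<open>R\<close> grows by 1 because all shifts \<open>h n\<close> have length at most 1.\<close>
  proof (rule integral_dominated_convergence[where w="\<lambda>x. indicator (cball 0 (R + 1)) x * M"])
    show "(\<lambda>x. grad \<phi> x $ j) \<in> borel_measurable lborel"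
      using test_function_integrable(3)[OF test_function_grad[OF \<phi>]] by simp
    show "s n \<in> borel_measurable lborel" for n
      using test_function_integrable(3)[OF \<phi>] unfolding s_def by measurable
    show "integrable lborel (\<lambda>x::real^'a. indicator (cball 0 (R + 1)) x * M)"
      using emeasure_compact_finite[OF compact_cball, of "0::real^'a" "R + 1"]
      by (intro integrable_mult_left integrable_real_indicator) auto
    show "AE x in lborel. (\<lambda>n. s n x) \<longlonglongrightarrow> grad \<phi> x $ j"
    proof (rule AE_I2)
      fix x
      have "((\<lambda>t. \<phi> (x + t *\<^sub>R axis j 1)) has_real_derivative grad \<phi> x $ j) (at 0)"
        using has_real_derivative_along_line[OF td, of x "axis j 1" 0] by (simp add: inner_axis)
      then have *: "((\<lambda>t. (\<phi> (x + t *\<^sub>R axis j 1) - \<phi> x) / t) \<longlongrightarrow> grad \<phi> x $ j) (at 0)"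
        by (simp add: DERIV_def)
      have "filterlim h (at 0) sequentially"
        using LIMSEQ_inverse_real_of_nat h(1) unfolding h_def[abs_def]
        by (intro filterlim_atI) (auto simp: less_imp_neq[symmetric])
      from filterlim_compose[OF * this] show "(\<lambda>n. s n x) \<longlonglongrightarrow> grad \<phi> x $ j" by (simp add: s_def)
    qed
    show "AE x in lborel. norm (s n x) \<le> indicator (cball 0 (R + 1)) x * M" for n
    proof (rule AE_I2)
      fix x
      show "norm (s n x) \<le> indicator (cball 0 (R + 1)) x * M"
      proof (cases "norm x \<le> R + 1")
        case True
        obtain z where "\<phi> (x + h n *\<^sub>R axis j 1) - \<phi> (x + 0 *\<^sub>R axis j 1) = (h n - 0) * (grad \<phi> (x + z *\<^sub>R axis j 1) \<bullet> axis j 1)"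
          using MVT2[OF h(1)[of n], of "\<lambda>t. \<phi> (x + t *\<^sub>R axis j 1)" "\<lambda>t. grad \<phi> (x + t *\<^sub>R axis j 1) \<bullet> axis j 1"]
            has_real_derivative_along_line[OF td] by blast
        then have "s n x = grad \<phi> (x + z *\<^sub>R axis j 1) $ j" using h(1)[of n] by (simp add: s_def inner_axis)
        then show ?thesis using True M(2) by simp
      next
        case False
        have "norm x \<le> norm (x + h n *\<^sub>R axis j 1) + norm (h n *\<^sub>R axis j (1::real) :: real^'a)"
          using norm_triangle_ineq4[of "x + h n *\<^sub>R axis j 1" "h n *\<^sub>R axis j 1"] by simp
        also have "norm (h n *\<^sub>R axis j (1::real) :: real^'a) \<le> 1" using h[of n] by simp
        finally have "R < norm (x + h n *\<^sub>R axis j 1)" using False by simp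
        then show ?thesis using False zero by (simp add: s_def)
      qed
    qed
  qed
  then show ?thesis using int0 by (simp add: LIMSEQ_const_iff)
qed

lemma integration_by_parts:
  assumes "\<phi> \<in> test_functions \<Omega>" "\<psi> \<in> test_functions \<Omega>"
  shows "abs_L2 \<phi> \<bullet> abs_L2 (\<lambda>x. grad \<psi> x $ j) = - (abs_L2 (\<lambda>x. grad \<phi> x $ j) \<bullet> abs_L2 \<psi>)"
proof -
  note t = assms test_function_grad[OF assms(1), of j] test_function_grad[OF assms(2), of j]
  have g: "grad (\<lambda>x. \<phi> x * \<psi> x) x $ j = \<phi> x * grad \<psi> x $ j + grad \<phi> x $ j * \<psi> x" for x
    using grad_eqI[OF has_derivative_mult[OF has_derivative_grad[OF test_functionD(3)[OF t(1)]] has_derivative_grad[OF test_functionD(3)[OF t(2)]]]]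
    by (simp add: inner_axis)
  have i: "integrable lborel (\<lambda>x. \<phi> x * grad \<psi> x $ j)" "integrable lborel (\<lambda>x. grad \<phi> x $ j * \<psi> x)"
    using test_function_integrable(1)[OF test_function_mult] t by blast+
  have "(LINT x|lborel. \<phi> x * grad \<psi> x $ j) + (LINT x|lborel. grad \<phi> x $ j * \<psi> x) = 0"
    using integral_partial_derivative_zero[OF test_function_mult[OF assms], of j]
    unfolding g Bochner_Integration.integral_add[OF i] .
  moreover have "(LINT x|lebesgue. \<phi> x * grad \<psi> x $ j) = (LINT x|lborel. \<phi> x * grad \<psi> x $ j)"
    "(LINT x|lebesgue. grad \<phi> x $ j * \<psi> x) = (LINT x|lborel. grad \<phi> x $ j * \<psi> x)"
    using i[THEN borel_measurable_integrable] by (simp_all add: integral_completion)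
  ultimately show ?thesis using t[THEN test_functionD(7)] by (simp add: inner_abs_L2)
qed

text \<open>Test functions vanish outside the domain, so integrals over it are inner products with
  fixed vectors. In this form linearity and passage to limits are immediate.\<close>

lemma is_weak_deriv_iff:
  "is_weak_deriv \<Omega> j v g \<longleftrightarrow> g \<in> L2_on \<Omega> \<and>
     (\<forall>\<phi>\<in>test_functions \<Omega>. v \<bullet> abs_L2 (\<lambda>x. grad \<phi> x $ j) = - (g \<bullet> abs_L2 \<phi>))"
proof -
  have "(LINT x:\<Omega>|lebesgue. rep_L2 v x * grad \<phi> x $ j) = v \<bullet> abs_L2 (\<lambda>x. grad \<phi> x $ j)"
    "(LINT x:\<Omega>|lebesgue. rep_L2 g x * \<phi> x) = g \<bullet> abs_L2 \<phi>" if "\<phi> \<in> test_functions \<Omega>" for \<phi>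
    using integral_eq_L2_inner[OF test_functionD(7,6)[OF that]]
      integral_eq_L2_inner[OF test_functionD(7,6)[OF test_function_grad[OF that]]] by blast+
  then show ?thesis unfolding is_weak_deriv_def by auto
qed

lemma is_weak_deriv_test_function:
  assumes "\<phi> \<in> test_functions \<Omega>"
  shows "is_weak_deriv \<Omega> j (abs_L2 \<phi>) (abs_L2 (\<lambda>x. grad \<phi> x $ j))"
  unfolding is_weak_deriv_iff
  using integration_by_parts[OF assms] abs_L2_in_L2_on[OF test_functionD(7,6)[OF test_function_grad[OF assms]]] by blast

lemma is_weak_deriv_add:
  "is_weak_deriv \<Omega> j v g \<Longrightarrow> is_weak_deriv \<Omega> j w h \<Longrightarrow> is_weak_deriv \<Omega> j (v + w) (g + h)"
  unfolding is_weak_deriv_iff using L2_on_subspace[of \<Omega>] by (auto simp: inner_add_left subspace_add)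

lemma is_weak_deriv_scaleR:
  "is_weak_deriv \<Omega> j v g \<Longrightarrow> is_weak_deriv \<Omega> j (c *\<^sub>R v) (c *\<^sub>R g)"
  unfolding is_weak_deriv_iff using L2_on_subspace[of \<Omega>] by (auto simp: subspace_scale)

lemma is_weak_deriv_unique:
  assumes "open \<Omega>" "is_weak_deriv \<Omega> j v g" "is_weak_deriv \<Omega> j v h"
  shows "g = h"
proof -
  have "g - h = 0"
    using assms(2,3) L2_on_subspace[of \<Omega>] unfolding is_weak_deriv_iff
    by (intro L2_eq_zero_if_orthogonal_to_test_functions[OF assms(1)]) (auto simp: subspace_diff inner_diff_left)
  then show ?thesis by simp
qed

lemma weak_deriv_eq: "open \<Omega> \<Longrightarrow> is_weak_deriv \<Omega> j v g \<Longrightarrow> weak_deriv \<Omega> j v = g"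
  unfolding weak_deriv_def using is_weak_deriv_unique by blast

lemma weak_deriv_works: "open \<Omega> \<Longrightarrow> v \<in> H1 \<Omega> \<Longrightarrow> is_weak_deriv \<Omega> j v (weak_deriv \<Omega> j v)"
  unfolding H1_def using weak_deriv_eq by fastforce

lemma weak_deriv_add:
  "open \<Omega> \<Longrightarrow> v \<in> H1 \<Omega> \<Longrightarrow> w \<in> H1 \<Omega> \<Longrightarrow> weak_deriv \<Omega> j (v + w) = weak_deriv \<Omega> j v + weak_deriv \<Omega> j w"
  by (intro weak_deriv_eq is_weak_deriv_add weak_deriv_works)

lemma weak_deriv_scaleR:
  "open \<Omega> \<Longrightarrow> v \<in> H1 \<Omega> \<Longrightarrow> weak_deriv \<Omega> j (c *\<^sub>R v) = c *\<^sub>R weak_deriv \<Omega> j v"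
  by (intro weak_deriv_eq is_weak_deriv_scaleR weak_deriv_works)

lemma subspace_H1: "subspace (H1 \<Omega>)"
proof (rule subspaceI)
  show "0 \<in> H1 \<Omega>"
    using L2_on_subspace[of \<Omega>] by (auto simp: H1_def is_weak_deriv_iff subspace_0 intro!: exI[of _ 0])
  show "v + w \<in> H1 \<Omega>" if "v \<in> H1 \<Omega>" "w \<in> H1 \<Omega>" for v w
    using that L2_on_subspace[of \<Omega>] is_weak_deriv_add unfolding H1_def
    by (simp add: subspace_add) blast
  show "c *\<^sub>R v \<in> H1 \<Omega>" if "v \<in> H1 \<Omega>" for v c
    using that L2_on_subspace[of \<Omega>] is_weak_deriv_scaleR unfolding H1_def
    by (simp add: subspace_scale) blast
qed

lemma weak_deriv_diff:
  assumes "open \<Omega>" "v \<in> H1 \<Omega>" "w \<in> H1 \<Omega>"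
  shows "weak_deriv \<Omega> j (v - w) = weak_deriv \<Omega> j v - weak_deriv \<Omega> j w"
  using weak_deriv_add[OF assms(1,2), of "(-1) *\<^sub>R w" j] weak_deriv_scaleR[OF assms(1,3), of j "-1"]
    subspace_scale[OF subspace_H1 assms(3), of "-1"] by simp

lemma test_function_in_H1:
  assumes "\<phi> \<in> test_functions \<Omega>"
  shows "abs_L2 \<phi> \<in> H1 \<Omega>"
  unfolding H1_def using is_weak_deriv_test_function[OF assms] abs_L2_in_L2_on[OF test_functionD(7,6)[OF assms]] by blast

section \<open>The Poincare and Ehrling inequalities\<close>

lemma nn_integral_lborel_translate:
  fixes f :: "'a::euclidean_space \<Rightarrow> ennreal"
  assumes "f \<in> borel_measurable borel"
  shows "(\<integral>\<^sup>+x. f (c + x) \<partial>lborel) = (\<integral>\<^sup>+x. f x \<partial>lborel)"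
proof -
  have "(\<integral>\<^sup>+x. f x \<partial>lborel) = (\<integral>\<^sup>+x. f x \<partial>(distr lborel borel ((+) c)))" by (simp add: lborel_distr_plus)
  also have "\<dots> = (\<integral>\<^sup>+x. f (c + x) \<partial>lborel)"
    using assms by (intro nn_integral_distr) auto
  finally show ?thesis by simp
qed

lemma nn_integral_unit_interval_continuous:
  fixes f :: "real \<Rightarrow> real"
  assumes "continuous_on UNIV f" "\<And>t. 0 \<le> f t"
  shows "(\<integral>\<^sup>+t. ennreal (indicator {0..1} t * f t) \<partial>lborel) = ennreal (integral {0..1} f)"
proof (rule nn_integral_has_integral_lborel)
  have [measurable]: "f \<in> borel_measurable borel" using assms(1) by (rule borel_measurable_continuous_onI)
  show "(\<lambda>t. indicator {0..1} t * f t) \<in> borel_measurable borel" by measurable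
  have "(f has_integral integral {0..1} f) {0..1}"
    by (intro integrable_integral integrable_continuous_real continuous_on_subset[OF assms(1)]) auto
  then have "((\<lambda>t. if t \<in> {0..1} then f t else 0) has_integral integral {0..1} f) UNIV"
    by (simp only: has_integral_restrict_UNIV)
  then show "((\<lambda>t. indicator {0..1} t * f t) has_integral integral {0..1} f) UNIV"
    by (rule has_integral_eq[rotated]) (simp add: indicator_def)
qed (use assms(2) in simp)

text \<open>Jensen's inequality for the square, from integrating \<open>(g t - m)^2 >= 0\<close>
  over an interval of length 1.\<close>

lemma square_integral_unit_interval_le:
  fixes g :: "real \<Rightarrow> real"
  assumes "continuous_on UNIV g" "(g has_integral m) {0..1}"
  shows "m\<^sup>2 \<le> integral {0..1} (\<lambda>t. (g t)\<^sup>2)"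
proof -
  have i: "(\<lambda>t. (g t)\<^sup>2) integrable_on {0..1}"
    using assms(1) by (intro integrable_continuous_real continuous_intros) (auto intro: continuous_on_subset)
  have c: "((\<lambda>_. m\<^sup>2) has_integral m\<^sup>2) {0..1::real}" using has_integral_const_real[of "m\<^sup>2" 0 1] by simp
  have "((\<lambda>t. (g t)\<^sup>2 - 2 * m * g t + m\<^sup>2) has_integral integral {0..1} (\<lambda>t. (g t)\<^sup>2) - 2 * m * m + m\<^sup>2) {0..1}"
    by (intro has_integral_add has_integral_diff has_integral_mult_right integrable_integral i assms(2) c)
  then have "0 \<le> integral {0..1} (\<lambda>t. (g t)\<^sup>2) - 2 * m * m + m\<^sup>2"
  proof (rule has_integral_nonneg)
    fix t
    have "(g t)\<^sup>2 - 2 * m * g t + m\<^sup>2 = (g t - m)\<^sup>2" by (simp add: power2_diff)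
    then show "0 \<le> (g t)\<^sup>2 - 2 * m * g t + m\<^sup>2" by simp
  qed
  then show ?thesis by (simp add: power2_eq_square)
qed

definition dirichlet :: "(real^'n \<Rightarrow> real) \<Rightarrow> real" where
  "dirichlet \<phi> = (\<Sum>j\<in>UNIV. (norm (abs_L2 (\<lambda>x. grad \<phi> x $ j)))\<^sup>2)"

lemma dirichlet_nonneg: "0 \<le> dirichlet \<phi>"
  unfolding dirichlet_def by (intro sum_nonneg) simp

lemma nn_integral_test_function_square:
  assumes "\<phi> \<in> test_functions \<Omega>"
  shows "(\<integral>\<^sup>+x. ennreal ((\<phi> x)\<^sup>2) \<partial>lborel) = ennreal ((norm (abs_L2 \<phi>))\<^sup>2)"
  unfolding norm_abs_L2_square[OF test_functionD(7)[OF assms]]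
  by (rule nn_integral_completion[symmetric])

lemma grad_measurable:
  assumes "\<phi> \<in> test_functions \<Omega>"
  shows "grad \<phi> \<in> borel_measurable borel" "continuous_on UNIV (grad \<phi>)"
proof -
  show c: "continuous_on UNIV (grad \<phi>)"
    using test_functionD(2)[OF test_function_grad[OF assms]]
      continuous_on_vec_lambda[of UNIV "\<lambda>j x. grad \<phi> x $ j"] by simp
  show "grad \<phi> \<in> borel_measurable borel" using borel_measurable_continuous_onI[OF c] .
qed

lemma nn_integral_grad_square:
  assumes "\<phi> \<in> test_functions \<Omega>"
  shows "(\<integral>\<^sup>+x. ennreal ((norm (grad \<phi> x))\<^sup>2) \<partial>lborel) = ennreal (dirichlet \<phi>)"
proof -
  have m: "(\<lambda>x. grad \<phi> x $ j) \<in> borel_measurable borel" for j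
    by (rule test_function_integrable(3)[OF test_function_grad[OF assms]])
  have "(\<integral>\<^sup>+x. ennreal ((norm (grad \<phi> x))\<^sup>2) \<partial>lborel) = (\<integral>\<^sup>+x. (\<Sum>j\<in>UNIV. ennreal ((grad \<phi> x $ j)\<^sup>2)) \<partial>lborel)"
    by (simp add: norm_vec_def L2_set_def sum_nonneg sum_ennreal)
  also have "\<dots> = (\<Sum>j\<in>UNIV. \<integral>\<^sup>+x. ennreal ((grad \<phi> x $ j)\<^sup>2) \<partial>lborel)"
    using m by (intro nn_integral_sum) simp
  also have "\<dots> = ennreal (dirichlet \<phi>)"
    by (simp add: nn_integral_test_function_square[OF test_function_grad[OF assms]] dirichlet_def sum_ennreal)
  finally show ?thesis .
qed

text \<open>The difference is the integral of the directional derivative along the segment from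
  \<open>x\<close> to \<open>x + h\<close>. After Jensen and Fubini, translation invariance removes
  the position on the segment, and Cauchy-Schwarz extracts \<open>norm h\<close>.\<close>

lemma nn_integral_translation_difference:
  assumes \<phi>: "\<phi> \<in> test_functions \<Omega>"
  shows "(\<integral>\<^sup>+x. ennreal ((\<phi> (x + h) - \<phi> x)\<^sup>2) \<partial>lborel) \<le> ennreal ((norm h)\<^sup>2 * dirichlet \<phi>)"
proof -
  have [measurable]: "grad \<phi> \<in> borel_measurable borel" by (rule grad_measurable[OF \<phi>])
  have pw: "ennreal ((\<phi> (x + h) - \<phi> x)\<^sup>2) \<le> (\<integral>\<^sup>+t. ennreal (indicator {0..1} t * (grad \<phi> (x + t *\<^sub>R h) \<bullet> h)\<^sup>2) \<partial>lborel)" for x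
  proof -
    have c: "continuous_on UNIV (\<lambda>t. grad \<phi> (x + t *\<^sub>R h) \<bullet> h)"
      by (intro continuous_intros continuous_on_compose2[OF grad_measurable(2)[OF \<phi>]]) auto
    have "((\<lambda>t. grad \<phi> (x + t *\<^sub>R h) \<bullet> h) has_integral \<phi> (x + 1 *\<^sub>R h) - \<phi> (x + 0 *\<^sub>R h)) {0..1}"
      using has_real_derivative_along_line[OF test_functionD(3)[OF \<phi>], of x h]
      by (intro fundamental_theorem_of_calculus)
        (auto simp: has_real_derivative_iff_has_vector_derivative intro: has_vector_derivative_at_within)
    from square_integral_unit_interval_le[OF c this]
    show ?thesis
      using c by (subst nn_integral_unit_interval_continuous) (auto intro!: ennreal_leI continuous_intros)
  qed
  have "(\<integral>\<^sup>+x. ennreal ((\<phi> (x + h) - \<phi> x)\<^sup>2) \<partial>lborel) \<le>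
      (\<integral>\<^sup>+x. (\<integral>\<^sup>+t. ennreal (indicator {0..1} t * (grad \<phi> (x + t *\<^sub>R h) \<bullet> h)\<^sup>2) \<partial>lborel) \<partial>lborel)"
    by (intro nn_integral_mono pw)
  also have "\<dots> = (\<integral>\<^sup>+t. (\<integral>\<^sup>+x. ennreal (indicator {0..1} t * (grad \<phi> (x + t *\<^sub>R h) \<bullet> h)\<^sup>2) \<partial>lborel) \<partial>lborel)"
    by (rule lborel_pair.Fubini'[symmetric]) measurable
  also have "\<dots> = (\<integral>\<^sup>+t. (indicator {0..1::real} t * (\<integral>\<^sup>+x. ennreal ((grad \<phi> x \<bullet> h)\<^sup>2) \<partial>lborel)) \<partial>lborel)"
  proof (intro nn_integral_cong)
    fix t :: real
    have "(\<integral>\<^sup>+x. ennreal (indicator {0..1} t * (grad \<phi> (x + t *\<^sub>R h) \<bullet> h)\<^sup>2) \<partial>lborel) =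
      (\<integral>\<^sup>+x. ennreal (indicator {0..1} t * (grad \<phi> (t *\<^sub>R h + x) \<bullet> h)\<^sup>2) \<partial>lborel)" by (simp add: add.commute)
    also have "\<dots> = (\<integral>\<^sup>+x. ennreal (indicator {0..1} t * (grad \<phi> x \<bullet> h)\<^sup>2) \<partial>lborel)"
      by (rule nn_integral_lborel_translate) measurable
    also have "\<dots> = indicator {0..1::real} t * (\<integral>\<^sup>+x. ennreal ((grad \<phi> x \<bullet> h)\<^sup>2) \<partial>lborel)"
      by (auto simp: indicator_def)
    finally show "(\<integral>\<^sup>+x. ennreal (indicator {0..1} t * (grad \<phi> (x + t *\<^sub>R h) \<bullet> h)\<^sup>2) \<partial>lborel) =
      indicator {0..1::real} t * (\<integral>\<^sup>+x. ennreal ((grad \<phi> x \<bullet> h)\<^sup>2) \<partial>lborel)" .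
  qed
  also have "\<dots> = (\<integral>\<^sup>+x. ennreal ((grad \<phi> x \<bullet> h)\<^sup>2) \<partial>lborel)"
    by (subst nn_integral_multc) auto
  also have "\<dots> \<le> (\<integral>\<^sup>+x. ennreal ((norm h)\<^sup>2) * ennreal ((norm (grad \<phi> x))\<^sup>2) \<partial>lborel)"
  proof (intro nn_integral_mono)
    fix x
    have "(grad \<phi> x \<bullet> h)\<^sup>2 \<le> (norm (grad \<phi> x) * norm h)\<^sup>2"
      by (rule abs_le_square_iff[THEN iffD1]) (use Cauchy_Schwarz_ineq2[of "grad \<phi> x" h] in simp)
    then show "ennreal ((grad \<phi> x \<bullet> h)\<^sup>2) \<le> ennreal ((norm h)\<^sup>2) * ennreal ((norm (grad \<phi> x))\<^sup>2)"
      by (simp add: ennreal_mult[symmetric] power_mult_distrib mult.commute)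
  qed
  also have "\<dots> = ennreal ((norm h)\<^sup>2) * ennreal (dirichlet \<phi>)"
    by (subst nn_integral_cmult) (simp_all add: nn_integral_grad_square[OF \<phi>])
  finally show ?thesis by (simp add: ennreal_mult dirichlet_nonneg)
qed

text \<open>A translation longer than the diameter moves the domain off itself, so at each point of
  the domain the translation difference is just \<open>- \<phi> x\<close>.\<close>

lemma poincare_test_functions:
  fixes \<Omega> :: "(real^'n) set"
  assumes "bounded \<Omega>"
  obtains C where "0 < C" "\<And>\<phi>. \<phi> \<in> test_functions \<Omega> \<Longrightarrow> (norm (abs_L2 \<phi>))\<^sup>2 \<le> C * dirichlet \<phi>"
proof -
  obtain R where R: "0 < R" "\<And>x. x \<in> \<Omega> \<Longrightarrow> norm x \<le> R" using assms by (auto simp: bounded_pos)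
  \<comment> \<open>Two points of the domain are at distance at most \<open>2 R\<close>, so length
    \<open>3 R\<close> suffices; the coordinate direction is arbitrary.\<close>
  define h :: "real^'n" where "h = axis undefined (3 * R)"
  have nh: "norm h = 3 * R" using R(1) real_sqrt_mult[of 9 "R\<^sup>2"] real_sqrt_abs[of 3] by (simp add: h_def norm_vec_def L2_set_def axis_def if_distrib[of norm] if_distrib[of "\<lambda>x. x\<^sup>2"] cong: if_cong)
  have out: "x + h \<notin> \<Omega>" if "x \<in> \<Omega>" for x
  proof
    assume "x + h \<in> \<Omega>"
    then have "norm h \<le> norm (x + h) + norm x" using norm_triangle_ineq4[of "x + h" x] by simp
    then show False using R(2)[OF \<open>x + h \<in> \<Omega>\<close>] R(2)[OF that] R(1) nh by linarith
  qed
  have "(norm (abs_L2 \<phi>))\<^sup>2 \<le> (3 * R)\<^sup>2 * dirichlet \<phi>" if \<phi>: "\<phi> \<in> test_functions \<Omega>" for \<phi>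
  proof -
    have "ennreal ((norm (abs_L2 \<phi>))\<^sup>2) = (\<integral>\<^sup>+x. ennreal ((\<phi> x)\<^sup>2) \<partial>lborel)"
      using nn_integral_test_function_square[OF \<phi>] by simp
    also have "\<dots> \<le> (\<integral>\<^sup>+x. ennreal ((\<phi> (x + h) - \<phi> x)\<^sup>2) \<partial>lborel)"
    proof (intro nn_integral_mono ennreal_leI)
      fix x
      show "(\<phi> x)\<^sup>2 \<le> (\<phi> (x + h) - \<phi> x)\<^sup>2"
        using test_functionD(6)[OF \<phi>, of x] test_functionD(6)[OF \<phi>, of "x + h"] out[of x]
        by (cases "x \<in> \<Omega>") auto
    qed
    also have "\<dots> \<le> ennreal ((norm h)\<^sup>2 * dirichlet \<phi>)" by (rule nn_integral_translation_difference[OF \<phi>])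
    finally show ?thesis by (simp add: nh ennreal_le_iff dirichlet_nonneg)
  qed
  then show ?thesis using that[of "(3 * R)\<^sup>2"] R(1) by simp
qed

text \<open>Cells are half-open so that they partition the space: the cell containing
  \<open>x\<close> has the integer parts of \<open>x $ i / \<epsilon>\<close> as its index.\<close>

definition grid_cell :: "real \<Rightarrow> ('n \<Rightarrow> int) \<Rightarrow> (real^'n) set" where
  "grid_cell \<epsilon> c = {x. \<forall>i. \<epsilon> * c i \<le> x $ i \<and> x $ i < \<epsilon> * (c i + 1)}"

lemma grid_cell_measurable: "grid_cell \<epsilon> c \<in> sets borel"
  unfolding grid_cell_def by measurable

lemma emeasure_grid_cell:
  fixes c :: "'n::finite \<Rightarrow> int"
  assumes "0 < \<epsilon>"
  shows "emeasure lborel (grid_cell \<epsilon> c) = ennreal (\<epsilon> ^ DIM(real^'n))"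
proof -
  define l u :: "real^'n" where "l = (\<chi> i. \<epsilon> * c i)" and "u = (\<chi> i. \<epsilon> * (c i + 1))"
  have ul: "(u - l) \<bullet> b = \<epsilon>" if "b \<in> Basis" for b
    using that by (auto simp: Basis_vec_def inner_axis u_def l_def algebra_simps)
  then have le: "l \<bullet> b \<le> u \<bullet> b" if "b \<in> Basis" for b using that assms by (fastforce simp: inner_diff_left)
  have "emeasure lborel (box l u) = ennreal (\<epsilon> ^ DIM(real^'n))" "emeasure lborel (cbox l u) = ennreal (\<epsilon> ^ DIM(real^'n))"
    using ul by (simp_all add: emeasure_lborel_box[OF le] emeasure_lborel_cbox[OF le])
  moreover have "box l u \<subseteq> grid_cell \<epsilon> c" "grid_cell \<epsilon> c \<subseteq> cbox l u"
    by (auto simp: mem_box_cart grid_cell_def l_def u_def less_imp_le)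
  then have "emeasure lborel (box l u) \<le> emeasure lborel (grid_cell \<epsilon> c)"
    "emeasure lborel (grid_cell \<epsilon> c) \<le> emeasure lborel (cbox l u)"
    using grid_cell_measurable[of \<epsilon> c] by (auto intro!: emeasure_mono)
  ultimately show ?thesis by (metis antisym)
qed

lemma grid_cell_unique: "0 < \<epsilon> \<Longrightarrow> x \<in> grid_cell \<epsilon> c \<Longrightarrow> c = (\<lambda>i. \<lfloor>x $ i / \<epsilon>\<rfloor>)"
proof
  fix i assume "0 < \<epsilon>" "x \<in> grid_cell \<epsilon> c"
  then have "of_int (c i) \<le> x $ i / \<epsilon>" "x $ i / \<epsilon> < of_int (c i) + 1"
    by (auto simp: grid_cell_def field_simps)
  then show "c i = \<lfloor>x $ i / \<epsilon>\<rfloor>" by (simp add: floor_unique)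
qed

lemma in_grid_cell: "0 < \<epsilon> \<Longrightarrow> x \<in> grid_cell \<epsilon> (\<lambda>i. \<lfloor>x $ i / \<epsilon>\<rfloor>)"
proof -
  assume "0 < \<epsilon>"
  have "\<epsilon> * of_int \<lfloor>x $ i / \<epsilon>\<rfloor> \<le> \<epsilon> * (x $ i / \<epsilon>)" "\<epsilon> * (x $ i / \<epsilon>) < \<epsilon> * (of_int \<lfloor>x $ i / \<epsilon>\<rfloor> + 1)" for i
    using \<open>0 < \<epsilon>\<close> by (intro mult_left_mono mult_strict_left_mono; linarith)+
  then have "\<epsilon> * of_int \<lfloor>x $ i / \<epsilon>\<rfloor> \<le> x $ i" "x $ i < \<epsilon> * (of_int \<lfloor>x $ i / \<epsilon>\<rfloor> + 1)" for i
    using \<open>0 < \<epsilon>\<close> by simp_all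
  then show ?thesis by (simp add: grid_cell_def)
qed

lemma finite_grid_cover:
  fixes \<Omega> :: "(real^'n) set"
  assumes "bounded \<Omega>" "0 < \<epsilon>"
  shows "finite {c :: 'n \<Rightarrow> int. grid_cell \<epsilon> c \<inter> \<Omega> \<noteq> {}}"
proof -
  obtain R where R: "\<And>x. x \<in> \<Omega> \<Longrightarrow> norm x \<le> R" using assms by (auto simp: bounded_iff)
  define N where "N = \<lceil>R / \<epsilon>\<rceil> + 1"
  have "c i \<in> {- N..N}" if "grid_cell \<epsilon> c \<inter> \<Omega> \<noteq> {}" for c i
  proof -
    obtain x where x: "x \<in> grid_cell \<epsilon> c" "x \<in> \<Omega>" using \<open>grid_cell \<epsilon> c \<inter> \<Omega> \<noteq> {}\<close> by blast
    have "\<bar>x $ i\<bar> \<le> R" using R[OF x(2)] component_le_norm_cart[of x i] by linarith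
    then have "\<bar>x $ i / \<epsilon>\<bar> \<le> R / \<epsilon>" using assms(2) by (simp add: abs_divide divide_right_mono)
    then have "\<bar>x $ i / \<epsilon>\<bar> \<le> of_int \<lceil>R / \<epsilon>\<rceil>" by linarith
    then have "- \<lceil>R / \<epsilon>\<rceil> \<le> \<lfloor>x $ i / \<epsilon>\<rfloor>" "\<lfloor>x $ i / \<epsilon>\<rfloor> \<le> \<lceil>R / \<epsilon>\<rceil>" by linarith+
    then show ?thesis using grid_cell_unique[OF assms(2) x(1)] by (simp add: N_def)
  qed
  then have "{c. grid_cell \<epsilon> c \<inter> \<Omega> \<noteq> {}} \<subseteq> PiE UNIV (\<lambda>_. {- N..N})"
    unfolding PiE_UNIV_domain by (intro subsetI Pi_I) blast
  then show ?thesis by (rule finite_subset) (intro finite_PiE finite_UNIV, auto)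
qed


text \<open>Expanding the square gives the variance identity: the right-hand side is
  \<open>2 m\<close> times the squared distance of \<open>\<phi>\<close> on \<open>q\<close> to its
  mean value. It links the mean oscillation of a cell to an inner product with its
  indicator.\<close>

lemma double_integral_square_difference:
  fixes \<phi> :: "real^'n \<Rightarrow> real"
  assumes \<phi>: "\<phi> \<in> test_functions \<Omega>" and q: "q \<in> sets borel" "emeasure lborel q = ennreal m" "0 < m"
  shows "(\<integral>\<^sup>+x. (\<integral>\<^sup>+y. ennreal (indicator q x * indicator q y * (\<phi> y - \<phi> x)\<^sup>2) \<partial>lborel) \<partial>lborel) =
    ennreal (2 * m * (LINT x|lborel. indicator q x * (\<phi> x)\<^sup>2) - 2 * (LINT x|lborel. indicator q x * \<phi> x)\<^sup>2)"
proof -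
  define I where "I = (LINT x|lborel. indicator q x * \<phi> x)"
  define J where "J = (LINT x|lborel. indicator q x * (\<phi> x)\<^sup>2)"
  have [measurable]: "\<phi> \<in> borel_measurable borel" by (rule test_function_integrable(3)[OF \<phi>])
  have [measurable]: "q \<in> sets borel" by fact
  have hI: "has_bochner_integral lborel (\<lambda>x. indicator q x * \<phi> x) I"
    using integrable_mult_indicator[of q lborel, OF _ test_function_integrable(1)[OF \<phi>]] q(1)
    unfolding I_def by (intro has_bochner_integral_integrable) simp
  have hJ: "has_bochner_integral lborel (\<lambda>x. indicator q x * (\<phi> x)\<^sup>2) J"
    using integrable_mult_indicator[of q lborel, OF _ test_function_integrable(1)[OF test_function_mult[OF \<phi> \<phi>]]] q(1)
    unfolding J_def by (intro has_bochner_integral_integrable) (simp add: power2_eq_square)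
  have hm: "has_bochner_integral lborel (indicator q :: real^'n \<Rightarrow> real) m"
    using has_bochner_integral_real_indicator[of q lborel] q by (simp add: measure_def)
  have inner: "has_bochner_integral lborel (\<lambda>y. indicator q y * (\<phi> y - \<phi> x)\<^sup>2) (J - 2 * \<phi> x * I + (\<phi> x)\<^sup>2 * m)" for x
  proof -
    have "has_bochner_integral lborel (\<lambda>y. indicator q y * (\<phi> y)\<^sup>2 - 2 * \<phi> x * (indicator q y * \<phi> y) + (\<phi> x)\<^sup>2 * indicator q y)
      (J - 2 * \<phi> x * I + (\<phi> x)\<^sup>2 * m)"
      by (intro has_bochner_integral_add has_bochner_integral_diff has_bochner_integral_mult_right hI hJ hm)
    moreover have "(\<lambda>y. indicator q y * (\<phi> y)\<^sup>2 - 2 * \<phi> x * (indicator q y * \<phi> y) + (\<phi> x)\<^sup>2 * indicator q y) =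
      (\<lambda>y. indicator q y * (\<phi> y - \<phi> x)\<^sup>2)"
      by (rule ext) (simp add: power2_diff algebra_simps)
    ultimately show ?thesis by simp
  qed
  have nonneg: "0 \<le> J - 2 * \<phi> x * I + (\<phi> x)\<^sup>2 * m" for x
    unfolding has_bochner_integral_integral_eq[OF inner, of x, symmetric]
    by (intro Bochner_Integration.integral_nonneg) simp
  have "has_bochner_integral lborel (\<lambda>x. J * indicator q x - 2 * I * (indicator q x * \<phi> x) + m * (indicator q x * (\<phi> x)\<^sup>2))
      (J * m - 2 * I * I + m * J)"
    by (intro has_bochner_integral_add has_bochner_integral_diff has_bochner_integral_mult_right hI hJ hm)
  moreover have "(\<lambda>x. J * indicator q x - 2 * I * (indicator q x * \<phi> x) + m * (indicator q x * (\<phi> x)\<^sup>2)) =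
      (\<lambda>x. indicator q x * (J - 2 * \<phi> x * I + (\<phi> x)\<^sup>2 * m))"
    by (rule ext) (simp add: algebra_simps)
  ultimately have outer: "has_bochner_integral lborel (\<lambda>x. indicator q x * (J - 2 * \<phi> x * I + (\<phi> x)\<^sup>2 * m)) (2 * m * J - 2 * I\<^sup>2)"
    by (simp add: power2_eq_square algebra_simps)
  have "(\<integral>\<^sup>+y. ennreal (indicator q x * indicator q y * (\<phi> y - \<phi> x)\<^sup>2) \<partial>lborel) =
      ennreal (indicator q x * (J - 2 * \<phi> x * I + (\<phi> x)\<^sup>2 * m))" for x
    using nn_integral_eq_integral[of lborel "\<lambda>y. indicator q y * (\<phi> y - \<phi> x)\<^sup>2"] inner[of x]
    by (cases "x \<in> q") (auto simp: has_bochner_integral_iff)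
  then have "(\<integral>\<^sup>+x. (\<integral>\<^sup>+y. ennreal (indicator q x * indicator q y * (\<phi> y - \<phi> x)\<^sup>2) \<partial>lborel) \<partial>lborel) =
    (\<integral>\<^sup>+x. ennreal (indicator q x * (J - 2 * \<phi> x * I + (\<phi> x)\<^sup>2 * m)) \<partial>lborel)" by simp
  also have "\<dots> = ennreal (2 * m * J - 2 * I\<^sup>2)"
    using nn_integral_eq_integral[of lborel "\<lambda>x. indicator q x * (J - 2 * \<phi> x * I + (\<phi> x)\<^sup>2 * m)"] outer nonneg
    by (simp add: has_bochner_integral_iff)
  finally show ?thesis by (simp add: I_def J_def)
qed

text \<open>Points of a common cell differ by a vector of the cube with side \<open>2 * \<epsilon>\<close>, so the local
  oscillations are controlled by the translation differences.\<close>

lemma grid_oscillation_bound: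
  fixes \<phi> :: "real^'n \<Rightarrow> real" and C :: "('n \<Rightarrow> int) set"
  assumes \<phi>: "\<phi> \<in> test_functions \<Omega>" and "0 < \<epsilon>" "finite C"
  shows "(\<Sum>c\<in>C. \<integral>\<^sup>+x. (\<integral>\<^sup>+y. ennreal (indicator (grid_cell \<epsilon> c) x * indicator (grid_cell \<epsilon> c) y * (\<phi> y - \<phi> x)\<^sup>2) \<partial>lborel) \<partial>lborel)
    \<le> ennreal (real CARD('n) * \<epsilon>\<^sup>2 * dirichlet \<phi> * (2 * \<epsilon>) ^ DIM(real^'n))"
proof -
  have [measurable]: "\<phi> \<in> borel_measurable borel" by (rule test_function_integrable(3)[OF \<phi>])
  have [measurable]: "grid_cell \<epsilon> c \<in> sets borel" for c :: "'n \<Rightarrow> int" by (rule grid_cell_measurable)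
  \<comment> \<open>All differences of two points of one cell lie here. Its volume is
    \<open>(2 \<epsilon>)^n\<close>, and its elements satisfy
    \<open>norm h ^ 2 <= n \<epsilon>^2\<close>.\<close>
  define D :: "(real^'n) set" where "D = cbox (\<chi> i. - \<epsilon>) (\<chi> i. \<epsilon>)"
  have [measurable]: "D \<in> sets borel" by (simp add: D_def)
  have cell: "(\<Sum>c\<in>C. ennreal (indicator (grid_cell \<epsilon> c) x * indicator (grid_cell \<epsilon> c) y * (\<phi> y - \<phi> x)\<^sup>2))
      \<le> indicator D (y - x) * ennreal ((\<phi> y - \<phi> x)\<^sup>2)" for x y
  proof -
    define c0 where "c0 = (\<lambda>i. \<lfloor>x $ i / \<epsilon>\<rfloor>)"
    have "(\<Sum>c\<in>C. ennreal (indicator (grid_cell \<epsilon> c) x * indicator (grid_cell \<epsilon> c) y * (\<phi> y - \<phi> x)\<^sup>2)) =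
      (\<Sum>c\<in>C. if c = c0 then indicator (grid_cell \<epsilon> c0) y * ennreal ((\<phi> y - \<phi> x)\<^sup>2) else 0)"
    proof (intro sum.cong refl)
      fix c
      have "x \<in> grid_cell \<epsilon> c \<longleftrightarrow> c = c0"
        using grid_cell_unique[OF assms(2)] in_grid_cell[OF assms(2)] unfolding c0_def by blast
      then show "ennreal (indicator (grid_cell \<epsilon> c) x * indicator (grid_cell \<epsilon> c) y * (\<phi> y - \<phi> x)\<^sup>2) =
          (if c = c0 then indicator (grid_cell \<epsilon> c0) y * ennreal ((\<phi> y - \<phi> x)\<^sup>2) else 0)"
        by (cases "c = c0"; cases "y \<in> grid_cell \<epsilon> c") auto
    qed
    also have "\<dots> \<le> indicator (grid_cell \<epsilon> c0) y * ennreal ((\<phi> y - \<phi> x)\<^sup>2)"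
      using assms(3) by simp
    also have "\<dots> \<le> indicator D (y - x) * ennreal ((\<phi> y - \<phi> x)\<^sup>2)"
    proof (cases "y \<in> grid_cell \<epsilon> c0")
      case True
      have x: "x \<in> grid_cell \<epsilon> c0" unfolding c0_def by (rule in_grid_cell[OF assms(2)])
      have "- \<epsilon> \<le> y $ i - x $ i \<and> y $ i - x $ i \<le> \<epsilon>" for i
      proof -
        have "\<epsilon> * c0 i \<le> y $ i" "y $ i < \<epsilon> * c0 i + \<epsilon>" "\<epsilon> * c0 i \<le> x $ i" "x $ i < \<epsilon> * c0 i + \<epsilon>"
          using True x by (simp_all add: grid_cell_def distrib_left)
        then show ?thesis by linarith
      qed
      then have "y - x \<in> D" by (simp add: D_def mem_box_cart)
      then show ?thesis by (simp add: indicator_def)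
    qed simp
    finally show ?thesis .
  qed
  have "(\<Sum>c\<in>C. \<integral>\<^sup>+x. (\<integral>\<^sup>+y. ennreal (indicator (grid_cell \<epsilon> c) x * indicator (grid_cell \<epsilon> c) y * (\<phi> y - \<phi> x)\<^sup>2) \<partial>lborel) \<partial>lborel)
    = (\<integral>\<^sup>+x. (\<integral>\<^sup>+y. (\<Sum>c\<in>C. ennreal (indicator (grid_cell \<epsilon> c) x * indicator (grid_cell \<epsilon> c) y * (\<phi> y - \<phi> x)\<^sup>2)) \<partial>lborel) \<partial>lborel)"
    by (simp add: nn_integral_sum del: sum_ennreal)
  also have "\<dots> \<le> (\<integral>\<^sup>+x. (\<integral>\<^sup>+y. indicator D (y - x) * ennreal ((\<phi> y - \<phi> x)\<^sup>2) \<partial>lborel) \<partial>lborel)"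
    by (intro nn_integral_mono cell)
  \<comment> \<open>With \<open>h = y - x\<close> as inner variable the constraint no longer
    involves \<open>x\<close>, and for fixed \<open>h\<close> the integral over \<open>x\<close> is
    a translation difference.\<close>
  also have "\<dots> = (\<integral>\<^sup>+x. (\<integral>\<^sup>+h. indicator D h * ennreal ((\<phi> (x + h) - \<phi> x)\<^sup>2) \<partial>lborel) \<partial>lborel)"
  proof (rule nn_integral_cong)
    fix x
    show "(\<integral>\<^sup>+y. indicator D (y - x) * ennreal ((\<phi> y - \<phi> x)\<^sup>2) \<partial>lborel) =
      (\<integral>\<^sup>+h. indicator D h * ennreal ((\<phi> (x + h) - \<phi> x)\<^sup>2) \<partial>lborel)"
      using nn_integral_lborel_translate[of "\<lambda>y. indicator D (y - x) * ennreal ((\<phi> y - \<phi> x)\<^sup>2)" x] by simp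
  qed
  also have "\<dots> = (\<integral>\<^sup>+h. (\<integral>\<^sup>+x. indicator D h * ennreal ((\<phi> (x + h) - \<phi> x)\<^sup>2) \<partial>lborel) \<partial>lborel)"
    by (rule lborel_pair.Fubini'[symmetric]) measurable
  also have "\<dots> \<le> (\<integral>\<^sup>+h. ennreal (real CARD('n) * \<epsilon>\<^sup>2 * dirichlet \<phi>) * indicator D h \<partial>lborel)"
  proof (intro nn_integral_mono)
    fix h
    show "(\<integral>\<^sup>+x. indicator D h * ennreal ((\<phi> (x + h) - \<phi> x)\<^sup>2) \<partial>lborel) \<le> ennreal (real CARD('n) * \<epsilon>\<^sup>2 * dirichlet \<phi>) * indicator D h"
    proof (cases "h \<in> D")
      case True
      have "(norm h)\<^sup>2 = (\<Sum>i\<in>UNIV. (h $ i)\<^sup>2)" by (simp add: norm_vec_def L2_set_def sum_nonneg)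
      also have "\<dots> \<le> (\<Sum>i\<in>(UNIV::'n set). \<epsilon>\<^sup>2)"
        using True assms(2) by (intro sum_mono) (auto simp: D_def mem_box_cart power2_le_iff_abs_le abs_le_iff minus_le_iff)
      finally have "(norm h)\<^sup>2 * dirichlet \<phi> \<le> real CARD('n) * \<epsilon>\<^sup>2 * dirichlet \<phi>"
        by (intro mult_right_mono dirichlet_nonneg) simp
      then have "(\<integral>\<^sup>+x. ennreal ((\<phi> (x + h) - \<phi> x)\<^sup>2) \<partial>lborel) \<le> ennreal (real CARD('n) * \<epsilon>\<^sup>2 * dirichlet \<phi>)"
        using nn_integral_translation_difference[OF \<phi>, of h] ennreal_leI order_trans by blast
      then show ?thesis using True by simp
    qed simp
  qed
  also have "\<dots> = ennreal (real CARD('n) * \<epsilon>\<^sup>2 * dirichlet \<phi>) * emeasure lborel D"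
    by (subst nn_integral_cmult_indicator) auto
  also have "emeasure lborel D = ennreal ((2 * \<epsilon>) ^ DIM(real^'n))"
  proof -
    have "((\<chi> i. \<epsilon>) - (\<chi> i. - \<epsilon>) :: real^'n) \<bullet> b = 2 * \<epsilon>" if "b \<in> Basis" for b
      using that by (auto simp: Basis_vec_def inner_axis)
    moreover then have "(\<chi> i. - \<epsilon> :: real^'n) \<bullet> b \<le> (\<chi> i. \<epsilon>) \<bullet> b" if "b \<in> Basis" for b
      using that assms(2) by (fastforce simp: inner_diff_left)
    ultimately show ?thesis unfolding D_def by (subst emeasure_lborel_cbox) simp_all
  qed
  finally show ?thesis using assms(2) by (simp add: ennreal_mult dirichlet_nonneg)
qed

text \<open>On each cell the squared norm is the mean part plus the oscillation. The mean parts are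
  the finitely many inner products, and the oscillations together are at most
  \<open>\<delta> / 2\<close> times the Dirichlet integral once the cells are small.\<close>

lemma ehrling_test_functions:
  fixes \<Omega> :: "(real^'n) set"
  assumes "bounded \<Omega>" "0 < \<delta>"
  obtains C :: "('n \<Rightarrow> int) set" and g where "finite C"
    "\<And>\<phi>. \<phi> \<in> test_functions \<Omega> \<Longrightarrow>
      (norm (abs_L2 \<phi>))\<^sup>2 \<le> \<delta> * dirichlet \<phi> + (\<Sum>c\<in>C. (abs_L2 \<phi> \<bullet> g c)\<^sup>2)"
proof -
  define n where "n = DIM(real^'n)"
  have n: "real CARD('n) = real n" "0 < n" by (simp_all add: n_def)
  \<comment> \<open>The oscillation bound is \<open>n \<epsilon>^2 (2 \<epsilon>)^n\<close>;
    dividing by the cell volume \<open>m = \<epsilon>^n\<close> leaves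
    \<open>2^n n \<epsilon>^2\<close>, which this choice makes equal to
    \<open>\<delta>\<close>.\<close>
  define \<epsilon> where "\<epsilon> = sqrt (\<delta> / (2 ^ n * real n))"
  have e: "0 < \<epsilon>" "2 ^ n * real n * \<epsilon>\<^sup>2 = \<delta>" using assms(2) n(2) by (simp_all add: \<epsilon>_def)
  define m where "m = \<epsilon> ^ n"
  have m: "0 < m" using e(1) by (simp add: m_def)
  define C where "C = {c :: 'n \<Rightarrow> int. grid_cell \<epsilon> c \<inter> \<Omega> \<noteq> {}}"
  have C: "finite C" unfolding C_def by (rule finite_grid_cover[OF assms(1) e(1)])
  define g where "g c = (1 / sqrt m) *\<^sub>R abs_L2 (indicator (grid_cell \<epsilon> c) :: real^'n \<Rightarrow> real)" for c
  have em: "emeasure lborel (grid_cell \<epsilon> c) = ennreal m" for c :: "'n \<Rightarrow> int"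
    unfolding m_def n_def by (rule emeasure_grid_cell[OF e(1)])
  have si: "square_integrable (indicator (grid_cell \<epsilon> c) :: real^'n \<Rightarrow> real)" for c :: "'n \<Rightarrow> int"
    unfolding square_integrable_def using grid_cell_measurable[of \<epsilon> c] em[of c]
    by (auto simp: power2_eq_square indicator_inter_arith[symmetric] intro!: integrable_real_indicator borel_measurable_indicator)
  have "(norm (abs_L2 \<phi>))\<^sup>2 \<le> \<delta> * dirichlet \<phi> + (\<Sum>c\<in>C. (abs_L2 \<phi> \<bullet> g c)\<^sup>2)" if \<phi>: "\<phi> \<in> test_functions \<Omega>" for \<phi>
  proof -
    have [measurable]: "\<phi> \<in> borel_measurable borel" by (rule test_function_integrable(3)[OF \<phi>])
    have [measurable]: "grid_cell \<epsilon> c \<in> sets borel" for c :: "'n \<Rightarrow> int" by (rule grid_cell_measurable)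
    define I where "I c = (LINT x|lborel. indicator (grid_cell \<epsilon> c) x * \<phi> x)" for c
    define J where "J c = (LINT x|lborel. indicator (grid_cell \<epsilon> c) x * (\<phi> x)\<^sup>2)" for c
    have iJ: "integrable lborel (\<lambda>x. indicator (grid_cell \<epsilon> c) x * (\<phi> x)\<^sup>2)" for c
      using integrable_mult_indicator[of "grid_cell \<epsilon> c" lborel, OF _ test_function_integrable(1)[OF test_function_mult[OF \<phi> \<phi>]]]
        grid_cell_measurable[of \<epsilon> c] by (simp add: power2_eq_square)
    have dbl: "(\<integral>\<^sup>+x. (\<integral>\<^sup>+y. ennreal (indicator (grid_cell \<epsilon> c) x * indicator (grid_cell \<epsilon> c) y * (\<phi> y - \<phi> x)\<^sup>2) \<partial>lborel) \<partial>lborel)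
        = ennreal (2 * m * J c - 2 * (I c)\<^sup>2)" for c
      unfolding I_def J_def by (rule double_integral_square_difference[OF \<phi> grid_cell_measurable em m])
    \<comment> \<open>Embedding into \<open>ennreal\<close> truncates negative terms to 0, so on the
      level of sums only this inequality is claimed.\<close>
    have "ennreal (\<Sum>c\<in>C. 2 * m * J c - 2 * (I c)\<^sup>2) \<le> (\<Sum>c\<in>C. ennreal (2 * m * J c - 2 * (I c)\<^sup>2))"
    proof -
      have "(\<Sum>c\<in>C. 2 * m * J c - 2 * (I c)\<^sup>2) \<le> (\<Sum>c\<in>C. max 0 (2 * m * J c - 2 * (I c)\<^sup>2))"
        by (intro sum_mono) simp
      then have "ennreal (\<Sum>c\<in>C. 2 * m * J c - 2 * (I c)\<^sup>2) \<le> ennreal (\<Sum>c\<in>C. max 0 (2 * m * J c - 2 * (I c)\<^sup>2))"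
        by (rule ennreal_leI)
      also have "\<dots> = (\<Sum>c\<in>C. ennreal (max 0 (2 * m * J c - 2 * (I c)\<^sup>2)))"
        by (rule sum_ennreal[symmetric]) simp
      also have "\<dots> = (\<Sum>c\<in>C. ennreal (2 * m * J c - 2 * (I c)\<^sup>2))"
        by (intro sum.cong refl) (simp add: max_def ennreal_neg)
      finally show ?thesis .
    qed
    also have "\<dots> \<le> ennreal (real CARD('n) * \<epsilon>\<^sup>2 * dirichlet \<phi> * (2 * \<epsilon>) ^ DIM(real^'n))"
      using grid_oscillation_bound[OF \<phi> e(1) C] unfolding dbl .
    finally have "(\<Sum>c\<in>C. 2 * m * J c - 2 * (I c)\<^sup>2) \<le> real n * \<epsilon>\<^sup>2 * dirichlet \<phi> * (2 * \<epsilon>) ^ n"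
      using e(1) dirichlet_nonneg[of \<phi>] ennreal_le_iff[of "real CARD('n) * \<epsilon>\<^sup>2 * dirichlet \<phi> * (2 * \<epsilon>) ^ DIM(real^'n)"]
      unfolding n(1) n_def[symmetric] by simp
    also have "\<dots> = m * (\<delta> * dirichlet \<phi>)"
      unfolding e(2)[symmetric] m_def by (simp add: power_mult_distrib)
    finally have le: "2 * m * (\<Sum>c\<in>C. J c) - 2 * (\<Sum>c\<in>C. (I c)\<^sup>2) \<le> m * (\<delta> * dirichlet \<phi>)"
      by (simp add: sum_subtractf sum_distrib_left)
    have "(\<Sum>c\<in>C. J c) = (LINT x|lborel. (\<Sum>c\<in>C. indicator (grid_cell \<epsilon> c) x * (\<phi> x)\<^sup>2))"
      unfolding J_def using iJ by (simp add: Bochner_Integration.integral_sum)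
    also have "\<dots> = (LINT x|lborel. \<phi> x * \<phi> x)"
    proof (intro Bochner_Integration.integral_cong refl)
      fix x :: "real^'n"
      define c0 where "c0 = (\<lambda>i. \<lfloor>x $ i / \<epsilon>\<rfloor>)"
      have x: "x \<in> grid_cell \<epsilon> c0" unfolding c0_def by (rule in_grid_cell[OF e(1)])
      show "(\<Sum>c\<in>C. indicator (grid_cell \<epsilon> c) x * (\<phi> x)\<^sup>2) = \<phi> x * \<phi> x"
      proof (cases "x \<in> \<Omega>")
        case True
        then have "c0 \<in> C" using x by (auto simp: C_def)
        have "(\<Sum>c\<in>C. indicator (grid_cell \<epsilon> c) x * (\<phi> x)\<^sup>2) = (\<Sum>c\<in>C. if c = c0 then (\<phi> x)\<^sup>2 else 0)"
        proof (intro sum.cong refl)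
          fix c
          have "x \<in> grid_cell \<epsilon> c \<longleftrightarrow> c = c0" using x grid_cell_unique[OF e(1)] unfolding c0_def by blast
          then show "indicator (grid_cell \<epsilon> c) x * (\<phi> x)\<^sup>2 = (if c = c0 then (\<phi> x)\<^sup>2 else 0)" by (cases "c = c0") auto
        qed
        then show ?thesis using C \<open>c0 \<in> C\<close> by (simp add: power2_eq_square)
      qed (simp add: test_functionD(6)[OF \<phi>])
    qed
    also have "\<dots> = (norm (abs_L2 \<phi>))\<^sup>2"
      unfolding power2_norm_eq_inner inner_abs_L2[OF test_functionD(7)[OF \<phi>] test_functionD(7)[OF \<phi>]]
      by (intro integral_completion[symmetric]) measurable
    finally have J: "(\<Sum>c\<in>C. J c) = (norm (abs_L2 \<phi>))\<^sup>2" .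
    have "(abs_L2 \<phi> \<bullet> g c)\<^sup>2 = (I c)\<^sup>2 / m" for c
    proof -
      have "abs_L2 \<phi> \<bullet> abs_L2 (indicator (grid_cell \<epsilon> c)) = (LINT x|lebesgue. \<phi> x * indicator (grid_cell \<epsilon> c) x)"
        by (rule inner_abs_L2[OF test_functionD(7)[OF \<phi>] si])
      also have "\<dots> = (LINT x|lborel. \<phi> x * indicator (grid_cell \<epsilon> c) x)"
        by (intro integral_completion) measurable
      finally have "abs_L2 \<phi> \<bullet> g c = I c / sqrt m" by (simp add: g_def I_def mult.commute)
      then show ?thesis using m by (simp add: power_divide)
    qed
    then have "(\<Sum>c\<in>C. (I c)\<^sup>2) = m * (\<Sum>c\<in>C. (abs_L2 \<phi> \<bullet> g c)\<^sup>2)" using m by (simp add: sum_divide_distrib[symmetric])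
    with le J have "m * (2 * (norm (abs_L2 \<phi>))\<^sup>2) \<le> m * (\<delta> * dirichlet \<phi> + 2 * (\<Sum>c\<in>C. (abs_L2 \<phi> \<bullet> g c)\<^sup>2))"
      by (simp add: algebra_simps)
    then have "2 * (norm (abs_L2 \<phi>))\<^sup>2 \<le> \<delta> * dirichlet \<phi> + 2 * (\<Sum>c\<in>C. (abs_L2 \<phi> \<bullet> g c)\<^sup>2)" using m by simp
    moreover have "0 \<le> \<delta> * dirichlet \<phi>" using assms(2) dirichlet_nonneg[of \<phi>] by simp
    ultimately show ?thesis by linarith
  qed
  then show ?thesis using that C by blast
qed

section \<open>The space \<open>H\<^sub>0\<^sup>1\<close>\<close>

lemma H1_norm_ge:
  "norm v \<le> H1_norm \<Omega> v" "norm (weak_deriv \<Omega> j v) \<le> H1_norm \<Omega> v"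
proof -
  have s: "(norm (weak_deriv \<Omega> j v))\<^sup>2 \<le> (\<Sum>j\<in>UNIV. (norm (weak_deriv \<Omega> j v))\<^sup>2)"
    by (rule member_le_sum) auto
  show "norm v \<le> H1_norm \<Omega> v"
    unfolding H1_norm_def by (intro real_le_rsqrt) (simp add: sum_nonneg)
  show "norm (weak_deriv \<Omega> j v) \<le> H1_norm \<Omega> v"
    unfolding H1_norm_def using s by (intro real_le_rsqrt) (simp add: add_increasing)
qed

lemma weak_deriv_diff_test_function:
  "open \<Omega> \<Longrightarrow> v \<in> H1 \<Omega> \<Longrightarrow> \<phi> \<in> test_functions \<Omega> \<Longrightarrow>
    weak_deriv \<Omega> j (v - abs_L2 \<phi>) = weak_deriv \<Omega> j v - abs_L2 (\<lambda>x. grad \<phi> x $ j)"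
  using weak_deriv_diff[OF _ _ test_function_in_H1] weak_deriv_eq[OF _ is_weak_deriv_test_function] by metis

text \<open>The defining identities are inner products with fixed vectors, hence continuous; the
  graph of the weak derivative is closed.\<close>

lemma is_weak_deriv_limit:
  assumes "open \<Omega>" "\<And>n. is_weak_deriv \<Omega> j (w n) (h n)" "w \<longlonglongrightarrow> v" "h \<longlonglongrightarrow> g"
  shows "is_weak_deriv \<Omega> j v g"
  unfolding is_weak_deriv_iff
proof (intro conjI ballI)
  have "\<Omega> \<in> sets lebesgue" using assms(1) by (simp add: borel_open)
  then show "g \<in> L2_on \<Omega>"
    using L2_on_closed[of \<Omega> h g] assms(2,4) unfolding is_weak_deriv_iff by blast
next
  fix \<phi> assume "\<phi> \<in> test_functions \<Omega>"
  then have "w n \<bullet> abs_L2 (\<lambda>x. grad \<phi> x $ j) = - (h n \<bullet> abs_L2 \<phi>)" for n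
    using assms(2)[of n] unfolding is_weak_deriv_iff by blast
  moreover have "(\<lambda>n. w n \<bullet> abs_L2 (\<lambda>x. grad \<phi> x $ j)) \<longlonglongrightarrow> v \<bullet> abs_L2 (\<lambda>x. grad \<phi> x $ j)"
    "(\<lambda>n. - (h n \<bullet> abs_L2 \<phi>)) \<longlonglongrightarrow> - (g \<bullet> abs_L2 \<phi>)"
    by (intro tendsto_intros assms(3,4))+
  ultimately show "v \<bullet> abs_L2 (\<lambda>x. grad \<phi> x $ j) = - (g \<bullet> abs_L2 \<phi>)"
    using LIMSEQ_unique by force
qed

lemma H10_approximation:
  assumes "open \<Omega>" "v \<in> H10 \<Omega>" "0 < \<epsilon>"
  obtains \<phi> where "\<phi> \<in> test_functions \<Omega>" "norm (v - abs_L2 \<phi>) < \<epsilon>"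
    "\<And>j. norm (weak_deriv \<Omega> j v - abs_L2 (\<lambda>x. grad \<phi> x $ j)) < \<epsilon>"
proof -
  have v: "v \<in> H1 \<Omega>" using assms(2) by (simp add: H10_def)
  obtain \<phi> where \<phi>: "\<phi> \<in> test_functions \<Omega>" "H1_norm \<Omega> (v - abs_L2 \<phi>) < \<epsilon>"
    using assms(2,3) unfolding H10_def by blast
  have "norm (weak_deriv \<Omega> j v - abs_L2 (\<lambda>x. grad \<phi> x $ j)) < \<epsilon>" for j
    using H1_norm_ge(2)[of \<Omega> j "v - abs_L2 \<phi>"] \<phi>(2)
    unfolding weak_deriv_diff_test_function[OF assms(1) v \<phi>(1)] by linarith
  then show ?thesis using that[OF \<phi>(1)] H1_norm_ge(1)[of "v - abs_L2 \<phi>" \<Omega>] \<phi>(2) by fastforce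
qed

text \<open>The closed graph identifies the limits \<open>g j\<close> as weak derivatives, and then
  the \<open>H1_norm\<close> of the error tends to 0. Sums, multiples and limits are shown to lie in
  \<open>H10\<close> by this criterion.\<close>

lemma H10_limit_of_test_functions:
  assumes "open \<Omega>" and \<phi>: "\<And>n. \<phi> n \<in> test_functions \<Omega>"
    and lim: "(\<lambda>n. abs_L2 (\<phi> n)) \<longlonglongrightarrow> v" "\<And>j. (\<lambda>n. abs_L2 (\<lambda>x. grad (\<phi> n) x $ j)) \<longlonglongrightarrow> g j"
  shows "v \<in> H10 \<Omega>" "weak_deriv \<Omega> j v = g j"
proof -
  have wd: "is_weak_deriv \<Omega> j v (g j)" for j
    by (rule is_weak_deriv_limit[OF assms(1) is_weak_deriv_test_function[OF \<phi>] lim])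
  then show eq: "weak_deriv \<Omega> j v = g j" for j by (rule weak_deriv_eq[OF assms(1)])
  have "\<Omega> \<in> sets lebesgue" using assms(1) by (simp add: borel_open)
  then have "v \<in> L2_on \<Omega>"
    using L2_on_closed[OF _ _ lim(1)] abs_L2_in_L2_on[OF test_functionD(7,6)[OF \<phi>]] by blast
  then have v: "v \<in> H1 \<Omega>" using wd by (auto simp: H1_def)
  have "(\<lambda>n. H1_norm \<Omega> (v - abs_L2 (\<phi> n))) \<longlonglongrightarrow> sqrt ((norm (v - v))\<^sup>2 + (\<Sum>j\<in>UNIV. (norm (g j - g j))\<^sup>2))"
    unfolding H1_norm_def weak_deriv_diff_test_function[OF assms(1) v \<phi>] eq
    by (intro tendsto_intros lim)
  then have "(\<lambda>n. H1_norm \<Omega> (v - abs_L2 (\<phi> n))) \<longlonglongrightarrow> 0" by simp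
  then have "\<exists>n. H1_norm \<Omega> (v - abs_L2 (\<phi> n)) < \<epsilon>" if "0 < \<epsilon>" for \<epsilon>
    using order_tendstoD(2)[OF _ that] eventually_happens by fastforce
  then show "v \<in> H10 \<Omega>" unfolding H10_def using v \<phi> by blast
qed

lemma tendsto_of_norm_diff_less:
  fixes x :: "nat \<Rightarrow> 'a::real_normed_vector"
  assumes "x \<longlonglongrightarrow> l" "\<And>n. norm (x n - y n) < inverse (real (Suc n))"
  shows "y \<longlonglongrightarrow> l"
proof -
  have "(\<lambda>n. x n - y n) \<longlonglongrightarrow> 0"
    by (rule Lim_null_comparison[OF _ LIMSEQ_inverse_real_of_nat])
      (use assms(2) in \<open>auto intro!: always_eventually less_imp_le\<close>)
  from tendsto_diff[OF assms(1) this] show ?thesis by simp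
qed

text \<open>Diagonal choice: each \<open>w n\<close> is replaced by a test function within
  \<open>1 / (n + 1)\<close>, in the function and in all derivatives, which leaves the limits
  unchanged.\<close>

lemma H10_closed:
  assumes "open \<Omega>" "\<And>n. w n \<in> H10 \<Omega>" "w \<longlonglongrightarrow> v" "\<And>j. (\<lambda>n. weak_deriv \<Omega> j (w n)) \<longlonglongrightarrow> g j"
  shows "v \<in> H10 \<Omega>" "weak_deriv \<Omega> j v = g j"
proof -
  have "\<exists>\<phi>. \<phi> \<in> test_functions \<Omega> \<and> norm (w n - abs_L2 \<phi>) < inverse (real (Suc n)) \<and>
    (\<forall>j. norm (weak_deriv \<Omega> j (w n) - abs_L2 (\<lambda>x. grad \<phi> x $ j)) < inverse (real (Suc n)))" for n
    using H10_approximation[OF assms(1,2), of "inverse (real (Suc n))" n] by (metis inverse_positive_iff_positive of_nat_0_less_iff zero_less_Suc)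
  then obtain \<phi> where \<phi>: "\<And>n. \<phi> n \<in> test_functions \<Omega>" "\<And>n. norm (w n - abs_L2 (\<phi> n)) < inverse (real (Suc n))"
    "\<And>n j. norm (weak_deriv \<Omega> j (w n) - abs_L2 (\<lambda>x. grad (\<phi> n) x $ j)) < inverse (real (Suc n))"
    by metis
  have "(\<lambda>n. abs_L2 (\<phi> n)) \<longlonglongrightarrow> v" "(\<lambda>n. abs_L2 (\<lambda>x. grad (\<phi> n) x $ j)) \<longlonglongrightarrow> g j" for j
    using tendsto_of_norm_diff_less[OF assms(3) \<phi>(2)] tendsto_of_norm_diff_less[OF assms(4) \<phi>(3)] by blast+
  from H10_limit_of_test_functions[OF assms(1) \<phi>(1) this]
  show "v \<in> H10 \<Omega>" "weak_deriv \<Omega> j v = g j" by blast+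
qed

lemma H10_approximating_sequence:
  assumes "open \<Omega>" "v \<in> H10 \<Omega>"
  obtains \<phi> where "\<And>n. \<phi> n \<in> test_functions \<Omega>" "(\<lambda>n. abs_L2 (\<phi> n)) \<longlonglongrightarrow> v"
    "\<And>j. (\<lambda>n. abs_L2 (\<lambda>x. grad (\<phi> n) x $ j)) \<longlonglongrightarrow> weak_deriv \<Omega> j v"
proof -
  have "\<exists>\<phi>. \<phi> \<in> test_functions \<Omega> \<and> norm (v - abs_L2 \<phi>) < inverse (real (Suc n)) \<and>
    (\<forall>j. norm (weak_deriv \<Omega> j v - abs_L2 (\<lambda>x. grad \<phi> x $ j)) < inverse (real (Suc n)))" for n
    using H10_approximation[OF assms, of "inverse (real (Suc n))"] by (metis inverse_positive_iff_positive of_nat_0_less_iff zero_less_Suc)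
  then obtain \<phi> where \<phi>: "\<And>n. \<phi> n \<in> test_functions \<Omega>" "\<And>n. norm (v - abs_L2 (\<phi> n)) < inverse (real (Suc n))"
    "\<And>n j. norm (weak_deriv \<Omega> j v - abs_L2 (\<lambda>x. grad (\<phi> n) x $ j)) < inverse (real (Suc n))"
    by metis
  show ?thesis
    using that[OF \<phi>(1) tendsto_of_norm_diff_less[OF tendsto_const \<phi>(2)] tendsto_of_norm_diff_less[OF tendsto_const \<phi>(3)]] .
qed

section \<open>Linear structure of \<open>H10\<close> and inequalities by density\<close>

lemma test_function_add:
  assumes "\<phi> \<in> test_functions \<Omega>" "\<psi> \<in> test_functions \<Omega>"
  shows "(\<lambda>x. \<phi> x + \<psi> x) \<in> test_functions \<Omega>"
proof -
  have c: "closure {x. \<phi> x + \<psi> x \<noteq> 0} \<subseteq> closure {x. \<phi> x \<noteq> 0} \<union> closure {x. \<psi> x \<noteq> 0}"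
    unfolding closure_Un[symmetric] by (intro closure_mono) auto
  have "compact (closure {x. \<phi> x \<noteq> 0} \<union> closure {x. \<psi> x \<noteq> 0})"
    using assms by (intro compact_Un) (simp_all add: test_functions_def)
  then have "compact (closure {x. \<phi> x + \<psi> x \<noteq> 0})"
    using compact_closure_subset[of "{x. \<phi> x \<noteq> 0} \<union> {x. \<psi> x \<noteq> 0}"] c unfolding closure_Un by blast
  then show ?thesis
    using assms c unfolding test_functions_def by (auto intro: times_differentiable_add)
qed

lemma test_function_cmult:
  assumes "\<phi> \<in> test_functions \<Omega>"
  shows "(\<lambda>x. c * \<phi> x) \<in> test_functions \<Omega>"
proof -
  have "closure {x. c * \<phi> x \<noteq> 0} \<subseteq> closure {x. \<phi> x \<noteq> 0}" by (intro closure_mono) auto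
  then show ?thesis
    using assms compact_closure_subset times_differentiable_mult[OF times_differentiable_const]
    unfolding test_functions_def by blast
qed

lemma grad_add:
  fixes f g :: "real^'n \<Rightarrow> real"
  assumes "f differentiable (at x)" "g differentiable (at x)"
  shows "grad (\<lambda>x. f x + g x) x = grad f x + grad g x"
  using grad_eqI[OF has_derivative_add[OF has_derivative_grad[OF assms(1)] has_derivative_grad[OF assms(2)]]]
  by (simp add: vec_eq_iff inner_axis)

lemma grad_cmult:
  fixes f :: "real^'n \<Rightarrow> real"
  assumes "f differentiable (at x)"
  shows "grad (\<lambda>x. c * f x) x = c *\<^sub>R grad f x"
  using grad_eqI[OF has_derivative_mult_right[OF has_derivative_grad[OF assms], of c]]
  by (simp add: vec_eq_iff inner_axis)

lemma subspace_H10: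
  assumes "open \<Omega>"
  shows "subspace (H10 \<Omega>)"
proof (rule subspaceI)
  fix v w assume "v \<in> H10 \<Omega>" "w \<in> H10 \<Omega>"
  from H10_approximating_sequence[OF assms this(1)] H10_approximating_sequence[OF assms this(2)]
  obtain \<phi> \<psi> where
    \<phi>: "\<And>n. \<phi> n \<in> test_functions \<Omega>" "(\<lambda>n. abs_L2 (\<phi> n)) \<longlonglongrightarrow> v" "\<And>j. (\<lambda>n. abs_L2 (\<lambda>x. grad (\<phi> n) x $ j)) \<longlonglongrightarrow> weak_deriv \<Omega> j v"
    and \<psi>: "\<And>n. \<psi> n \<in> test_functions \<Omega>" "(\<lambda>n. abs_L2 (\<psi> n)) \<longlonglongrightarrow> w" "\<And>j. (\<lambda>n. abs_L2 (\<lambda>x. grad (\<psi> n) x $ j)) \<longlonglongrightarrow> weak_deriv \<Omega> j w"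
    by metis
  have "(\<lambda>n. abs_L2 (\<lambda>x. \<phi> n x + \<psi> n x)) \<longlonglongrightarrow> v + w"
    using tendsto_add[OF \<phi>(2) \<psi>(2)] by (simp add: plus_abs_L2 test_functionD(7)[OF \<phi>(1)] test_functionD(7)[OF \<psi>(1)])
  moreover have "(\<lambda>n. abs_L2 (\<lambda>x. grad (\<lambda>x. \<phi> n x + \<psi> n x) x $ j)) \<longlonglongrightarrow> weak_deriv \<Omega> j v + weak_deriv \<Omega> j w" for j
    using tendsto_add[OF \<phi>(3) \<psi>(3)]
    by (simp add: plus_abs_L2 test_functionD(7)[OF test_function_grad[OF \<phi>(1)]] test_functionD(7)[OF test_function_grad[OF \<psi>(1)]]
        grad_add test_functionD(3)[OF \<phi>(1)] test_functionD(3)[OF \<psi>(1)])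
  ultimately show "v + w \<in> H10 \<Omega>"
    by (rule H10_limit_of_test_functions(1)[OF assms test_function_add[OF \<phi>(1) \<psi>(1)]])
next
  fix v c assume "v \<in> H10 \<Omega>"
  from H10_approximating_sequence[OF assms this] obtain \<phi> where
    \<phi>: "\<And>n. \<phi> n \<in> test_functions \<Omega>" "(\<lambda>n. abs_L2 (\<phi> n)) \<longlonglongrightarrow> v" "\<And>j. (\<lambda>n. abs_L2 (\<lambda>x. grad (\<phi> n) x $ j)) \<longlonglongrightarrow> weak_deriv \<Omega> j v"
    by metis
  have "(\<lambda>n. abs_L2 (\<lambda>x. c * \<phi> n x)) \<longlonglongrightarrow> c *\<^sub>R v"
    using tendsto_scaleR[OF tendsto_const \<phi>(2), of c] by (simp add: scaleR_abs_L2 test_functionD(7)[OF \<phi>(1)])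
  moreover have "(\<lambda>n. abs_L2 (\<lambda>x. grad (\<lambda>x. c * \<phi> n x) x $ j)) \<longlonglongrightarrow> c *\<^sub>R weak_deriv \<Omega> j v" for j
    using tendsto_scaleR[OF tendsto_const \<phi>(3), of c]
    by (simp add: scaleR_abs_L2 test_functionD(7)[OF test_function_grad[OF \<phi>(1)]] grad_cmult test_functionD(3)[OF \<phi>(1)])
  ultimately show "c *\<^sub>R v \<in> H10 \<Omega>"
    by (rule H10_limit_of_test_functions(1)[OF assms test_function_cmult[OF \<phi>(1)]])
next
  have "(\<lambda>_. 0 :: real) \<in> test_functions \<Omega>" by (simp add: test_functions_def times_differentiable_const)
  moreover have "grad (\<lambda>_. 0 :: real) x = 0" for x :: "real^'a"
    using grad_eq_zero_if_locally_constant[of UNIV x "\<lambda>_. 0" 0] by simp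
  moreover have "abs_L2 (\<lambda>_. 0) = (0 :: (real^'a) L2)" by (simp add: zero_L2_def)
  ultimately show "0 \<in> H10 \<Omega>"
    using H10_limit_of_test_functions(1)[OF assms, of "\<lambda>_ _. 0" 0 "\<lambda>_. 0"] by simp
qed

lemma H10_subset_H1: "H10 \<Omega> \<subseteq> H1 \<Omega>" by (auto simp: H10_def)

lemma sym_form_a_form:
  assumes "open \<Omega>"
  shows "sym_form (H10 \<Omega>) (a_form \<Omega>)"
proof
  show "subspace (H10 \<Omega>)" by (rule subspace_H10[OF assms])
  fix x y z and c assume x: "x \<in> H10 \<Omega>"
  then have x1: "x \<in> H1 \<Omega>" using H10_subset_H1 by blast
  show "a_form \<Omega> (c *\<^sub>R x) z = c * a_form \<Omega> x z"
    by (simp add: a_form_def weak_deriv_scaleR[OF assms x1] sum_distrib_left)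
  show "a_form \<Omega> x z = a_form \<Omega> z x" by (simp add: a_form_def inner_commute)
  assume "y \<in> H10 \<Omega>"
  then have y1: "y \<in> H1 \<Omega>" using H10_subset_H1 by blast
  show "a_form \<Omega> (x + y) z = a_form \<Omega> x z + a_form \<Omega> y z"
    by (simp add: a_form_def weak_deriv_add[OF assms x1 y1] inner_add_left sum.distrib)
qed

lemma a_form_self: "a_form \<Omega> v v = (\<Sum>j\<in>UNIV. (norm (weak_deriv \<Omega> j v))\<^sup>2)"
  by (simp add: a_form_def power2_norm_eq_inner)

lemma a_form_nonneg: "0 \<le> a_form \<Omega> v v"
  unfolding a_form_self by (intro sum_nonneg) simp

text \<open>Both sides are continuous along a sequence of test functions that converges together
  with its derivatives.\<close>

lemma poincare_H10:
  fixes \<Omega> :: "(real^'n) set"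
  assumes "open \<Omega>" "bounded \<Omega>"
  obtains C where "0 < C" "\<And>v. v \<in> H10 \<Omega> \<Longrightarrow> (norm v)\<^sup>2 \<le> C * a_form \<Omega> v v"
proof -
  obtain C where C: "0 < C" "\<And>\<phi>. \<phi> \<in> test_functions \<Omega> \<Longrightarrow> (norm (abs_L2 \<phi>))\<^sup>2 \<le> C * dirichlet \<phi>"
    using poincare_test_functions[OF assms(2)] by blast
  have "(norm v)\<^sup>2 \<le> C * a_form \<Omega> v v" if v: "v \<in> H10 \<Omega>" for v
  proof -
    obtain \<phi> where \<phi>: "\<And>n. \<phi> n \<in> test_functions \<Omega>" "(\<lambda>n. abs_L2 (\<phi> n)) \<longlonglongrightarrow> v"
      "\<And>j. (\<lambda>n. abs_L2 (\<lambda>x. grad (\<phi> n) x $ j)) \<longlonglongrightarrow> weak_deriv \<Omega> j v"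
      using H10_approximating_sequence[OF assms(1) v] by blast
    show ?thesis
    proof (rule LIMSEQ_le)
      show "(\<lambda>n. (norm (abs_L2 (\<phi> n)))\<^sup>2) \<longlonglongrightarrow> (norm v)\<^sup>2" by (intro tendsto_intros \<phi>(2))
      show "(\<lambda>n. C * dirichlet (\<phi> n)) \<longlonglongrightarrow> C * a_form \<Omega> v v"
        unfolding dirichlet_def a_form_self by (intro tendsto_intros \<phi>(3))
    qed (use C(2)[OF \<phi>(1)] in auto)
  qed
  then show ?thesis using that C(1) by blast
qed

lemma ehrling_H10:
  fixes \<Omega> :: "(real^'n) set"
  assumes "open \<Omega>" "bounded \<Omega>" "0 < \<delta>"
  obtains C :: "('n \<Rightarrow> int) set" and g where "finite C"
    "\<And>v. v \<in> H10 \<Omega> \<Longrightarrow> (norm v)\<^sup>2 \<le> \<delta> * a_form \<Omega> v v + (\<Sum>c\<in>C. (v \<bullet> g c)\<^sup>2)"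
proof -
  obtain C :: "('n \<Rightarrow> int) set" and g where C: "finite C"
    "\<And>\<phi>. \<phi> \<in> test_functions \<Omega> \<Longrightarrow> (norm (abs_L2 \<phi>))\<^sup>2 \<le> \<delta> * dirichlet \<phi> + (\<Sum>c\<in>C. (abs_L2 \<phi> \<bullet> g c)\<^sup>2)"
    using ehrling_test_functions[OF assms(2,3)] by blast
  have "(norm v)\<^sup>2 \<le> \<delta> * a_form \<Omega> v v + (\<Sum>c\<in>C. (v \<bullet> g c)\<^sup>2)" if v: "v \<in> H10 \<Omega>" for v
  proof -
    obtain \<phi> where \<phi>: "\<And>n. \<phi> n \<in> test_functions \<Omega>" "(\<lambda>n. abs_L2 (\<phi> n)) \<longlonglongrightarrow> v"
      "\<And>j. (\<lambda>n. abs_L2 (\<lambda>x. grad (\<phi> n) x $ j)) \<longlonglongrightarrow> weak_deriv \<Omega> j v"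
      using H10_approximating_sequence[OF assms(1) v] by blast
    show ?thesis
    proof (rule LIMSEQ_le)
      show "(\<lambda>n. (norm (abs_L2 (\<phi> n)))\<^sup>2) \<longlonglongrightarrow> (norm v)\<^sup>2" by (intro tendsto_intros \<phi>(2))
      show "(\<lambda>n. \<delta> * dirichlet (\<phi> n) + (\<Sum>c\<in>C. (abs_L2 (\<phi> n) \<bullet> g c)\<^sup>2)) \<longlonglongrightarrow> \<delta> * a_form \<Omega> v v + (\<Sum>c\<in>C. (v \<bullet> g c)\<^sup>2)"
        unfolding dirichlet_def a_form_self by (intro tendsto_intros \<phi>(2,3))
    qed (use C(2)[OF \<phi>(1)] in auto)
  qed
  then show ?thesis using that C(1) by blast
qed

section \<open>The potential as a bounded nonnegative form\<close>

lemma potential_bounds: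
  assumes "open \<Omega>" "V \<in> Linfty_on \<Omega>" "essinf_on \<Omega> V = 0"
  obtains M where "0 \<le> M" "AE x in lebesgue. x \<in> \<Omega> \<longrightarrow> 0 \<le> V x \<and> V x \<le> M"
    "(\<lambda>x. indicator \<Omega> x * V x) \<in> borel_measurable lebesgue"
proof -
  have S: "\<Omega> \<in> sets lebesgue" using assms(1) by (simp add: borel_open)
  have Vm: "V \<in> borel_measurable (lebesgue_on \<Omega>)" "esssup (lebesgue_on \<Omega>) (\<lambda>x. ereal \<bar>V x\<bar>) < \<infinity>"
    using assms(2) by (auto simp: Linfty_on_def)
  obtain M where M: "esssup (lebesgue_on \<Omega>) (\<lambda>x. ereal \<bar>V x\<bar>) \<le> ereal M"
  proof -
    obtain n where "esssup (lebesgue_on \<Omega>) (\<lambda>x. ereal \<bar>V x\<bar>) < ereal (real n)"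
      using Vm(2) less_PInf_Ex_of_nat by auto
    then show ?thesis using that[of "real n"] by simp
  qed
  have "esssup (lebesgue_on \<Omega>) (\<lambda>x. ereal (- V x)) = 0"
    using assms(3) by (simp add: essinf_on_def)
  then have "AE x in lebesgue_on \<Omega>. ereal (- V x) \<le> 0"
    using esssup_AE[of "\<lambda>x. ereal (- V x)" "lebesgue_on \<Omega>"] by simp
  then have 1: "AE x in lebesgue. x \<in> \<Omega> \<longrightarrow> 0 \<le> V x"
    using AE_restrict_space_iff[of \<Omega> lebesgue] S by simp
  have "AE x in lebesgue_on \<Omega>. ereal \<bar>V x\<bar> \<le> ereal M"
    using esssup_AE[of "\<lambda>x. ereal \<bar>V x\<bar>" "lebesgue_on \<Omega>"] by eventually_elim (use M order_trans in blast)
  then have 2: "AE x in lebesgue. x \<in> \<Omega> \<longrightarrow> \<bar>V x\<bar> \<le> M"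
    using AE_restrict_space_iff[of \<Omega> lebesgue] S by simp
  have "AE x in lebesgue. x \<in> \<Omega> \<longrightarrow> 0 \<le> V x \<and> V x \<le> max 0 M"
    using 1 2 by eventually_elim auto
  moreover have "(\<lambda>x. indicator \<Omega> x * V x) \<in> borel_measurable lebesgue"
    using Vm(1) S borel_measurable_restrict_space_iff[of \<Omega> lebesgue V] by simp
  ultimately show ?thesis using that[of "max 0 M"] by simp
qed

text \<open>A bounded potential makes the form finite on all of \<open>L2\<close>, hence the carrier
  \<open>UNIV\<close>. The upper bound by \<open>M\<close> is its continuity; nonnegativity comes
  from the vanishing essential infimum.\<close>

lemma V_form_properties:
  assumes "open \<Omega>" "V \<in> Linfty_on \<Omega>" "essinf_on \<Omega> V = 0"
  obtains M where "0 \<le> M" "sym_form UNIV (V_form \<Omega> V)" "\<And>v. 0 \<le> V_form \<Omega> V v v" "\<And>v. V_form \<Omega> V v v \<le> M * (norm v)\<^sup>2"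
proof -
  obtain M where M: "0 \<le> M" "AE x in lebesgue. x \<in> \<Omega> \<longrightarrow> 0 \<le> V x \<and> V x \<le> M"
    "(\<lambda>x. indicator \<Omega> x * V x) \<in> borel_measurable lebesgue"
    using potential_bounds[OF assms] by blast
  define U where "U x = indicator \<Omega> x * V x" for x
  have U: "U \<in> borel_measurable lebesgue" "AE x in lebesgue. 0 \<le> U x \<and> U x \<le> M"
  proof -
    show "U \<in> borel_measurable lebesgue" using M(3) by (simp add: U_def[abs_def])
    show "AE x in lebesgue. 0 \<le> U x \<and> U x \<le> M"
      using M(2) by eventually_elim (use M(1) in \<open>auto simp: U_def indicator_def\<close>)
  qed
  have form: "V_form \<Omega> V v w = (LINT x|lebesgue. U x * (rep_L2 v x * rep_L2 w x))" for v w
    unfolding V_form_def set_lebesgue_integral_def U_def by (simp add: mult_ac)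
  have prod: "integrable lebesgue (\<lambda>x. rep_L2 v x * rep_L2 w x)" for v w
    by (rule square_integrable_mult[OF square_integrable_rep square_integrable_rep])
  have int: "integrable lebesgue (\<lambda>x. U x * (rep_L2 v x * rep_L2 w x))" for v w
  proof (rule Bochner_Integration.integrable_bound)
    show "integrable lebesgue (\<lambda>x. M * (rep_L2 v x * rep_L2 w x))" by (rule integrable_mult_right[OF prod])
    show "(\<lambda>x. U x * (rep_L2 v x * rep_L2 w x)) \<in> borel_measurable lebesgue"
      by (intro borel_measurable_times U(1) measurable_rep)
    show "AE x in lebesgue. norm (U x * (rep_L2 v x * rep_L2 w x)) \<le> norm (M * (rep_L2 v x * rep_L2 w x))"
      using U(2) by eventually_elim (auto simp: abs_mult intro!: mult_right_mono)
  qed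
  have "sym_form UNIV (V_form \<Omega> V)"
  proof
    fix x y z :: "(real^'a) L2" and c
    show "V_form \<Omega> V (x + y) z = V_form \<Omega> V x z + V_form \<Omega> V y z"
      unfolding form Bochner_Integration.integral_add[OF int int, symmetric]
    proof (rule integral_cong_AE)
      show "AE t in lebesgue. U t * (rep_L2 (x + y) t * rep_L2 z t) = U t * (rep_L2 x t * rep_L2 z t) + U t * (rep_L2 y t * rep_L2 z t)"
        using rep_add[of x y] by eventually_elim (simp add: algebra_simps)
    qed (intro borel_measurable_add borel_measurable_times U(1) measurable_rep)+
    show "V_form \<Omega> V (c *\<^sub>R x) z = c * V_form \<Omega> V x z"
      unfolding form integral_mult_right_zero[symmetric]
    proof (rule integral_cong_AE)
      show "AE t in lebesgue. U t * (rep_L2 (c *\<^sub>R x) t * rep_L2 z t) = c * (U t * (rep_L2 x t * rep_L2 z t))"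
        using rep_scaleR[of c x] by eventually_elim (simp add: algebra_simps)
    qed (intro borel_measurable_times borel_measurable_const U(1) measurable_rep)+
    show "V_form \<Omega> V x z = V_form \<Omega> V z x" unfolding form by (simp add: mult_ac)
  qed simp
  moreover have "0 \<le> V_form \<Omega> V v v" for v
    unfolding form by (rule integral_nonneg_AE) (use U(2) in eventually_elim, auto)
  moreover have "V_form \<Omega> V v v \<le> M * (norm v)\<^sup>2" for v
    unfolding form power2_norm_eq_inner inner_rep integral_mult_right_zero[symmetric]
    by (rule integral_mono_AE[OF int]) (rule integrable_mult_right[OF prod], use U(2) in eventually_elim, auto intro!: mult_right_mono)
  ultimately show ?thesis using that M(1) by blast
qed


section \<open>The min-max principle for the exact eigenvalues\<close>

context sym_form
begin

text \<open>A semidefinite version: if \<open>q x x\<close> is positive, minimizing over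
  \<open>y + t x\<close> gives the claim.\<close>

lemma cauchy_schwarz:
  assumes nonneg: "\<And>w. w \<in> S \<Longrightarrow> 0 \<le> q w w" and x: "x \<in> S" and y: "y \<in> S"
  shows "(q x y)\<^sup>2 \<le> q x x * q y y"
proof (cases "q x x = 0")
  case True
  \<comment> \<open>A vector with \<open>q x x = 0\<close> minimizes the nonnegative form, so it
    satisfies the Euler equation with value 0.\<close>
  have "q x y = 0 * (x \<bullet> y)" by (rule minimizer_euler) (simp_all add: nonneg True x y)
  then show ?thesis using True by simp
next
  case False
  then have pos: "0 < q x x" using nonneg[OF x] by simp
  define t where "t = - q x y / q x x"
  have "y + t *\<^sub>R x \<in> S" using x y subspace by (simp add: subspace_add subspace_scale)
  then have "0 \<le> q (y + t *\<^sub>R x) (y + t *\<^sub>R x)" by (rule nonneg)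
  also have "\<dots> = q y y + 2 * t * q x y + t\<^sup>2 * q x x" by (simp only: square_add[OF y x] sym[OF y x])
  finally have "0 \<le> (q y y + 2 * t * q x y + t\<^sup>2 * q x x) * q x x" using pos by simp
  also have "\<dots> = q y y * q x x + 2 * (t * q x x) * q x y + (t * q x x)\<^sup>2"
    by (simp add: power2_eq_square algebra_simps)
  also have "t * q x x = - q x y" using pos by (simp add: t_def)
  finally show ?thesis by (simp add: power2_eq_square mult.commute)
qed

text \<open>Expanding around \<open>l\<close> leaves a cross term, which Cauchy-Schwarz bounds by
  the square root of the error form.\<close>

lemma tendsto_square:
  assumes nonneg: "\<And>w. w \<in> S \<Longrightarrow> 0 \<le> q w w" and x: "\<And>n. x n \<in> S" and l: "l \<in> S"
    and lim: "(\<lambda>n. q (x n - l) (x n - l)) \<longlonglongrightarrow> 0"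
  shows "(\<lambda>n. q (x n) (x n)) \<longlonglongrightarrow> q l l"
proof -
  have d: "x n - l \<in> S" for n using x l subspace by (simp add: subspace_diff)
  have "(\<lambda>n. q l (x n - l)) \<longlonglongrightarrow> 0"
  proof (rule Lim_null_comparison)
    show "eventually (\<lambda>n. norm (q l (x n - l)) \<le> sqrt (q l l * q (x n - l) (x n - l))) sequentially"
      using cauchy_schwarz[OF nonneg l d] by (intro always_eventually allI) (simp add: real_le_rsqrt)
    show "(\<lambda>n. sqrt (q l l * q (x n - l) (x n - l))) \<longlonglongrightarrow> 0"
      using tendsto_real_sqrt[OF tendsto_mult[OF tendsto_const lim], of "q l l"] by simp
  qed
  then have "(\<lambda>n. q l l + 2 * 1 * q l (x n - l) + 1\<^sup>2 * q (x n - l) (x n - l)) \<longlonglongrightarrow> q l l + 2 * 1 * 0 + 1\<^sup>2 * 0"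
    by (intro tendsto_intros lim)
  then show ?thesis unfolding square_add[OF l d, symmetric] by simp
qed

end

section \<open>Convergence of minimizing sequences\<close>

lemma Cauchy_if_norm_square_le:
  fixes x :: "nat \<Rightarrow> 'a::real_normed_vector"
  assumes "\<And>m n. (norm (x m - x n))\<^sup>2 \<le> z m + z n" "z \<longlonglongrightarrow> 0"
  shows "Cauchy x"
proof (rule CauchyI)
  fix e :: real assume "0 < e"
  then have "eventually (\<lambda>n. z n < e\<^sup>2 / 2) sequentially"
    using order_tendstoD(2)[OF assms(2), of "e\<^sup>2 / 2"] by simp
  then obtain N where N: "\<And>n. n \<ge> N \<Longrightarrow> z n < e\<^sup>2 / 2" by (auto simp: eventually_sequentially)
  have "norm (x m - x n) < e" if "m \<ge> N" "n \<ge> N" for m n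
  proof (rule power_less_imp_less_base)
    show "(norm (x m - x n))\<^sup>2 < e\<^sup>2" using assms(1)[of m n] N[OF that(1)] N[OF that(2)] by linarith
  qed (use \<open>0 < e\<close> in simp)
  then show "\<exists>M. \<forall>m\<ge>M. \<forall>n\<ge>M. norm (x m - x n) < e" by blast
qed

lemma finite_convergent_subsequence:
  fixes f :: "'c \<Rightarrow> nat \<Rightarrow> real"
  assumes "finite C" "\<And>c. c \<in> C \<Longrightarrow> bounded (range (f c))"
  shows "\<exists>r :: nat \<Rightarrow> nat. strict_mono r \<and> (\<forall>c\<in>C. convergent (f c \<circ> r))"
  using assms
proof (induction C)
  case empty
  show ?case by (intro exI[of _ id]) (auto simp: strict_mono_def)
next
  case (insert c C)
  then obtain r :: "nat \<Rightarrow> nat" where r: "strict_mono r" "\<forall>c\<in>C. convergent (f c \<circ> r)" by blast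
  have "bounded (range (f c \<circ> r))" using insert.prems[of c] by (auto intro: bounded_subset)
  then obtain l s where s: "strict_mono (s :: nat \<Rightarrow> nat)" "((f c \<circ> r) \<circ> s) \<longlonglongrightarrow> l"
    using bounded_imp_convergent_subsequence by blast
  have "convergent (f d \<circ> (r \<circ> s))" if "d \<in> insert c C" for d
  proof (cases "d = c")
    case True
    then show ?thesis using s(2) by (auto simp: convergent_def comp_assoc)
  next
    case False
    then have "convergent (f d \<circ> r)" using r(2) that by blast
    then show ?thesis unfolding o_assoc by (rule convergent_subseq_convergent[OF _ s(1)])
  qed
  then show ?case using strict_mono_o[OF r(1) s(1)] by blast
qed

text \<open>By the parallelogram law, a minimizing sequence is Cauchy in the form norm as soon as it is
  Cauchy in \<open>L\<^sup>2\<close>; by the Ehrling inequality with \<open>\<delta> * \<rho> \<le> 1/2\<close> it suffices that finitely many inner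
  products converge.\<close>

lemma minimizing_sequence_Cauchy:
  fixes x :: "nat \<Rightarrow> 'a::real_inner"
  assumes "sym_form X q" and x: "\<And>n. x n \<in> X" "\<And>n. norm (x n) = 1"
    and lower: "\<And>w. w \<in> X \<Longrightarrow> \<rho> * (norm w)\<^sup>2 \<le> q w w" and lim: "(\<lambda>n. q (x n) (x n)) \<longlonglongrightarrow> \<rho>"
    and \<delta>: "0 \<le> \<delta>" "0 \<le> \<rho>" "\<delta> * \<rho> \<le> 1 / 2" and C: "finite C"
    and ehrling: "\<And>w. w \<in> X \<Longrightarrow> (norm w)\<^sup>2 \<le> \<delta> * q w w + (\<Sum>c\<in>C. (w \<bullet> g c)\<^sup>2)"
    and conv: "\<And>c. c \<in> C \<Longrightarrow> convergent (\<lambda>n. x n \<bullet> g c)"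
  obtains z where "z \<longlonglongrightarrow> 0" "\<And>m n. (norm (x m - x n))\<^sup>2 \<le> z m + z n" "\<And>m n. q (x m - x n) (x m - x n) \<le> z m + z n"
proof -
  interpret sym_form X q by fact
  define l where "l c = lim (\<lambda>n. x n \<bullet> g c)" for c
  define b where "b n = q (x n) (x n) - \<rho>" for n
  define s where "s n = 2 * (\<Sum>c\<in>C. (x n \<bullet> g c - l c)\<^sup>2)" for n
  \<comment> \<open>With \<open>N\<close> the squared distance, the Ehrling and parallelogram
    estimates give \<open>N <= \<delta> (2 b m + 2 b n + \<rho> N) + s m + s n\<close>. Since
    \<open>\<delta> \<rho> <= 1/2\<close>, half of \<open>N\<close> is absorbed on the left, which
    doubles the remaining coefficients.\<close>
  define z1 where "z1 n = 4 * \<delta> * b n + 2 * s n" for n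
  define z2 where "z2 n = 2 * b n + \<rho> * z1 n" for n
  have l: "(\<lambda>n. x n \<bullet> g c) \<longlonglongrightarrow> l c" if "c \<in> C" for c
    using conv[OF that] by (simp add: l_def convergent_LIMSEQ_iff)
  have b: "b \<longlonglongrightarrow> 0" using tendsto_diff[OF lim tendsto_const[of \<rho>]] by (simp add: b_def[abs_def])
  have bn: "0 \<le> b n" for n using lower[OF x(1)[of n]] x(2)[of n] by (simp add: b_def)
  have "s \<longlonglongrightarrow> 2 * (\<Sum>c\<in>C. (l c - l c)\<^sup>2)" unfolding s_def[abs_def] by (intro tendsto_intros l)
  then have s: "s \<longlonglongrightarrow> 0" by simp
  have sn: "0 \<le> s n" for n unfolding s_def by (simp add: sum_nonneg)
  have z1: "z1 \<longlonglongrightarrow> 4 * \<delta> * 0 + 2 * 0" unfolding z1_def[abs_def] by (intro tendsto_intros b s)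
  then have z2: "z2 \<longlonglongrightarrow> 2 * 0 + \<rho> * 0" unfolding z2_def[abs_def] by (intro tendsto_intros b) simp
  have z1n: "0 \<le> z1 n" for n using bn[of n] sn[of n] \<delta>(1) by (simp add: z1_def)
  then have z2n: "0 \<le> z2 n" for n using bn[of n] \<delta>(2) by (simp add: z2_def)
  have main: "(norm (x m - x n))\<^sup>2 \<le> z1 m + z1 n \<and> q (x m - x n) (x m - x n) \<le> z2 m + z2 n" for m n
  proof -
    define N where "N = (norm (x m - x n))\<^sup>2"
    define Qd where "Qd = q (x m - x n) (x m - x n)"
    have d: "x m - x n \<in> X" "x m + x n \<in> X" using x(1) subspace by (simp_all add: subspace_diff subspace_add)
    \<comment> \<open>Parallelogram law for unit vectors; the lower bound applied to the sum then
      limits the energy of the difference.\<close>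
    have "(norm (x m + x n))\<^sup>2 = 4 - N"
      using x(2)[of m, unfolded norm_eq_1] x(2)[of n, unfolded norm_eq_1]
      unfolding N_def power2_norm_eq_inner inner_add_left inner_add_right inner_diff_left inner_diff_right
      by (simp only: inner_commute[of "x n" "x m"])
    then have "\<rho> * (4 - N) \<le> q (x m + x n) (x m + x n)" using lower[OF d(2)] by simp
    then have Qd: "Qd \<le> 2 * b m + 2 * b n + \<rho> * N"
      unfolding Qd_def parallelogram[OF x(1) x(1)] b_def by (simp add: algebra_simps)
    have S: "(\<Sum>c\<in>C. ((x m - x n) \<bullet> g c)\<^sup>2) \<le> s m + s n"
    proof -
      have "((x m - x n) \<bullet> g c)\<^sup>2 \<le> 2 * (x m \<bullet> g c - l c)\<^sup>2 + 2 * (x n \<bullet> g c - l c)\<^sup>2" for c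
        using zero_le_power2[of "(x m \<bullet> g c - l c) + (x n \<bullet> g c - l c)"]
        by (simp add: inner_diff_left power2_eq_square algebra_simps)
      then have "(\<Sum>c\<in>C. ((x m - x n) \<bullet> g c)\<^sup>2) \<le> (\<Sum>c\<in>C. 2 * (x m \<bullet> g c - l c)\<^sup>2 + 2 * (x n \<bullet> g c - l c)\<^sup>2)"
        by (intro sum_mono)
      then show ?thesis by (simp add: s_def sum.distrib sum_distrib_left)
    qed
    have "N \<le> \<delta> * Qd + (s m + s n)" using ehrling[OF d(1)] S unfolding N_def Qd_def by linarith
    also have "\<delta> * Qd \<le> \<delta> * (2 * b m + 2 * b n + \<rho> * N)" using Qd \<delta>(1) by (rule mult_left_mono)
    also have "\<delta> * (2 * b m + 2 * b n + \<rho> * N) = 2 * \<delta> * b m + 2 * \<delta> * b n + (\<delta> * \<rho>) * N" by (simp add: algebra_simps)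
    also have "(\<delta> * \<rho>) * N \<le> 1 / 2 * N" using \<delta>(3) by (intro mult_right_mono) (simp_all add: N_def)
    finally have N: "N \<le> z1 m + z1 n" unfolding z1_def by simp
    have "\<rho> * N \<le> \<rho> * (z1 m + z1 n)" using N \<delta>(2) by (rule mult_left_mono)
    then have "Qd \<le> z2 m + z2 n" using Qd unfolding z2_def by (simp add: algebra_simps)
    with N show ?thesis by (simp add: N_def Qd_def)
  qed
  show ?thesis
  proof (rule that[of "\<lambda>n. z1 n + z2 n"])
    show "(\<lambda>n. z1 n + z2 n) \<longlonglongrightarrow> 0" using tendsto_add[OF z1 z2] by simp
  next
    fix m n
    show "(norm (x m - x n))\<^sup>2 \<le> z1 m + z2 m + (z1 n + z2 n)" using main[of m n] z2n[of m] z2n[of n] by linarith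
    show "q (x m - x n) (x m - x n) \<le> z1 m + z2 m + (z1 n + z2 n)" using main[of m n] z1n[of m] z1n[of n] by linarith
  qed
qed


definition energy :: "(real^'n) set \<Rightarrow> (real^'n \<Rightarrow> real) \<Rightarrow> (real^'n) L2 \<Rightarrow> (real^'n) L2 \<Rightarrow> real" where
  "energy \<Omega> V v w = a_form \<Omega> v w + V_form \<Omega> V v w"

lemma sym_form_energy:
  assumes "open \<Omega>" "sym_form UNIV (V_form \<Omega> V)"
  shows "sym_form (H10 \<Omega>) (energy \<Omega> V)"
proof -
  interpret a: sym_form "H10 \<Omega>" "a_form \<Omega>" by (rule sym_form_a_form[OF assms(1)])
  interpret V: sym_form UNIV "V_form \<Omega> V" by fact
  show ?thesis
  proof
    show "subspace (H10 \<Omega>)" by (rule a.subspace)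
    fix x y z c assume x: "x \<in> H10 \<Omega>" and z: "z \<in> H10 \<Omega>"
    show "energy \<Omega> V (c *\<^sub>R x) z = c * energy \<Omega> V x z"
      using x z by (simp add: energy_def a.scale_left V.scale_left distrib_left)
    show "energy \<Omega> V x z = energy \<Omega> V z x"
      unfolding energy_def using a.sym[OF x z] V.sym[of x z] by simp
    assume "y \<in> H10 \<Omega>"
    then show "energy \<Omega> V (x + y) z = energy \<Omega> V x z + energy \<Omega> V y z"
      using x z by (simp add: energy_def a.add_left V.add_left)
  qed
qed

text \<open>Direct method: a minimizing sequence of unit vectors, thinned out so that the Ehrling
  inner products converge, is Cauchy in \<open>L2\<close> and in every weak derivative. The limit
  keeps unit norm and the constraints, and the energy is continuous along the sequence.\<close>

lemma energy_minimizer_exists: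
  fixes \<Omega> :: "(real^'n) set"
  assumes \<Omega>: "open \<Omega>" "bounded \<Omega>" and V: "V \<in> Linfty_on \<Omega>" "essinf_on \<Omega> V = 0"
    and X: "X = H10 \<Omega> \<inter> {w. \<forall>g\<in>G. w \<bullet> g = 0}" and w0: "w0 \<in> X" "w0 \<noteq> 0"
  obtains v \<rho> where "v \<in> X" "norm v = 1" "0 < \<rho>" "energy \<Omega> V v v = \<rho>" "\<rho> \<le> rayleigh \<Omega> V w0"
    "\<And>w. w \<in> X \<Longrightarrow> \<rho> * (w \<bullet> w) \<le> energy \<Omega> V w w"
proof -
  obtain M where M: "0 \<le> M" "sym_form UNIV (V_form \<Omega> V)" "\<And>v. 0 \<le> V_form \<Omega> V v v" "\<And>v. V_form \<Omega> V v v \<le> M * (norm v)\<^sup>2"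
    using V_form_properties[OF \<Omega>(1) V] by blast
  let ?B = "energy \<Omega> V"
  interpret B: sym_form "H10 \<Omega>" ?B by (rule sym_form_energy[OF \<Omega>(1) M(2)])
  have a_le: "a_form \<Omega> v v \<le> ?B v v" for v using M(3)[of v] by (simp add: energy_def)
  have B_nonneg: "0 \<le> ?B v v" for v using a_le[of v] a_form_nonneg[of \<Omega> v] by linarith
  have sX: "subspace X" unfolding X
    by (intro subspace_inter B.subspace subspace_orthogonal_complement)
  interpret X: sym_form X ?B by (rule B.subform[OF sX]) (simp add: X)
  define E where "E = (\<lambda>v. ?B v v) ` (X \<inter> sphere 0 1)"
  define \<rho> where "\<rho> = Inf E"
  have bdd: "bdd_below E" unfolding E_def using B_nonneg by (intro bdd_belowI[of _ 0]) auto
  have normalize: "?B v v / (v \<bullet> v) \<in> E" if v: "v \<in> X" "v \<noteq> 0" for v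
  proof -
    have n: "(1 / norm v) *\<^sub>R v \<in> X" using v sX by (simp add: subspace_scale)
    have "?B ((1 / norm v) *\<^sub>R v) ((1 / norm v) *\<^sub>R v) = (1 / norm v) * ((1 / norm v) * ?B v v)"
      using X.scale_left[OF v(1) n] X.scale_right[OF v(1) v(1)] by simp
    also have "\<dots> = ?B v v / (v \<bullet> v)" by (simp add: dot_square_norm power2_eq_square)
    finally show ?thesis unfolding E_def using n v(2) by (intro image_eqI[of _ _ "(1 / norm v) *\<^sub>R v"]) auto
  qed
  have ne: "E \<noteq> {}" using normalize[OF w0] by auto
  have \<rho>_le: "\<rho> \<le> rayleigh \<Omega> V w0"
    unfolding \<rho>_def rayleigh_def using cInf_lower[OF normalize[OF w0] bdd] by (simp add: energy_def)
  have lower: "\<rho> * (w \<bullet> w) \<le> ?B w w" if "w \<in> X" for w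
  proof (cases "w = 0")
    case True
    then show ?thesis using B_nonneg[of 0] by simp
  next
    case False
    have "\<rho> \<le> ?B w w / (w \<bullet> w)" unfolding \<rho>_def using cInf_lower[OF normalize[OF that False] bdd] .
    then show ?thesis using False by (simp add: pos_le_divide_eq)
  qed
  have \<rho>0: "0 \<le> \<rho>" unfolding \<rho>_def by (rule cInf_greatest[OF ne]) (auto simp: E_def B_nonneg)
  have "\<exists>v\<in>X. norm v = 1 \<and> ?B v v < \<rho> + inverse (real (Suc n))" for n
  proof -
    have "\<exists>y\<in>E. y < \<rho> + inverse (real (Suc n))"
      unfolding \<rho>_def by (rule cInf_lessD[OF ne]) simp
    then show ?thesis by (auto simp: E_def)
  qed
  then obtain y where y: "\<And>n. y n \<in> X" "\<And>n. norm (y n) = 1" "\<And>n. ?B (y n) (y n) < \<rho> + inverse (real (Suc n))"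
    by metis
  \<comment> \<open>This choice gives \<open>\<delta> \<rho> <= 1/2\<close>; the summand 1 covers
    \<open>\<rho> = 0\<close>, which is excluded only later.\<close>
  define \<delta> where "\<delta> = 1 / (2 * (\<rho> + 1))"
  have \<delta>: "0 < \<delta>" "\<delta> * \<rho> \<le> 1 / 2" using \<rho>0 by (simp_all add: \<delta>_def field_simps)
  obtain C :: "('n \<Rightarrow> int) set" and g where C: "finite C"
    "\<And>v. v \<in> H10 \<Omega> \<Longrightarrow> (norm v)\<^sup>2 \<le> \<delta> * a_form \<Omega> v v + (\<Sum>c\<in>C. (v \<bullet> g c)\<^sup>2)"
    using ehrling_H10[OF \<Omega> \<delta>(1)] by blast
  have "bounded (range (\<lambda>n. y n \<bullet> g c))" for c
  proof (rule boundedI)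
    fix t assume "t \<in> range (\<lambda>n. y n \<bullet> g c)"
    then obtain n where "t = y n \<bullet> g c" by blast
    then show "norm t \<le> norm (g c)" using Cauchy_Schwarz_ineq2[of "y n" "g c"] y(2)[of n] by simp
  qed
  then obtain r :: "nat \<Rightarrow> nat" where r: "strict_mono r" "\<forall>c\<in>C. convergent ((\<lambda>n. y n \<bullet> g c) \<circ> r)"
    using finite_convergent_subsequence[OF C(1), of "\<lambda>c n. y n \<bullet> g c"] by blast
  define x where "x n = y (r n)" for n
  have x: "x n \<in> X" "norm (x n) = 1" "x n \<in> H10 \<Omega>" for n using y(1,2) by (auto simp: x_def X)
  have Bx: "(\<lambda>n. ?B (x n) (x n)) \<longlonglongrightarrow> \<rho>"
  proof -
    have "(\<lambda>n. ?B (y n) (y n)) \<longlonglongrightarrow> \<rho>"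
    proof (rule tendsto_sandwich)
      show "eventually (\<lambda>n. \<rho> \<le> ?B (y n) (y n)) sequentially"
        using lower[OF y(1)] y(2) by (simp add: dot_square_norm)
      show "eventually (\<lambda>n. ?B (y n) (y n) \<le> \<rho> + inverse (real (Suc n))) sequentially"
        using y(3) by (intro always_eventually allI less_imp_le)
      show "(\<lambda>n. \<rho> + inverse (real (Suc n))) \<longlonglongrightarrow> \<rho>"
        using tendsto_add[OF tendsto_const LIMSEQ_inverse_real_of_nat, of \<rho>] by simp
    qed simp
    from LIMSEQ_subseq_LIMSEQ[OF this r(1)] show ?thesis by (simp add: x_def o_def)
  qed
  obtain z where z: "z \<longlonglongrightarrow> 0" "\<And>m n. (norm (x m - x n))\<^sup>2 \<le> z m + z n" "\<And>m n. ?B (x m - x n) (x m - x n) \<le> z m + z n"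
  proof (rule minimizing_sequence_Cauchy[OF X.sym_form_axioms x(1,2) _ Bx _ \<rho>0 \<delta>(2) C(1)])
    show "\<rho> * (norm w)\<^sup>2 \<le> ?B w w" if "w \<in> X" for w using lower[OF that] by (simp add: power2_norm_eq_inner)
    show "0 \<le> \<delta>" using \<delta>(1) by simp
    show "(norm w)\<^sup>2 \<le> \<delta> * ?B w w + (\<Sum>c\<in>C. (w \<bullet> g c)\<^sup>2)" if "w \<in> X" for w
    proof -
      have "w \<in> H10 \<Omega>" using that by (simp add: X)
      moreover have "\<delta> * a_form \<Omega> w w \<le> \<delta> * ?B w w" using a_le \<delta>(1) by (intro mult_left_mono) auto
      ultimately show ?thesis using C(2)[of w] by linarith
    qed
    show "convergent (\<lambda>n. x n \<bullet> g c)" if "c \<in> C" for c using r(2) that by (simp add: o_def x_def)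
  qed blast
  have "Cauchy x" by (rule Cauchy_if_norm_square_le[OF z(2,1)])
  then obtain v where v: "x \<longlonglongrightarrow> v" using L2_complete by blast
  have "Cauchy (\<lambda>n. weak_deriv \<Omega> j (x n))" for j
  proof (rule Cauchy_if_norm_square_le[OF _ z(1)])
    fix m n
    have "x m \<in> H1 \<Omega>" "x n \<in> H1 \<Omega>" using x(3) H10_subset_H1 by blast+
    then have "(norm (weak_deriv \<Omega> j (x m) - weak_deriv \<Omega> j (x n)))\<^sup>2 = (norm (weak_deriv \<Omega> j (x m - x n)))\<^sup>2"
      by (simp add: weak_deriv_diff[OF \<Omega>(1)])
    also have "\<dots> \<le> a_form \<Omega> (x m - x n) (x m - x n)"
      unfolding a_form_self by (rule member_le_sum) auto
    also have "\<dots> \<le> z m + z n" using a_le z(3) order_trans by blast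
    finally show "(norm (weak_deriv \<Omega> j (x m) - weak_deriv \<Omega> j (x n)))\<^sup>2 \<le> z m + z n" .
  qed
  then have "\<forall>j. \<exists>g. (\<lambda>n. weak_deriv \<Omega> j (x n)) \<longlonglongrightarrow> g" using L2_complete by blast
  from choice[OF this] obtain d where d: "\<And>j. (\<lambda>n. weak_deriv \<Omega> j (x n)) \<longlonglongrightarrow> d j" by blast
  have vH: "v \<in> H10 \<Omega>" "\<And>j. weak_deriv \<Omega> j v = d j" using H10_closed[OF \<Omega>(1) x(3) v d] by blast+
  have vX: "v \<in> X"
  proof -
    have "v \<bullet> h = 0" if "h \<in> G" for h
    proof -
      have "(\<lambda>n. x n \<bullet> h) \<longlonglongrightarrow> v \<bullet> h" by (intro tendsto_intros v)
      moreover have "x n \<bullet> h = 0" for n using x(1)[of n] that by (simp add: X)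
      ultimately show ?thesis by (simp add: LIMSEQ_const_iff)
    qed
    then show ?thesis using vH(1) by (simp add: X)
  qed
  have nv: "norm v = 1" using tendsto_norm[OF v] x(2) by (simp add: LIMSEQ_const_iff)
  \<comment> \<open>The error energy splits into the weak derivatives, which converge to those of
    \<open>v\<close>, and the potential part, at most \<open>M\<close> times the squared
    \<open>L2\<close> error.\<close>
  have "(\<lambda>n. ?B (x n - v) (x n - v)) \<longlonglongrightarrow> 0"
  proof (rule tendsto_sandwich[where f="\<lambda>_. 0" and
        h="\<lambda>n. (\<Sum>j\<in>UNIV. (norm (weak_deriv \<Omega> j (x n) - d j))\<^sup>2) + M * (norm (x n - v))\<^sup>2"])
    have "?B (x n - v) (x n - v) \<le> (\<Sum>j\<in>UNIV. (norm (weak_deriv \<Omega> j (x n) - d j))\<^sup>2) + M * (norm (x n - v))\<^sup>2" for n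
    proof -
      have "x n \<in> H1 \<Omega>" "v \<in> H1 \<Omega>" using x(3) vH(1) H10_subset_H1 by blast+
      then show ?thesis using M(4)[of "x n - v"]
        by (simp add: energy_def a_form_self weak_deriv_diff[OF \<Omega>(1)] vH(2))
    qed
    then show "eventually (\<lambda>n. ?B (x n - v) (x n - v) \<le> (\<Sum>j\<in>UNIV. (norm (weak_deriv \<Omega> j (x n) - d j))\<^sup>2) + M * (norm (x n - v))\<^sup>2) sequentially"
      by simp
    have "(\<lambda>n. (\<Sum>j\<in>UNIV. (norm (weak_deriv \<Omega> j (x n) - d j))\<^sup>2) + M * (norm (x n - v))\<^sup>2)
      \<longlonglongrightarrow> (\<Sum>j\<in>UNIV. (norm (d j - d j))\<^sup>2) + M * (norm (v - v))\<^sup>2"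
      by (intro tendsto_intros d v)
    then show "(\<lambda>n. (\<Sum>j\<in>UNIV. (norm (weak_deriv \<Omega> j (x n) - d j))\<^sup>2) + M * (norm (x n - v))\<^sup>2) \<longlonglongrightarrow> 0" by simp
  qed (use B_nonneg in simp_all)
  from B.tendsto_square[OF B_nonneg x(3) vH(1) this]
  have Bv: "?B v v = \<rho>" using Bx LIMSEQ_unique by blast
  \<comment> \<open>Poincare makes the minimum positive, as required to apply the enumeration, which
    speaks about positive values only.\<close>
  obtain P where P: "0 < P" "\<And>v. v \<in> H10 \<Omega> \<Longrightarrow> (norm v)\<^sup>2 \<le> P * a_form \<Omega> v v"
    using poincare_H10[OF \<Omega>] by blast
  have "P * a_form \<Omega> v v \<le> P * ?B v v" using P(1) a_le by (intro mult_left_mono) auto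
  then have "1 \<le> P * \<rho>" using P(2)[OF vH(1)] nv Bv by simp
  then have "0 < \<rho>" using P(1) \<rho>0 by (cases "\<rho> = 0") auto
  then show ?thesis using that vX nv Bv \<rho>_le lower by blast
qed

lemma card_below_eigenvalue:
  fixes lam :: "nat \<Rightarrow> real"
  assumes "mono_on {1..} lam" "1 \<le> k"
  shows "{i\<in>{1..}. lam i < lam k} \<subseteq> {1..<k}"
proof
  fix i assume i: "i \<in> {i\<in>{1..}. lam i < lam k}"
  have "\<not> k \<le> i"
  proof
    assume "k \<le> i"
    then have "lam k \<le> lam i" using assms i by (intro mono_onD[OF assms(1)]) auto
    then show False using i by simp
  qed
  then show "i \<in> {1..<k}" using i by simp
qed

text \<open>The constraints are basis vectors of all eigenspaces with value below
  \<open>lam k\<close>. Counted with multiplicity these are fewer than \<open>k\<close>, so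
  \<open>W\<close> contains a vector satisfying all of them, and its small quotient forces the
  constrained minimum below \<open>lam k\<close>.\<close>

lemma min_max_lower_bound:
  fixes \<Omega> :: "(real^'n) set"
  assumes \<Omega>: "open \<Omega>" "bounded \<Omega>" and V: "V \<in> Linfty_on \<Omega>" "essinf_on \<Omega> V = 0"
    and lam: "enumerates_eigenvalues {1..} lam (exact_eigenspace \<Omega> V)"
    and k: "1 \<le> k" and W: "subspace W" "W \<subseteq> H10 \<Omega>" "dim W = k"
  shows "\<exists>w\<in>W - {0}. lam k \<le> rayleigh \<Omega> V w"
proof (rule ccontr)
  assume "\<not> ?thesis"
  then have less: "rayleigh \<Omega> V w < lam k" if "w \<in> W" "w \<noteq> 0" for w using that by force
  let ?B = "energy \<Omega> V"
  let ?I = "\<lambda>t. {i\<in>{1..}. lam i = t}"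
  obtain M where M: "sym_form UNIV (V_form \<Omega> V)"
    using V_form_properties[OF \<Omega>(1) V] by blast
  interpret B: sym_form "H10 \<Omega>" ?B by (rule sym_form_energy[OF \<Omega>(1) M])
  have lam': "0 < lam i" "mono_on {1..} lam" if "1 \<le> i" for i
    using lam that unfolding enumerates_eigenvalues_def by auto
  have "\<forall>t. \<exists>b. 0 < t \<longrightarrow> finite b \<and> independent b \<and> span b = exact_eigenspace \<Omega> V t \<and> card b = card (?I t)"
    using lam unfolding enumerates_eigenvalues_def by blast
  from choice[OF this] obtain b where
    b: "\<And>t. 0 < t \<Longrightarrow> finite (b t) \<and> independent (b t) \<and> span (b t) = exact_eigenspace \<Omega> V t \<and> card (b t) = card (?I t)"
    by blast
  have finI: "finite (?I t)" if "0 < t" for t using lam that unfolding enumerates_eigenvalues_def by blast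
  define L where "L = {i\<in>{1..}. lam i < lam k}"
  have L: "L \<subseteq> {1..<k}" unfolding L_def by (rule card_below_eigenvalue[OF lam'(2)[OF k] k])
  then have finL: "finite L" using finite_subset by blast
  \<comment> \<open>The set of distinct values below \<open>lam k\<close>; the basis
    \<open>b t\<close> already accounts for the multiplicity of \<open>t\<close>, so each value is
    taken once.\<close>
  define T where "T = lam ` L"
  have T: "finite T" "\<And>t. t \<in> T \<Longrightarrow> 0 < t" using finL lam'(1) by (auto simp: T_def L_def)
  define G where "G = (\<Union>t\<in>T. b t)"
  have G: "finite G" using T b by (auto simp: G_def)
  have "card G \<le> (\<Sum>t\<in>T. card (b t))" unfolding G_def by (rule card_UN_le[OF T(1)])
  also have "\<dots> = (\<Sum>t\<in>T. card (?I t))" using T b by (intro sum.cong) auto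
  also have "\<dots> = card (\<Union>t\<in>T. ?I t)"
    using T finI by (intro card_UN_disjoint[symmetric]) auto
  also have "(\<Union>t\<in>T. ?I t) = L" by (auto simp: T_def L_def)
  also have "card L \<le> card {1..<k}" by (rule card_mono) (use L in auto)
  finally have "card G < dim W" using k W(3) by simp
  then obtain w0 where w0: "w0 \<in> W" "w0 \<noteq> 0" "\<And>g. g \<in> span G \<Longrightarrow> w0 \<bullet> g = 0"
    using exists_orthogonal_vector[OF W(1) G] by blast
  define X where "X = H10 \<Omega> \<inter> {w. \<forall>g\<in>G. w \<bullet> g = 0}"
  have "w0 \<in> X" using w0 W(2) by (auto simp: X_def span_base)
  then obtain v \<rho> where v: "v \<in> X" "norm v = 1" "0 < \<rho>" "?B v v = \<rho>" "\<rho> \<le> rayleigh \<Omega> V w0"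
    "\<And>w. w \<in> X \<Longrightarrow> \<rho> * (w \<bullet> w) \<le> ?B w w"
    using energy_minimizer_exists[OF \<Omega> V X_def _ w0(2)] by blast
  have \<rho>: "\<rho> < lam k" using v(5) less[OF w0(1,2)] by simp
  have vH: "v \<in> H10 \<Omega>" using v(1) by (simp add: X_def)
  have sX: "subspace X" unfolding X_def
    by (intro subspace_inter B.subspace subspace_orthogonal_complement)
  interpret X: sym_form X ?B by (rule B.subform[OF sX]) (simp add: X_def)
  have euler: "?B v w = \<rho> * (v \<bullet> w)" if "w \<in> X" for w
  proof -
    have "?B v v = \<rho> * (v \<bullet> v)" using v(2,4) by (simp only: dot_square_norm) simp
    from X.minimizer_euler[OF v(6) v(1) this that] show ?thesis .
  qed
  \<comment> \<open>For an eigenfunction \<open>g\<close> with value \<open>t\<close> the energy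
    product with \<open>v\<close> is \<open>t\<close> times the inner product, so \<open>L2\<close>
    orthogonality entails energy orthogonality.\<close>
  have Gprop: "g \<in> H10 \<Omega> \<and> ?B v g = 0 \<and> v \<bullet> g = 0" if gG: "g \<in> G" for g
  proof -
    obtain t where t: "t \<in> T" "g \<in> b t" using gG unfolding G_def by blast
    have "g \<in> exact_eigenspace \<Omega> V t" using b[OF T(2)[OF t(1)]] t(2) span_base by blast
    then have g: "g \<in> H10 \<Omega>" "?B g v = t * (g \<bullet> v)" using vH by (auto simp: exact_eigenspace_def energy_def)
    moreover have "v \<bullet> g = 0" using v(1) gG by (simp add: X_def)
    ultimately show ?thesis using B.sym[OF g(1) vH] by (simp add: inner_commute)
  qed
  have spanG: "g \<in> H10 \<Omega> \<and> ?B v g = 0 \<and> v \<bullet> g = 0" if "g \<in> span G" for g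
    using that
  proof (induction rule: span_induct)
    case base
    show ?case
      using B.subspace vH
      by (auto simp: subspace_def B.zero_right B.add_right B.scale_right inner_add_right)
  qed (use Gprop in blast)
  have "v \<in> exact_eigenspace \<Omega> V \<rho>"
    unfolding exact_eigenspace_def mem_Collect_eq
  proof (intro conjI ballI)
    show "v \<in> H10 \<Omega>" by (rule vH)
    fix w assume w: "w \<in> H10 \<Omega>"
    obtain \<pi> :: "(real^'n) L2 \<Rightarrow> (real^'n) L2" where p: "linear \<pi>" "\<And>v. \<pi> v \<in> span G"
      "\<And>v g. g \<in> span G \<Longrightarrow> (v - \<pi> v) \<bullet> g = 0"
      by (rule orthogonal_projection_exists[OF G]) blast
    \<comment> \<open>The Euler equation is available on \<open>X\<close> only. An arbitrary
      direction is corrected by its projection onto \<open>span G\<close>, which contributes 0 to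
      both sides.\<close>
    have wX: "w - \<pi> w \<in> X"
      using p(3)[OF span_base] w spanG[OF p(2)] B.subspace by (simp add: X_def subspace_diff)
    then have wH: "w - \<pi> w \<in> H10 \<Omega>" by (simp add: X_def)
    have "?B v w = ?B v (w - \<pi> w) + ?B v (\<pi> w)"
      using B.add_right[OF wH _ vH, of "\<pi> w"] spanG[OF p(2)] by simp
    also have "\<dots> = \<rho> * (v \<bullet> w)" using euler[OF wX] spanG[OF p(2)] by (simp add: inner_diff_right)
    finally show "a_form \<Omega> v w + V_form \<Omega> V v w = \<rho> * (v \<bullet> w)" by (simp add: energy_def)
  qed
  then have vb: "v \<in> span (b \<rho>)" using b[OF v(3)] by simp
  show False
  \<comment> \<open>If \<open>\<rho>\<close> is not listed, its eigenspace is trivial; if it is,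
    \<open>v\<close> lies in \<open>span G\<close>, to which it is orthogonal. Either way
    \<open>v = 0\<close>, against its unit norm.\<close>
  proof (cases "?I \<rho> = {}")
    case True
    then have "card (b \<rho>) = 0" using b[OF v(3)] by (simp only: card.empty)
    then have "b \<rho> = {}" using b[OF v(3)] card_0_eq by blast
    then show False using vb v(2) by simp
  next
    case False
    then have "\<rho> \<in> T" using \<rho> by (auto simp: T_def L_def)
    then have "v \<in> span G" using vb span_mono[of "b \<rho>" G] by (auto simp: G_def)
    then have "v \<bullet> v = 0" using spanG by blast
    then show False using v(2) by simp
  qed
qed

section \<open>Piecewise polynomials\<close>

lemma finite_multi_indices: "finite {\<alpha> :: 'n::finite \<Rightarrow> nat. sum \<alpha> UNIV \<le> m}"
proof -
  have "{\<alpha> :: 'n \<Rightarrow> nat. sum \<alpha> UNIV \<le> m} \<subseteq> PiE UNIV (\<lambda>_. {..m})"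
  proof
    fix \<alpha> :: "'n \<Rightarrow> nat" assume "\<alpha> \<in> {\<alpha>. sum \<alpha> UNIV \<le> m}"
    moreover have "\<alpha> i \<le> sum \<alpha> UNIV" for i by (rule member_le_sum) auto
    ultimately show "\<alpha> \<in> PiE UNIV (\<lambda>_. {..m})" unfolding PiE_UNIV_domain by (auto intro: order_trans)
  qed
  then show ?thesis by (rule finite_subset) (intro finite_PiE finite_UNIV, auto)
qed

lemma polys_add: "p \<in> polys m \<Longrightarrow> q \<in> polys m \<Longrightarrow> (\<lambda>x. p x + q x) \<in> polys m"
proof -
  assume "p \<in> polys m" "q \<in> polys m"
  then obtain c d where "p = (\<lambda>x. \<Sum>\<alpha> | sum \<alpha> UNIV \<le> m. c \<alpha> * (\<Prod>i\<in>UNIV. x $ i ^ \<alpha> i))"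
    "q = (\<lambda>x. \<Sum>\<alpha> | sum \<alpha> UNIV \<le> m. d \<alpha> * (\<Prod>i\<in>UNIV. x $ i ^ \<alpha> i))" unfolding polys_def by blast
  then have "(\<lambda>x. p x + q x) = (\<lambda>x. \<Sum>\<alpha> | sum \<alpha> UNIV \<le> m. (c \<alpha> + d \<alpha>) * (\<Prod>i\<in>UNIV. x $ i ^ \<alpha> i))"
    by (simp add: sum.distrib distrib_right)
  then show ?thesis unfolding polys_def by (intro CollectI exI)
qed

lemma polys_cmult: "p \<in> polys m \<Longrightarrow> (\<lambda>x. c * p x) \<in> polys m"
proof -
  assume "p \<in> polys m"
  then obtain d where "p = (\<lambda>x. \<Sum>\<alpha> | sum \<alpha> UNIV \<le> m. d \<alpha> * (\<Prod>i\<in>UNIV. x $ i ^ \<alpha> i))" unfolding polys_def by blast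
  then have "(\<lambda>x. c * p x) = (\<lambda>x. \<Sum>\<alpha> | sum \<alpha> UNIV \<le> m. (c * d \<alpha>) * (\<Prod>i\<in>UNIV. x $ i ^ \<alpha> i))"
    by (simp add: sum_distrib_left mult.assoc)
  then show ?thesis unfolding polys_def by (intro CollectI exI)
qed

lemma polys_monomial:
  fixes \<beta> :: "'n::finite \<Rightarrow> nat"
  assumes "sum \<beta> UNIV \<le> m"
  shows "(\<lambda>x::real^'n. \<Prod>i\<in>UNIV. x $ i ^ \<beta> i) \<in> polys m"
proof -
  have "(\<Sum>\<alpha> | sum \<alpha> UNIV \<le> m. (if \<alpha> = \<beta> then 1 else 0) * (\<Prod>i\<in>UNIV. x $ i ^ \<alpha> i)) = (\<Prod>i\<in>UNIV. x $ i ^ \<beta> i)" for x :: "real^'n"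
    using assms finite_multi_indices[where 'n='n] by (simp add: if_distrib[of "\<lambda>c. c * _"] cong: if_cong)
  then show ?thesis unfolding polys_def by (intro CollectI exI[of _ "\<lambda>\<alpha>. if \<alpha> = \<beta> then 1 else 0"]) simp
qed

lemma polys_const: "(\<lambda>_. c) \<in> polys m"
  using polys_cmult[OF polys_monomial[of "\<lambda>_. 0" m], of c] by simp

lemma polys_mono:
  assumes "m \<le> m'"
  shows "polys m \<subseteq> (polys m' :: (real^'n \<Rightarrow> real) set)"
proof
  fix p :: "real^'n \<Rightarrow> real" assume "p \<in> polys m"
  then obtain d where p: "p = (\<lambda>x. \<Sum>\<alpha> | sum \<alpha> UNIV \<le> m. d \<alpha> * (\<Prod>i\<in>UNIV. x $ i ^ \<alpha> i))" unfolding polys_def by blast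
  have "p x = (\<Sum>\<alpha> | sum \<alpha> UNIV \<le> m'. (if sum \<alpha> UNIV \<le> m then d \<alpha> else 0) * (\<Prod>i\<in>UNIV. x $ i ^ \<alpha> i))" for x
    unfolding p using assms by (intro sum.mono_neutral_cong_left finite_multi_indices) auto
  then show "p \<in> polys m'" unfolding polys_def
    by (intro CollectI exI[of _ "\<lambda>\<alpha>. if sum \<alpha> UNIV \<le> m then d \<alpha> else 0"] ext)
qed

lemma polys_sum: "(\<And>i. i \<in> I \<Longrightarrow> p i \<in> polys m) \<Longrightarrow> (\<lambda>x. \<Sum>i\<in>I. p i x) \<in> polys m"
  by (induction I rule: infinite_finite_induct) (auto intro: polys_const polys_add)

lemma prod_power_single: "(\<Prod>i\<in>(UNIV::'n::finite set). (x :: real^'n) $ i ^ (if i = j then k else 0)) = x $ j ^ k"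
proof -
  have "(\<Prod>i\<in>UNIV. x $ i ^ (if i = j then k else 0)) = (\<Prod>i\<in>UNIV. if i = j then x $ j ^ k else 1)"
    by (intro prod.cong) auto
  then show ?thesis by simp
qed

lemma polys_component_power: "k \<le> m \<Longrightarrow> (\<lambda>x::real^'n. x $ j ^ k) \<in> polys m"
  using polys_monomial[of "\<lambda>i. if i = j then k else 0" m] by (simp add: prod_power_single)

lemma polys_1_affine:
  fixes p :: "real^'n \<Rightarrow> real"
  assumes "p \<in> polys 1"
  obtains a b where "p = (\<lambda>x. b + a \<bullet> x)"
proof -
  obtain c where p: "p = (\<lambda>x. \<Sum>\<alpha> | sum \<alpha> UNIV \<le> 1. c \<alpha> * (\<Prod>i\<in>UNIV. x $ i ^ \<alpha> i))"
    using assms unfolding polys_def by blast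
  have "\<exists>b a. \<forall>x::real^'n. (\<Prod>i\<in>UNIV. x $ i ^ \<alpha> i) = b + a \<bullet> x" if "sum \<alpha> UNIV \<le> 1" for \<alpha> :: "'n \<Rightarrow> nat"
  proof (cases "sum \<alpha> UNIV = 0")
    case True
    then show ?thesis by (intro exI[of _ 1] exI[of _ 0]) simp
  next
    case False
    then obtain j where j: "\<alpha> j \<noteq> 0" by (meson sum.neutral)
    have "sum \<alpha> UNIV = \<alpha> j + sum \<alpha> (UNIV - {j})" by (rule sum.remove) auto
    then have "\<alpha> j = 1" "sum \<alpha> (UNIV - {j}) = 0" using that j by linarith+
    then have "\<alpha> = (\<lambda>i. if i = j then 1 else 0)" by auto
    then have "\<forall>x::real^'n. (\<Prod>i\<in>UNIV. x $ i ^ \<alpha> i) = 0 + axis j 1 \<bullet> x"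
      by (simp add: prod_power_single inner_axis')
    then show ?thesis by blast
  qed
  then obtain b a where ab: "\<And>\<alpha> x. sum \<alpha> UNIV \<le> 1 \<Longrightarrow> (\<Prod>i\<in>UNIV. (x::real^'n) $ i ^ \<alpha> i) = b \<alpha> + a \<alpha> \<bullet> x"
    by metis
  have "p = (\<lambda>x. (\<Sum>\<alpha> | sum \<alpha> UNIV \<le> 1. c \<alpha> * b \<alpha>) + (\<Sum>\<alpha> | sum \<alpha> UNIV \<le> 1. c \<alpha> *\<^sub>R a \<alpha>) \<bullet> x)"
    unfolding p by (rule ext) (simp add: ab inner_sum_left sum.distrib[symmetric] distrib_left)
  then show ?thesis using that by blast
qed

lemma polys_smooth:
  fixes p :: "real^'n \<Rightarrow> real"
  assumes "p \<in> polys m"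
  shows "times_differentiable k p"
proof -
  have x: "times_differentiable k (\<lambda>x::real^'n. x $ i)" for k i
  proof (cases k)
    case 0
    then show ?thesis by (simp add: continuous_on_component)
  next
    case (Suc l)
    have d: "((\<lambda>x::real^'n. x $ i) has_derivative (\<lambda>h. h $ i)) (at x)" for x
      by (rule bounded_linear_imp_has_derivative[OF bounded_linear_vec_nth])
    have "grad (\<lambda>x::real^'n. x $ i) x $ j = (if i = j then 1 else 0)" for x j
      using grad_eqI[OF d] by (simp add: axis_def)
    then show ?thesis using Suc d times_differentiable_const by (auto simp: differentiable_def)
  qed
  have "times_differentiable k (\<lambda>x::real^'n. x $ i ^ l)" for i l
    by (induction l) (auto intro: times_differentiable_const times_differentiable_mult x)
  then show ?thesis
    using assms unfolding polys_def
    by (auto intro!: times_differentiable_sum times_differentiable_mult times_differentiable_const times_differentiable_prod)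
qed

lemma polys_differentiable: "p \<in> polys m \<Longrightarrow> p differentiable (at x)"
  using polys_smooth[of p m "Suc 0"] by simp

lemma polys_continuous: "p \<in> polys m \<Longrightarrow> continuous_on S p"
  using polys_smooth[of p m 0] continuous_on_subset by auto

lemma polys_grad_continuous: "p \<in> polys m \<Longrightarrow> continuous_on S (grad p)"
  using polys_smooth[of p m "Suc 0"] continuous_on_vec_lambda[of UNIV "\<lambda>j x. grad p x $ j"] continuous_on_subset by auto

lemma polys_on_line:
  fixes p :: "real^'n \<Rightarrow> real"
  assumes "p \<in> polys m"
  obtains P :: "real poly" where "\<And>t. p (x + t *\<^sub>R y) = poly P t"
proof -
  obtain c where p: "p = (\<lambda>x. \<Sum>\<alpha> | sum \<alpha> UNIV \<le> m. c \<alpha> * (\<Prod>i\<in>UNIV. x $ i ^ \<alpha> i))"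
    using assms unfolding polys_def by blast
  show ?thesis
    by (rule that[of "\<Sum>\<alpha> | sum \<alpha> UNIV \<le> m. smult (c \<alpha>) (\<Prod>i\<in>UNIV. [:x $ i, y $ i:] ^ \<alpha> i)"])
      (simp add: p poly_sum poly_prod)
qed

text \<open>On the line from a point of \<open>U\<close> to \<open>z\<close> both sides are
  one-variable polynomials that agree on an interval, hence everywhere, in particular at the
  parameter 1 of \<open>z\<close>.\<close>

lemma polys_eq_if_eq_on_open:
  fixes p :: "real^'n \<Rightarrow> real"
  assumes "p \<in> polys m" "q \<in> polys m'" "open U" "U \<noteq> {}" "\<And>x. x \<in> U \<Longrightarrow> p x = q x"
  shows "p = q"
proof
  fix z
  obtain x where x1: "x \<in> U" using assms(4) by blast
  obtain e where x: "0 < e" "ball x e \<subseteq> U" using openE[OF assms(3) x1] by blast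
  obtain P where P: "\<And>t. p (x + t *\<^sub>R (z - x)) = poly P t" using polys_on_line[OF assms(1)] by blast
  obtain Q where Q: "\<And>t. q (x + t *\<^sub>R (z - x)) = poly Q t" using polys_on_line[OF assms(2)] by blast
  \<comment> \<open>For parameters below \<open>d\<close> the line stays in the ball; the summand 1
    covers \<open>z = x\<close>.\<close>
  define d where "d = e / (norm (z - x) + 1)"
  have d: "0 < d" using x(1) by (simp add: d_def add_nonneg_pos)
  have eq: "poly (P - Q) t = 0" if "0 < t" "t < d" for t
  proof -
    have "t * norm (z - x) < t * (norm (z - x) + 1)" using that by simp
    also have "\<dots> < d * (norm (z - x) + 1)" using that by (intro mult_strict_right_mono) (auto simp: add_nonneg_pos)
    also have "\<dots> = e" using add_nonneg_pos[OF norm_ge_zero zero_less_one, of "z - x"] by (simp add: d_def)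
    finally have "x + t *\<^sub>R (z - x) \<in> ball x e" using that by (simp add: dist_norm)
    then have "x + t *\<^sub>R (z - x) \<in> U" using x(2) by blast
    then show ?thesis using assms(5) P Q by (metis poly_diff right_minus_eq)
  qed
  have "P - Q = 0"
  proof (rule ccontr)
    assume "P - Q \<noteq> 0"
    then have "finite {t. poly (P - Q) t = 0}" by (rule poly_roots_finite)
    moreover have "{0<..<d} \<subseteq> {t. poly (P - Q) t = 0}" using eq by auto
    ultimately have "finite {0<..<d}" using finite_subset by blast
    then show False using d infinite_Ioo by blast
  qed
  then show "p z = q z" using P[of 1] Q[of 1] by simp
qed

section \<open>Uniqueness and linearity of the polynomial pieces\<close>

lemma AE_not_in_open:
  fixes U :: "'a::euclidean_space set"
  assumes "open U" "AE x in lebesgue. x \<notin> U"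
  shows "U = {}"
proof (rule ccontr)
  assume "U \<noteq> {}"
  have "U \<in> null_sets lebesgue"
    using assms AE_iff_null_sets[of U lebesgue] by (simp add: borel_open)
  then have "negligible U" by (simp add: negligible_iff_null_sets)
  then show False using open_not_negligible[OF assms(1) \<open>U \<noteq> {}\<close>] by blast
qed

text \<open>The set where the functions differ is open and null, hence empty.\<close>

lemma continuous_eq_if_AE_eq_on_open:
  fixes f g :: "'a::euclidean_space \<Rightarrow> real"
  assumes "open U" "continuous_on U f" "continuous_on U g" "AE x in lebesgue. x \<in> U \<longrightarrow> f x = g x" "x \<in> U"
  shows "f x = g x"
proof -
  have "open (U \<inter> (\<lambda>x. f x - g x) -` (- {0}))"
    using assms(1-3) by (intro continuous_open_preimage continuous_intros) auto
  moreover have "AE x in lebesgue. x \<notin> U \<inter> (\<lambda>x. f x - g x) -` (- {0})"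
    using assms(4) by eventually_elim auto
  ultimately show ?thesis using AE_not_in_open assms(5) by fastforce
qed

text \<open>The condition inside the definite description of \<open>piece\<close>, with the
  polynomial as an argument: linearity is proved for witnesses and transferred by
  uniqueness.\<close>

definition is_piece :: "(real^'n) L2 \<Rightarrow> (real^'n) set \<Rightarrow> (real^'n \<Rightarrow> real) \<Rightarrow> bool" where
  "is_piece v T p \<longleftrightarrow> (\<exists>m. p \<in> polys m) \<and> (AE x in lebesgue. x \<in> T \<longrightarrow> rep_L2 v x = p x)"

lemma is_piece_unique:
  assumes "interior T \<noteq> {}" "is_piece v T p" "is_piece v T q"
  shows "p = q"
proof -
  obtain m m' where m: "p \<in> polys m" "q \<in> polys m'" using assms(2,3) by (auto simp: is_piece_def)
  have p: "AE x in lebesgue. x \<in> T \<longrightarrow> rep_L2 v x = p x" and q: "AE x in lebesgue. x \<in> T \<longrightarrow> rep_L2 v x = q x"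
    using assms(2,3) by (auto simp: is_piece_def)
  have "AE x in lebesgue. x \<in> interior T \<longrightarrow> p x = q x"
    using p q by eventually_elim (use interior_subset in force)
  then have "p x = q x" if "x \<in> interior T" for x
    using that m by (intro continuous_eq_if_AE_eq_on_open[of "interior T" p q] polys_continuous) auto
  then show ?thesis using polys_eq_if_eq_on_open[OF m open_interior assms(1)] by blast
qed

lemma piece_eq: "interior T \<noteq> {} \<Longrightarrow> is_piece v T p \<Longrightarrow> piece v T = p"
  unfolding piece_def is_piece_def[symmetric] using is_piece_unique by blast

lemma is_piece_add:
  assumes "is_piece v T p" "is_piece w T q"
  shows "is_piece (v + w) T (\<lambda>x. p x + q x)"
proof -
  obtain m m' where "p \<in> polys m" "q \<in> polys m'" using assms by (auto simp: is_piece_def)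
  then have "(\<lambda>x. p x + q x) \<in> polys (max m m')"
    using polys_mono[of m "max m m'"] polys_mono[of m' "max m m'"] by (intro polys_add) auto
  moreover have "AE x in lebesgue. x \<in> T \<longrightarrow> rep_L2 v x = p x" "AE x in lebesgue. x \<in> T \<longrightarrow> rep_L2 w x = q x"
    using assms by (auto simp: is_piece_def)
  then have "AE x in lebesgue. x \<in> T \<longrightarrow> rep_L2 (v + w) x = p x + q x"
    using rep_add[of v w] by eventually_elim auto
  ultimately show ?thesis by (auto simp: is_piece_def)
qed

lemma is_piece_scaleR:
  assumes "is_piece v T p"
  shows "is_piece (c *\<^sub>R v) T (\<lambda>x. c * p x)"
proof -
  have "AE x in lebesgue. x \<in> T \<longrightarrow> rep_L2 v x = p x" using assms by (simp add: is_piece_def)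
  then have "AE x in lebesgue. x \<in> T \<longrightarrow> rep_L2 (c *\<^sub>R v) x = c * p x"
    using rep_scaleR[of c v] by eventually_elim auto
  then show ?thesis using assms polys_cmult by (auto simp: is_piece_def)
qed

text \<open>A common carrier on which \<open>piece\<close> is linear and \<open>a_pw\<close>
  bilinear; it contains the affine functions and the quadratic bubbles alike, as degrees may
  vary.\<close>

definition pw_poly_space :: "(real^'n) set set \<Rightarrow> (real^'n) L2 set" where
  "pw_poly_space \<T> = {v. \<forall>T\<in>\<T>. \<exists>p. is_piece v T p}"

lemma subspace_pw_poly_space: "subspace (pw_poly_space \<T>)"
proof (rule subspaceI)
  show "0 \<in> pw_poly_space \<T>"
    using rep_zero polys_const[of 0 0] by (force simp: pw_poly_space_def is_piece_def)
qed (auto simp: pw_poly_space_def dest: is_piece_add is_piece_scaleR, (meson is_piece_add is_piece_scaleR)+)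

lemma is_piece_piece: "interior T \<noteq> {} \<Longrightarrow> v \<in> pw_poly_space \<T> \<Longrightarrow> T \<in> \<T> \<Longrightarrow> is_piece v T (piece v T)"
  unfolding pw_poly_space_def using piece_eq by fastforce

lemma set_integrable_grad_piece:
  assumes "compact T" "p \<in> polys m" "q \<in> polys m'"
  shows "set_integrable lebesgue T (\<lambda>x. grad p x \<bullet> grad q x)"
proof -
  have "integrable lborel (\<lambda>x. indicator T x *\<^sub>R (grad p x \<bullet> grad q x))"
    by (intro borel_integrable_compact assms(1) continuous_intros polys_grad_continuous[OF assms(2)] polys_grad_continuous[OF assms(3)])
  from integrable_completion[THEN iffD2, OF borel_measurable_integrable[OF this] this] show ?thesis by (simp add: set_integrable_def)
qed

lemma sym_form_a_pw:
  fixes \<T> :: "(real^'n) set set"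
  assumes T: "\<And>T. T \<in> \<T> \<Longrightarrow> interior T \<noteq> {}" "\<And>T. T \<in> \<T> \<Longrightarrow> compact T"
  shows "sym_form (pw_poly_space \<T>) (a_pw \<T>)"
proof
  show "subspace (pw_poly_space \<T>)" by (rule subspace_pw_poly_space)
  fix x z :: "(real^'n) L2" and c
  show "a_pw \<T> x z = a_pw \<T> z x" by (simp add: a_pw_def inner_commute)
  assume x: "x \<in> pw_poly_space \<T>" and z: "z \<in> pw_poly_space \<T>"
  have px: "is_piece x T (piece x T)" "is_piece z T (piece z T)" if "T \<in> \<T>" for T
    using is_piece_piece[OF T(1)] that x z by blast+
  then have ex: "\<exists>m. piece x T \<in> polys m" "\<exists>m. piece z T \<in> polys m" if "T \<in> \<T>" for T
    using that by (auto simp: is_piece_def)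
  show "a_pw \<T> (c *\<^sub>R x) z = c * a_pw \<T> x z"
    unfolding a_pw_def sum_distrib_left
  proof (intro sum.cong refl)
    fix T assume TT: "T \<in> \<T>"
    have "grad (piece (c *\<^sub>R x) T) y = c *\<^sub>R grad (piece x T) y" for y
      using ex(1)[OF TT] piece_eq[OF T(1)[OF TT] is_piece_scaleR[OF px(1)[OF TT]]] grad_cmult polys_differentiable by metis
    then show "(LINT y:T|lebesgue. grad (piece (c *\<^sub>R x) T) y \<bullet> grad (piece z T) y) =
        c * (LINT y:T|lebesgue. grad (piece x T) y \<bullet> grad (piece z T) y)" by simp
  qed
  fix y assume y: "y \<in> pw_poly_space \<T>"
  show "a_pw \<T> (x + y) z = a_pw \<T> x z + a_pw \<T> y z"
    unfolding a_pw_def sum.distrib[symmetric]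
  proof (intro sum.cong refl)
    fix T assume TT: "T \<in> \<T>"
    have py: "is_piece y T (piece y T)" using is_piece_piece[OF T(1)[OF TT] y TT] .
    then obtain m' where m': "piece y T \<in> polys m'" by (auto simp: is_piece_def)
    obtain m l where m: "piece x T \<in> polys m" "piece z T \<in> polys l" using ex[OF TT] by blast
    have "grad (piece (x + y) T) t = grad (piece x T) t + grad (piece y T) t" for t
      unfolding piece_eq[OF T(1)[OF TT] is_piece_add[OF px(1)[OF TT] py]]
      by (rule grad_add[OF polys_differentiable[OF m(1)] polys_differentiable[OF m']])
    then show "(LINT t:T|lebesgue. grad (piece (x + y) T) t \<bullet> grad (piece z T) t) =
        (LINT t:T|lebesgue. grad (piece x T) t \<bullet> grad (piece z T) t) + (LINT t:T|lebesgue. grad (piece y T) t \<bullet> grad (piece z T) t)"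
      using set_integral_add(2)[OF set_integrable_grad_piece[OF T(2)[OF TT] m(1) m(2)] set_integrable_grad_piece[OF T(2)[OF TT] m' m(2)]]
      by (simp add: inner_add_left)
  qed
qed

lemma a_pw_nonneg: "0 \<le> a_pw \<T> v v"
  unfolding a_pw_def set_lebesgue_integral_def
  by (intro sum_nonneg Bochner_Integration.integral_nonneg) auto

text \<open>Each summand is nonnegative and so vanishes. The continuous gradient is then 0
  throughout the convex interior, and a polynomial constant on an open set is constant
  everywhere.\<close>

lemma a_pw_zero_imp_piece_const:
  fixes \<T> :: "(real^'n) set set"
  assumes "finite \<T>" and T: "\<And>T. T \<in> \<T> \<Longrightarrow> interior T \<noteq> {}" "\<And>T. T \<in> \<T> \<Longrightarrow> compact T" "\<And>T. T \<in> \<T> \<Longrightarrow> convex T"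
    and v: "v \<in> pw_poly_space \<T>" "a_pw \<T> v v = 0" and TT: "T \<in> \<T>"
  obtains c where "piece v T = (\<lambda>_. c)"
proof -
  obtain m where m: "piece v T \<in> polys m" using is_piece_piece[OF T(1)[OF TT] v(1) TT] by (auto simp: is_piece_def)
  let ?f = "\<lambda>x. indicator T x *\<^sub>R (grad (piece v T) x \<bullet> grad (piece v T) x)"
  have "(LINT x:T|lebesgue. grad (piece v T) x \<bullet> grad (piece v T) x) = 0"
    using v(2) TT assms(1) unfolding a_pw_def
    by (subst (asm) sum_nonneg_eq_0_iff) (auto simp: set_lebesgue_integral_def intro!: Bochner_Integration.integral_nonneg)
  moreover have "integrable lebesgue ?f"
    using set_integrable_grad_piece[OF T(2)[OF TT] m m] by (simp add: set_integrable_def)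
  ultimately have "AE x in lebesgue. ?f x = 0"
    using integral_nonneg_eq_0_iff_AE[of lebesgue ?f] by (auto simp: set_lebesgue_integral_def)
  then have "AE x in lebesgue. x \<in> interior T \<longrightarrow> grad (piece v T) x \<bullet> grad (piece v T) x = 0"
    by eventually_elim (use interior_subset in \<open>force simp: indicator_def\<close>)
  then have g0: "grad (piece v T) x = 0" if "x \<in> interior T" for x
    using continuous_eq_if_AE_eq_on_open[OF open_interior, of T "\<lambda>x. grad (piece v T) x \<bullet> grad (piece v T) x" "\<lambda>_. 0" x] that
      polys_grad_continuous[OF m] by (auto intro!: continuous_intros)
  have "\<exists>c. \<forall>x\<in>interior T. piece v T x = c"
  proof (rule has_derivative_zero_constant[OF convex_interior[OF T(3)[OF TT]]])
    fix x assume x: "x \<in> interior T"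
    show "(piece v T has_derivative (\<lambda>h. 0)) (at x within interior T)"
      using has_derivative_at_withinI[OF has_derivative_grad[OF polys_differentiable[OF m, of x]]] g0[OF x] by simp
  qed
  then obtain c where c: "\<And>x. x \<in> interior T \<Longrightarrow> piece v T x = c" by blast
  have "piece v T = (\<lambda>_. c)"
    by (rule polys_eq_if_eq_on_open[OF m polys_const open_interior T(1)[OF TT]]) (rule c)
  then show ?thesis by (rule that)
qed

section \<open>Geometry of the triangulation\<close>

text \<open>Projecting along the direction of an interior point \<open>p\<close> onto the hyperplane of the facet \<open>F\<close>
  exhibits nearby points of the half-space as convex combinations of \<open>p\<close> and points of \<open>F\<close>.\<close>

lemma half_ball_subset_convex:
  fixes T :: "'a::euclidean_space set"
  assumes "convex T" "F \<subseteq> T" and hull: "affine hull F = {x. a \<bullet> x = b}"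
    and z: "z \<in> rel_interior F" and p: "p \<in> T" "a \<bullet> p < b"
  obtains \<epsilon> where "0 < \<epsilon>" "ball z \<epsilon> \<inter> {x. a \<bullet> x \<le> b} \<subseteq> T"
proof -
  obtain r where r: "0 < r" "ball z r \<inter> affine hull F \<subseteq> F"
    using z mem_rel_interior_ball by blast
  have az: "a \<bullet> z = b" using z rel_interior_subset hull_inc[of z F affine] hull by blast
  define D where "D = b - a \<bullet> p"
  define K where "K = norm a / D"
  define B where "B = 1 + K * norm (p - z)"
  have D: "0 < D" using p(2) by (simp add: D_def)
  have K: "0 \<le> K" using D by (simp add: K_def)
  have B: "1 \<le> B" using K by (simp add: B_def)
  \<comment> \<open>The first bound keeps the weight \<open>s\<close> of \<open>p\<close> at most
    1/2; the second keeps the projected point \<open>y\<close> within \<open>r\<close> of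
    \<open>z\<close>, where \<open>B\<close> collects the distortion of the projection.\<close>
  define \<epsilon> where "\<epsilon> = min (1 / (2 * (K + 1))) (r / (2 * B))"
  have \<epsilon>: "0 < \<epsilon>" using K B r(1) by (simp add: \<epsilon>_def)
  have "x \<in> T" if x: "x \<in> ball z \<epsilon>" "a \<bullet> x \<le> b" for x
  proof -
    define d where "d = norm (x - z)"
    define s where "s = (b - a \<bullet> x) / D"
    have d: "0 \<le> d" "d < 1 / (2 * (K + 1))" "d < r / (2 * B)"
      using x(1) by (auto simp: d_def \<epsilon>_def dist_norm norm_minus_commute)
    have s0: "0 \<le> s" using x(2) D by (simp add: s_def)
    have "b - a \<bullet> x = a \<bullet> (z - x)" by (simp add: inner_diff_right az)
    also have "\<dots> \<le> norm a * d" unfolding d_def by (metis norm_cauchy_schwarz norm_minus_commute)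
    finally have sK: "s \<le> K * d" using D by (simp add: s_def K_def divide_right_mono)
    have "d * (2 * (K + 1)) < 1" using d(2) K by (simp add: pos_less_divide_eq)
    then have "K * d \<le> 1 / 2" using d(1) by (simp add: algebra_simps)
    then have s1: "s \<le> 1 / 2" using sK by simp
    \<comment> \<open>The point where the line from \<open>p\<close> through \<open>x\<close> meets
      the hyperplane, so that \<open>x = (1 - s) y + s p\<close>.\<close>
    define y where "y = (1 / (1 - s)) *\<^sub>R (x - s *\<^sub>R p)"
    have "y - z = (1 / (1 - s)) *\<^sub>R ((x - z) - s *\<^sub>R (p - z))"
    proof -
      have "z = (1 / (1 - s)) *\<^sub>R ((1 - s) *\<^sub>R z)" using s1 by simp
      then have "y - z = (1 / (1 - s)) *\<^sub>R ((x - s *\<^sub>R p) - (1 - s) *\<^sub>R z)"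
        unfolding y_def scaleR_diff_right by simp
      then show ?thesis by (simp add: algebra_simps)
    qed
    then have "norm (y - z) = norm ((x - z) - s *\<^sub>R (p - z)) / (1 - s)" using s1 by simp
    also have "\<dots> \<le> (d + s * norm (p - z)) / (1 - s)"
      using norm_triangle_ineq4[of "x - z" "s *\<^sub>R (p - z)"] s0 s1 by (intro divide_right_mono) (simp_all add: d_def)
    also have "\<dots> \<le> (d + K * d * norm (p - z)) / (1 / 2)"
      using s0 s1 sK d(1) by (intro frac_le add_left_mono mult_right_mono add_nonneg_nonneg mult_nonneg_nonneg K) auto
    also have "\<dots> = d * (2 * B)" by (simp add: B_def algebra_simps)
    also have "\<dots> < r" using d(3) B by (simp add: pos_less_divide_eq)
    finally have "y \<in> ball z r" by (simp add: dist_norm norm_minus_commute)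
    moreover have "a \<bullet> y = b"
    proof -
      have "a \<bullet> x = b - s * D" using D by (simp add: s_def)
      then have "a \<bullet> (x - s *\<^sub>R p) = b * (1 - s)" by (simp add: inner_diff_right D_def algebra_simps)
      then show ?thesis using s1 by (simp add: y_def)
    qed
    ultimately have "y \<in> T" using r(2) hull assms(2) by blast
    moreover have "x = (1 - s) *\<^sub>R y + s *\<^sub>R p" using s1 by (simp add: y_def)
    ultimately show "x \<in> T" using assms(1) p(1) s0 s1 by (simp add: convex_def)
  qed
  then show ?thesis using that[OF \<epsilon>] by blast
qed

text \<open>Near \<open>z\<close> both sets contain the same half-ball, and an open half-ball is
  nonempty.\<close>

lemma same_side_interior_Int:
  fixes T1 T2 :: "'a::euclidean_space set"
  assumes "convex T1" "convex T2" "F \<subseteq> T1" "F \<subseteq> T2" and hull: "affine hull F = {x. a \<bullet> x = b}"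
    and z: "z \<in> rel_interior F" and p: "p1 \<in> T1" "a \<bullet> p1 < b" "p2 \<in> T2" "a \<bullet> p2 < b"
  shows "interior (T1 \<inter> T2) \<noteq> {}"
proof -
  obtain e1 where e1: "0 < e1" "ball z e1 \<inter> {x. a \<bullet> x \<le> b} \<subseteq> T1"
    using half_ball_subset_convex[OF assms(1,3) hull z p(1,2)] .
  obtain e2 where e2: "0 < e2" "ball z e2 \<inter> {x. a \<bullet> x \<le> b} \<subseteq> T2"
    using half_ball_subset_convex[OF assms(2,4) hull z p(3,4)] .
  define e where "e = min e1 e2"
  have az: "a \<bullet> z = b" using z rel_interior_subset hull_inc[of z F affine] hull by blast
  have e: "0 < e" using e1(1) e2(1) by (simp add: e_def)
  have sub: "ball z e \<inter> {x. a \<bullet> x < b} \<subseteq> interior (T1 \<inter> T2)"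
    by (rule interior_maximal) (use e1(2) e2(2) in \<open>auto simp: e_def open_Int open_halfspace_lt\<close>)
  define t where "t = e / 2 / (norm (p1 - z) + 1)"
  have t: "0 < t" using e add_nonneg_pos[OF norm_ge_zero zero_less_one, of "p1 - z"] by (simp add: t_def)
  have "t * norm (p1 - z) \<le> t * (norm (p1 - z) + 1)" using t by simp
  also have "\<dots> = e / 2"
    unfolding t_def by (rule nonzero_eq_divide_eq[THEN iffD1, OF _ refl]) (use norm_ge_zero[of "p1 - z"] in linarith)
  also have "\<dots> < e" using e by simp
  finally have "z + t *\<^sub>R (p1 - z) \<in> ball z e" using t by (simp add: dist_norm)
  moreover have "a \<bullet> (z + t *\<^sub>R (p1 - z)) < b"
    using t p(2) az by (simp add: inner_add_right inner_diff_right mult_pos_neg)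
  ultimately show ?thesis using sub by blast
qed

lemma opposite_sides_interior_Un:
  fixes T1 T2 :: "'a::euclidean_space set"
  assumes "convex T1" "convex T2" "F \<subseteq> T1" "F \<subseteq> T2" and hull: "affine hull F = {x. a \<bullet> x = b}"
    and z: "z \<in> rel_interior F" and p: "p1 \<in> T1" "a \<bullet> p1 < b" "p2 \<in> T2" "b < a \<bullet> p2"
  shows "z \<in> interior (T1 \<union> T2)"
proof -
  obtain e1 where e1: "0 < e1" "ball z e1 \<inter> {x. a \<bullet> x \<le> b} \<subseteq> T1"
    using half_ball_subset_convex[OF assms(1,3) hull z p(1,2)] .
  have hull': "affine hull F = {x. (- a) \<bullet> x = - b}" using hull by simp
  obtain e2 where e2: "0 < e2" "ball z e2 \<inter> {x. (- a) \<bullet> x \<le> - b} \<subseteq> T2"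
    using half_ball_subset_convex[OF assms(2,4) hull' z p(3)] p(4) by auto
  have "ball z (min e1 e2) \<subseteq> T1 \<union> T2"
  proof
    fix x assume "x \<in> ball z (min e1 e2)"
    then show "x \<in> T1 \<union> T2" using e1(2) e2(2) by (cases "a \<bullet> x \<le> b") auto
  qed
  then show ?thesis using e1(1) e2(1) by (intro interiorI[of "ball z (min e1 e2)"]) auto
qed

text \<open>A domain with Lipschitz boundary lies on one side of it: moving down from a boundary
  point leads into an open set below the graph that misses the domain. This rules out slits inside
  the closure.\<close>

lemma lipschitz_domain_frontier:
  assumes "lipschitz_domain \<Omega>" "z \<in> frontier \<Omega>"
  shows "z \<notin> interior (closure \<Omega>)"
proof
  assume zi: "z \<in> interior (closure \<Omega>)"
  obtain r e \<gamma> L where r: "0 < r" "norm e = 1" "L-lipschitz_on {y. y \<bullet> e = 0} \<gamma>"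
    "\<Omega> \<inter> ball z r = {x \<in> ball z r. \<gamma> (x - (x \<bullet> e) *\<^sub>R e) < x \<bullet> e}"
    using assms unfolding lipschitz_domain_def by blast
  have ee: "e \<bullet> e = 1" using r(2) by (simp add: dot_square_norm)
  have "open \<Omega>" using assms(1) by (simp add: lipschitz_domain_def)
  then have "z \<notin> \<Omega>" using assms(2) by (simp add: frontier_def interior_open)
  then have zg: "z \<bullet> e \<le> \<gamma> (z - (z \<bullet> e) *\<^sub>R e)" using r(1,4) by (force simp: not_less)
  obtain s where s: "0 < s" "ball z s \<subseteq> closure \<Omega>" using zi by (auto simp: mem_interior)
  define t where "t = min r s / 2"
  have t: "0 < t" "t < r" "t < s" using r(1) s(1) by (auto simp: t_def)
  \<comment> \<open>A point straight below \<open>z\<close>: it has the same projection onto the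
    hyperplane, so its height is compared with the same graph value.\<close>
  define w where "w = z - t *\<^sub>R e"
  have wz: "dist z w = t" using t(1) r(2) by (simp add: w_def dist_norm)
  have proj: "w - (w \<bullet> e) *\<^sub>R e = z - (z \<bullet> e) *\<^sub>R e"
    by (simp add: w_def inner_diff_left ee algebra_simps)
  define h where "h x = \<gamma> (x - (x \<bullet> e) *\<^sub>R e) - x \<bullet> e" for x
  have "continuous_on UNIV (\<lambda>x. \<gamma> (x - (x \<bullet> e) *\<^sub>R e))"
    by (rule continuous_on_compose2[OF lipschitz_on_continuous_on[OF r(3)]])
      (auto intro!: continuous_intros simp: inner_diff_left ee)
  then have c: "continuous_on UNIV h" unfolding h_def by (intro continuous_intros)
  have "open {x. 0 < h x}" using open_Collect_less[OF continuous_on_const c] .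
  then have U: "open (ball z r \<inter> {x. 0 < h x})" by (intro open_Int open_ball)
  have "h w = \<gamma> (z - (z \<bullet> e) *\<^sub>R e) - (z \<bullet> e - t)" unfolding h_def proj by (simp add: w_def inner_diff_left ee)
  then have "w \<in> ball z r \<inter> {x. 0 < h x}" using zg t wz by simp
  moreover have "w \<in> closure \<Omega>" using s(2) wz t by auto
  ultimately have "\<Omega> \<inter> (ball z r \<inter> {x. 0 < h x}) \<noteq> {}"
    using open_Int_closure_eq_empty[OF U, of \<Omega>] by blast
  then obtain x where x: "x \<in> \<Omega>" "x \<in> ball z r" "0 < h x" by blast
  then have "x \<in> {x \<in> ball z r. \<gamma> (x - (x \<bullet> e) *\<^sub>R e) < x \<bullet> e}" unfolding r(4)[symmetric] by blast
  then show False using x(3) by (simp add: h_def)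
qed

locale mesh =
  fixes \<Omega> :: "(real^'n) set" and \<T> :: "(real^'n) set set"
  assumes dim: "CARD('n) \<ge> 2" and lip: "lipschitz_domain \<Omega>" and bounded: "bounded \<Omega>"
    and reg: "regular_triangulation \<Omega> \<T>"
begin

lemma finite_mesh: "finite \<T>" and mesh_Union: "\<Union>\<T> = closure \<Omega>"
  using reg by (auto simp: regular_triangulation_def triangulation_def)

lemma mesh_Int_face: "T \<in> \<T> \<Longrightarrow> T' \<in> \<T> \<Longrightarrow> (T \<inter> T') face_of T"
  using reg by (auto simp: regular_triangulation_def triangulation_def)

lemma mesh_element:
  assumes "T \<in> \<T>"
  shows "polytope T" "convex T" "compact T" "aff_dim T = DIM(real^'n)" "interior T \<noteq> {}" "rel_interior T = interior T"
    "polyhedron T"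
proof -
  have s: "int CARD('n) simplex T" using reg assms by (auto simp: regular_triangulation_def)
  show p: "polytope T" by (rule simplex_imp_polytope[OF s])
  show cv: "convex T" and "compact T" and "polyhedron T"
    using p by (auto simp: polytope_imp_convex polytope_imp_compact polytope_imp_polyhedron)
  show d: "aff_dim T = DIM(real^'n)" using aff_dim_simplex[OF s] by simp
  show ri: "rel_interior T = interior T" by (rule interior_rel_interior[OF d])
  have "T \<noteq> {}" using d by auto
  then show "interior T \<noteq> {}" using rel_interior_eq_empty[OF cv] ri by simp
qed

text \<open>The intersection is a face of both simplices, and a face of full dimension is the whole
  simplex.\<close>

lemma mesh_eq_if_interior_Int:
  assumes "T1 \<in> \<T>" "T2 \<in> \<T>" "interior (T1 \<inter> T2) \<noteq> {}"
  shows "T1 = T2"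
proof -
  have d: "aff_dim (T1 \<inter> T2) = DIM(real^'n)" using assms(3) interior_rel_interior_gen[of "T1 \<inter> T2"] by metis
  have "T1 \<inter> T2 = T1"
    using face_of_aff_dim_lt[OF mesh_element(2)[OF assms(1)] mesh_Int_face[OF assms(1,2)]] d mesh_element(4)[OF assms(1)] by linarith
  moreover have "T2 \<inter> T1 = T2"
  proof (rule ccontr)
    assume "T2 \<inter> T1 \<noteq> T2"
    then have "aff_dim (T2 \<inter> T1) < aff_dim T2"
      by (rule face_of_aff_dim_lt[OF mesh_element(2)[OF assms(2)] mesh_Int_face[OF assms(2,1)]])
    then show False using d mesh_element(4)[OF assms(2)] by (simp add: Int_commute)
  qed
  ultimately show ?thesis by blast
qed

lemma mesh_Int_negligible: "T1 \<in> \<T> \<Longrightarrow> T2 \<in> \<T> \<Longrightarrow> T1 \<noteq> T2 \<Longrightarrow> negligible (T1 \<inter> T2)"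
  using mesh_eq_if_interior_Int mesh_element(2) by (subst negligible_convex_interior) (auto intro: convex_Int)

lemma facet_hyperplane:
  assumes "T \<in> \<T>" "F facet_of T"
  obtains a b where "a \<noteq> 0" "affine hull F = {x. a \<bullet> x = b}"
proof -
  obtain a b where ab: "a \<noteq> 0" "F = T \<inter> {x. a \<bullet> x = b}"
    using facet_of_polyhedron[OF mesh_element(7)[OF assms(1)] assms(2)] by metis
  have F: "F \<noteq> {}" "aff_dim F = int DIM(real^'n) - 1"
    using assms(2) mesh_element(4)[OF assms(1)] by (auto simp: facet_of_def)
  have "affine hull F = {x. a \<bullet> x = b}"
  proof (rule affine_dim_equal)
    show "affine hull F \<subseteq> {x. a \<bullet> x = b}" using ab(2) by (intro hull_minimal) (auto simp: affine_hyperplane)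
    show "aff_dim (affine hull F) = aff_dim {x. a \<bullet> x = b}" using F(2) ab(1) by (simp add: aff_dim_hyperplane)
  qed (use F(1) in \<open>auto simp: affine_hyperplane\<close>)
  then show ?thesis using that ab(1) by blast
qed

lemma off_hyperplane:
  assumes "T \<in> \<T>" "a \<noteq> 0"
  obtains p where "p \<in> T" "a \<bullet> p \<noteq> b"
proof -
  have "\<not> T \<subseteq> {x. a \<bullet> x = b}"
  proof
    assume "T \<subseteq> {x. a \<bullet> x = b}"
    then have "aff_dim T \<le> aff_dim {x. a \<bullet> x = b}" by (rule aff_dim_subset)
    then show False using mesh_element(4)[OF assms(1)] assms(2) by (simp add: aff_dim_hyperplane)
  qed
  then show ?thesis using that by blast
qed

lemma facet_rel_interior:
  assumes "F facet_of T"
  shows "rel_interior F \<noteq> {}" "convex F" "F \<subseteq> T"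
proof -
  show "convex F" "F \<subseteq> T" using assms by (auto simp: facet_of_def face_of_imp_convex face_of_imp_subset)
  then show "rel_interior F \<noteq> {}" using assms rel_interior_eq_empty by (auto simp: facet_of_def)
qed

lemma same_strict_side_eq:
  assumes T: "T1 \<in> \<T>" "T2 \<in> \<T>" "F facet_of T1" "F facet_of T2" and hull: "affine hull F = {x. a \<bullet> x = b}"
    and p: "p1 \<in> T1" "a \<bullet> p1 < b" "p2 \<in> T2" "a \<bullet> p2 < b"
  shows "T1 = T2"
proof -
  obtain z where "z \<in> rel_interior F" using facet_rel_interior(1)[OF T(3)] by blast
  then show ?thesis
    using same_side_interior_Int[OF mesh_element(2)[OF T(1)] mesh_element(2)[OF T(2)] facet_rel_interior(3)[OF T(3)] facet_rel_interior(3)[OF T(4)] hull _ p]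
      mesh_eq_if_interior_Int[OF T(1,2)] by blast
qed

lemma same_side_eq:
  assumes T: "T1 \<in> \<T>" "T2 \<in> \<T>" "F facet_of T1" "F facet_of T2" and hull: "affine hull F = {x. a \<bullet> x = b}"
    and p: "p1 \<in> T1" "p2 \<in> T2" "a \<bullet> p1 \<noteq> b" "a \<bullet> p2 \<noteq> b" "a \<bullet> p1 < b \<longleftrightarrow> a \<bullet> p2 < b"
  shows "T1 = T2"
proof (cases "a \<bullet> p1 < b")
  case True
  then show ?thesis using same_strict_side_eq[OF T hull p(1) _ p(2)] p(5) by blast
next
  case False
  have hull': "affine hull F = {x. (- a) \<bullet> x = - b}" using hull by simp
  show ?thesis using same_strict_side_eq[OF T hull' p(1) _ p(2)] False p(3-5) by simp
qed

text \<open>Distinct simplices at a facet lie on opposite sides of its hyperplane. Two of them fill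
  a neighbourhood of each relative interior point, and a third would have to share a side with one
  of them.\<close>

lemma two_simplices_at_facet:
  assumes T: "T1 \<in> \<T>" "T2 \<in> \<T>" "F facet_of T1" "F facet_of T2" "T1 \<noteq> T2"
  shows "rel_interior F \<subseteq> interior (T1 \<union> T2)" "T \<in> \<T> \<Longrightarrow> F facet_of T \<Longrightarrow> T = T1 \<or> T = T2"
proof -
  obtain a b where ab: "a \<noteq> 0" "affine hull F = {x. a \<bullet> x = b}" using facet_hyperplane[OF T(1,3)] .
  obtain p1 where p1: "p1 \<in> T1" "a \<bullet> p1 \<noteq> b" using off_hyperplane[OF T(1) ab(1)] .
  obtain p2 where p2: "p2 \<in> T2" "a \<bullet> p2 \<noteq> b" using off_hyperplane[OF T(2) ab(1)] .
  have opp: "a \<bullet> p1 < b \<longleftrightarrow> \<not> a \<bullet> p2 < b"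
    using same_side_eq[OF T(1-4) ab(2) p1(1) p2(1) p1(2) p2(2)] T(5) by blast
  note cv = mesh_element(2)[OF T(1)] mesh_element(2)[OF T(2)]
  note sub = facet_rel_interior(3)[OF T(3)] facet_rel_interior(3)[OF T(4)]
  show "rel_interior F \<subseteq> interior (T1 \<union> T2)"
  proof
    fix z assume z: "z \<in> rel_interior F"
    show "z \<in> interior (T1 \<union> T2)"
    proof (cases "a \<bullet> p1 < b")
      case True
      then show ?thesis
        using opposite_sides_interior_Un[OF cv sub ab(2) z p1(1) _ p2(1)] opp p2(2) by simp
    next
      case False
      then show ?thesis
        using opposite_sides_interior_Un[OF cv(2,1) sub(2,1) ab(2) z p2(1) _ p1(1)] opp p1(2) by (simp add: Un_commute)
    qed
  qed
  assume TT: "T \<in> \<T>" "F facet_of T"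
  obtain p where p: "p \<in> T" "a \<bullet> p \<noteq> b" using off_hyperplane[OF TT(1) ab(1)] .
  show "T = T1 \<or> T = T2"
    using same_side_eq[OF TT(1) T(1) TT(2) T(3) ab(2) p(1) p1(1) p(2) p1(2)]
      same_side_eq[OF TT(1) T(2) TT(2) T(4) ab(2) p(1) p2(1) p(2) p2(2)] opp by blast
qed

text \<open>Two simplices at a facet would put its relative interior into the interior of the closed
  domain, which a Lipschitz boundary forbids. The definite description in \<open>jump\<close> is
  thereby justified.\<close>

lemma boundary_facet_unique:
  assumes T: "T1 \<in> \<T>" "T2 \<in> \<T>" "F facet_of T1" "F facet_of T2" and "F \<subseteq> frontier \<Omega>"
  shows "T1 = T2"
proof (rule ccontr)
  assume ne: "T1 \<noteq> T2"
  obtain z where z: "z \<in> rel_interior F" using facet_rel_interior(1)[OF T(3)] by blast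
  then have "z \<in> interior (T1 \<union> T2)" using two_simplices_at_facet(1)[OF T ne] by blast
  moreover have "T1 \<union> T2 \<subseteq> closure \<Omega>" using T(1,2) mesh_Union by blast
  ultimately have "z \<in> interior (closure \<Omega>)" using interior_mono by blast
  moreover have "z \<in> frontier \<Omega>" using z assms(5) rel_interior_subset by blast
  ultimately show False using lipschitz_domain_frontier[OF lip] by blast
qed

text \<open>A point of the domain in the relative interior of \<open>F\<close> must lie in another
  simplex, since otherwise it would be interior to \<open>T\<close>. By face-to-face regularity and
  dimension, the two simplices then meet exactly in \<open>F\<close>.\<close>

lemma interior_facet_neighbour:
  assumes T: "T \<in> \<T>" "F facet_of T" "\<not> F \<subseteq> frontier \<Omega>"
  obtains T' where "T' \<in> \<T>" "F facet_of T'" "T' \<noteq> T"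
proof -
  have op: "open \<Omega>" using lip by (simp add: lipschitz_domain_def)
  obtain x where x: "x \<in> F" "x \<notin> frontier \<Omega>" using T(3) by blast
  have "x \<in> closure \<Omega>" using x(1) facet_rel_interior(3)[OF T(2)] T(1) mesh_Union by blast
  then have "x \<in> \<Omega>" using x(2) op by (simp add: frontier_def interior_open)
  \<comment> \<open>The point \<open>x\<close> may lie on the relative boundary of \<open>F\<close>;
    openness of the domain lets it be replaced by a nearby relative interior point.\<close>
  moreover have "x \<in> closure (rel_interior F)"
    using x(1) convex_closure_rel_interior[OF facet_rel_interior(2)[OF T(2)]] closure_subset by blast
  ultimately have "\<Omega> \<inter> rel_interior F \<noteq> {}" using open_Int_closure_eq_empty[OF op] by blast
  then obtain y where y: "y \<in> \<Omega>" "y \<in> rel_interior F" by blast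
  have Fface: "F face_of T" "F \<noteq> T" using T(2) by (auto simp: facet_of_def)
  have "\<exists>T'\<in>\<T> - {T}. y \<in> T'"
  proof (rule ccontr)
    assume "\<not> ?thesis"
    then have "y \<in> \<Omega> - \<Union>(\<T> - {T})" using y(1) by blast
    moreover have "closed (\<Union>(\<T> - {T}))"
      using finite_mesh mesh_element(3) by (intro closed_Union) (auto intro: compact_imp_closed)
    then have "open (\<Omega> - \<Union>(\<T> - {T}))" using op by (rule open_Diff[rotated])
    moreover have "\<Omega> - \<Union>(\<T> - {T}) \<subseteq> T" using mesh_Union closure_subset[of \<Omega>] by blast
    ultimately have "y \<in> interior T" using interior_maximal by blast
    then show False using face_of_disjoint_interior[OF Fface] y(2) rel_interior_subset by blast
  qed
  then obtain T' where T': "T' \<in> \<T>" "T' \<noteq> T" "y \<in> T'" by blast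
  have fT: "(T \<inter> T') face_of T" by (rule mesh_Int_face[OF T(1) T'(1)])
  have "F \<subseteq> T \<inter> T'"
    using subset_of_face_of[OF fT facet_rel_interior(3)[OF T(2)]] y(2) T'(3) rel_interior_subset facet_rel_interior(3)[OF T(2)] by blast
  then have F2: "F face_of (T \<inter> T')" using face_of_subset[OF Fface(1)] by blast
  have "T \<inter> T' \<noteq> T"
  proof
    assume "T \<inter> T' = T"
    then have "interior (T \<inter> T') \<noteq> {}" using mesh_element(5)[OF T(1)] by simp
    then show False using mesh_eq_if_interior_Int[OF T(1) T'(1)] T'(2) by blast
  qed
  then have "aff_dim (T \<inter> T') < aff_dim T" using face_of_aff_dim_lt[OF mesh_element(2)[OF T(1)] fT] by blast
  then have "\<not> aff_dim F < aff_dim (T \<inter> T')" using T(2) by (simp add: facet_of_def)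
  then have eq: "F = T \<inter> T'"
    using face_of_aff_dim_lt[OF _ F2] mesh_element(2)[OF T(1)] mesh_element(2)[OF T'(1)] by (metis convex_Int)
  then have "F face_of T'" using mesh_Int_face[OF T'(1) T(1)] by (simp add: Int_commute)
  then have "F facet_of T'"
    using T(2) mesh_element(4)[OF T(1)] mesh_element(4)[OF T'(1)] by (simp add: facet_of_def)
  then show ?thesis using that T' by blast
qed

text \<open>Resolves both choice operators in \<open>jump\<close>. The order of \<open>T1\<close>
  and \<open>T2\<close> remains unknown but is the same for all \<open>v\<close> and
  \<open>x\<close>, so the jump is linear in \<open>v\<close>.\<close>

lemma jump_cases:
  assumes T: "T \<in> \<T>" "F facet_of T"
  shows "(\<forall>v x. jump \<Omega> \<T> v F x = piece v T x) \<or>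
    (\<exists>T1 T2. T1 \<in> \<T> \<and> T2 \<in> \<T> \<and> T1 \<noteq> T2 \<and> F facet_of T1 \<and> F facet_of T2 \<and> (T = T1 \<or> T = T2) \<and>
      (\<forall>v x. jump \<Omega> \<T> v F x = piece v T1 x - piece v T2 x))"
proof (cases "F \<subseteq> frontier \<Omega>")
  case True
  then have "(THE T. T \<in> \<T> \<and> F facet_of T) = T"
    using T boundary_facet_unique by (intro the_equality) blast+
  then show ?thesis using True by (simp add: jump_def)
next
  case False
  obtain T' where T': "T' \<in> \<T>" "F facet_of T'" "T' \<noteq> T" using interior_facet_neighbour[OF T False] .
  let ?P = "\<lambda>(T1, T2). T1 \<in> \<T> \<and> T2 \<in> \<T> \<and> T1 \<noteq> T2 \<and> F facet_of T1 \<and> F facet_of T2"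
  obtain T1 T2 where eq: "(SOME (T1, T2). T1 \<in> \<T> \<and> T2 \<in> \<T> \<and> T1 \<noteq> T2 \<and> F facet_of T1 \<and> F facet_of T2) = (T1, T2)"
    by (rule prod.exhaust)
  have "?P (SOME p. ?P p)" by (rule someI[of ?P "(T', T)"]) (use T T' in auto)
  then have P: "T1 \<in> \<T> \<and> T2 \<in> \<T> \<and> T1 \<noteq> T2 \<and> F facet_of T1 \<and> F facet_of T2" using eq by simp
  then have "T = T1 \<or> T = T2" using two_simplices_at_facet(2)[of T1 T2 F T] T by blast
  moreover have "\<forall>v x. jump \<Omega> \<T> v F x = piece v T1 x - piece v T2 x"
    using False eq by (simp add: jump_def)
  ultimately show ?thesis using P by blast
qed

text \<open>A segment from a simplex where \<open>c\<close> does not vanish to the outside of the domain, chosen to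
  avoid the faces of codimension two, can leave the union of the simplices with that value of \<open>c\<close>
  only through the relative interior of a facet.\<close>

lemma piecewise_constant_eq_zero:
  assumes neighbour: "\<And>T F. T \<in> \<T> \<Longrightarrow> F facet_of T \<Longrightarrow> c T \<noteq> 0 \<Longrightarrow>
      \<exists>T'\<in>\<T>. T' \<noteq> T \<and> F facet_of T' \<and> c T' = c T"
    and T0: "T0 \<in> \<T>"
  shows "c T0 = (0::real)"
proof (rule ccontr)
  assume c0: "c T0 \<noteq> 0"
  define d where "d = int DIM(real^'n)"
  define S where "S = \<Union>{T\<in>\<T>. c T = c T0}"
  define \<Z> where "\<Z> = {G. \<exists>T\<in>\<T>. G face_of T \<and> aff_dim G \<le> d - 2}"
  have "\<Z> \<subseteq> (\<Union>T\<in>\<T>. {G. G face_of T})" by (auto simp: \<Z>_def)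
  then have finZ: "finite \<Z>"
    by (rule finite_subset) (use finite_mesh mesh_element(1) in \<open>auto intro: finite_polytope_faces\<close>)
  have negl: "negligible G" if "aff_dim G < d" for G :: "(real^'n) set"
  proof -
    obtain a b where "a \<noteq> 0" "G \<subseteq> {x. a \<bullet> x = b}" using aff_lowdim_subset_hyperplane[of G] \<open>aff_dim G < d\<close> unfolding d_def by blast
    then show ?thesis using negligible_hyperplane[of a b] negligible_subset by blast
  qed
  have "negligible (\<Union>\<Z>)" using finZ negl by (intro negligible_Union) (auto simp: \<Z>_def)
  then have "\<not> interior T0 \<subseteq> \<Union>\<Z>"
    using open_not_negligible[OF open_interior mesh_element(5)[OF T0]] negligible_subset by blast
  then obtain x0 where x0: "x0 \<in> interior T0" "x0 \<notin> \<Union>\<Z>" by blast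
  \<comment> \<open>If a segment from \<open>x0\<close> met a face \<open>G\<close> of codimension
    at least two, its end point would lie in the affine hull of \<open>x0\<close> and
    \<open>G\<close>. These hulls have dimension at most \<open>d - 1\<close>, so almost every end
    point avoids them.\<close>
  define N where "N = (\<Union>G\<in>\<Z>. affine hull (insert x0 G))"
  have "negligible N"
    unfolding N_def
  proof (intro negligible_Union finite_imageI finZ)
    fix t assume "t \<in> (\<lambda>G. affine hull (insert x0 G)) ` \<Z>"
    then obtain G where G: "G \<in> \<Z>" "t = affine hull (insert x0 G)" by blast
    have "aff_dim (insert x0 G) \<le> aff_dim G + 1" by (simp add: aff_dim_insert)
    then show "negligible t" using G by (intro negl) (auto simp: \<Z>_def)
  qed
  moreover have "open (- closure \<Omega>)" by (intro open_Compl closed_closure)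
  moreover have "- closure \<Omega> \<noteq> {}"
    using bounded_closure[OF bounded] not_bounded_UNIV by (metis Compl_empty_eq double_complement)
  ultimately have "\<not> - closure \<Omega> \<subseteq> N" using open_not_negligible negligible_subset by blast
  then obtain y where y: "y \<notin> closure \<Omega>" "y \<notin> N" by blast
  \<comment> \<open>Off the small faces, a boundary point of a simplex lies in the relative interior
    of a facet, and the neighbour with the same value covers the other side.\<close>
  have facet_point: "z \<in> interior S" if z: "z \<in> S" "z \<notin> \<Union>\<Z>" for z
  proof -
    obtain T where T: "T \<in> \<T>" "c T = c T0" "z \<in> T" using z(1) by (auto simp: S_def)
    show ?thesis
    proof (cases "z \<in> interior T")
      case True
      moreover have "interior T \<subseteq> interior S" using T by (intro interior_mono) (auto simp: S_def)
      ultimately show ?thesis by blast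
    next
      case False
      then obtain F where F: "F facet_of T" "z \<in> F"
        using rel_boundary_of_polyhedron[OF mesh_element(7)[OF T(1)]] T(3) mesh_element(6)[OF T(1)] by blast
      have Fface: "F face_of T" using F(1) by (simp add: facet_of_def)
      have zr: "z \<in> rel_interior F"
      proof (rule ccontr)
        assume "z \<notin> rel_interior F"
        moreover have "polyhedron F"
          using face_of_polytope_polytope[OF mesh_element(1)[OF T(1)] Fface] by (rule polytope_imp_polyhedron)
        ultimately obtain F' where F': "F' facet_of F" "z \<in> F'"
          using rel_boundary_of_polyhedron F(2) by blast
        have "F' face_of T" using F'(1) Fface face_of_trans by (auto simp: facet_of_def)
        moreover have "aff_dim F' = d - 2"
          using F'(1) F(1) mesh_element(4)[OF T(1)] by (simp add: facet_of_def d_def)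
        ultimately have "F' \<in> \<Z>" using T(1) by (auto simp: \<Z>_def)
        then show False using F'(2) z(2) by blast
      qed
      obtain T' where T': "T' \<in> \<T>" "T' \<noteq> T" "F facet_of T'" "c T' = c T"
        using neighbour[OF T(1) F(1)] T(2) c0 by auto
      have "z \<in> interior (T \<union> T')" using two_simplices_at_facet(1)[OF T(1) T'(1) F(1) T'(3)] T'(2) zr by blast
      moreover have "interior (T \<union> T') \<subseteq> interior S" using T T' by (intro interior_mono) (auto simp: S_def)
      ultimately show ?thesis by blast
    qed
  qed
  have avoid: "z \<notin> \<Union>\<Z>" if z: "z \<in> closed_segment x0 y" for z
  proof
    assume "z \<in> \<Union>\<Z>"
    then obtain G where G: "G \<in> \<Z>" "z \<in> G" by blast
    obtain u where u: "z = (1 - u) *\<^sub>R x0 + u *\<^sub>R y" using z by (auto simp: in_segment)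
    have "u \<noteq> 0" using u \<open>z \<in> \<Union>\<Z>\<close> x0(2) by auto
    have "(1 / u) *\<^sub>R z = (1 / u) *\<^sub>R ((1 - u) *\<^sub>R x0) + y"
      unfolding u using \<open>u \<noteq> 0\<close> by (simp add: scaleR_add_right)
    moreover have "(1 / u) *\<^sub>R ((1 - u) *\<^sub>R x0) = - ((1 - 1 / u) *\<^sub>R x0)"
    proof -
      have "(1 / u) * (1 - u) = - (1 - 1 / u)" using \<open>u \<noteq> 0\<close> by (simp add: field_simps)
      then show ?thesis by (simp only: scaleR_scaleR scaleR_minus_left)
    qed
    ultimately have "y = (1 - 1 / u) *\<^sub>R x0 + (1 / u) *\<^sub>R z" by simp
    moreover have "(1 - 1 / u) *\<^sub>R x0 + (1 / u) *\<^sub>R z \<in> affine hull (insert x0 G)"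
      by (rule mem_affine[OF affine_affine_hull]) (use G in \<open>auto intro: hull_inc\<close>)
    ultimately show False using y(2) G(1) by (auto simp: N_def)
  qed
  have "closed S"
    unfolding S_def using finite_mesh mesh_element(3) by (intro closed_Union) (auto intro: compact_imp_closed)
  then have "open (- S)" by (rule open_Compl)
  \<comment> \<open>The interior and the complement of \<open>S\<close> are disjoint open sets
    covering the segment; one contains \<open>x0\<close>, the other \<open>y\<close>, against
    connectedness.\<close>
  moreover have "closed_segment x0 y \<subseteq> interior S \<union> - S" using avoid facet_point by blast
  moreover have "interior S \<inter> - S \<inter> closed_segment x0 y = {}" using interior_subset by blast
  moreover have "x0 \<in> interior S"
  proof -
    have "T0 \<subseteq> S" using T0 by (auto simp: S_def)
    then show ?thesis using x0(1) interior_mono by blast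
  qed
  then have "interior S \<inter> closed_segment x0 y \<noteq> {}" by auto
  moreover have "y \<notin> S" using y(1) mesh_Union by (auto simp: S_def)
  then have "- S \<inter> closed_segment x0 y \<noteq> {}" by auto
  ultimately show False
    using connectedD[OF connected_segment(1)[of x0 y] open_interior[of S], of "- S"] by blast
qed

end

section \<open>Nonconforming spaces\<close>

lemma L2_proj_finite_span:
  fixes B :: "'b::real_inner set"
  assumes "finite B"
  shows "linear (L2_proj (span B))" "norm (L2_proj (span B) v) \<le> norm v"
proof -
  obtain \<pi> :: "'b \<Rightarrow> 'b" where p: "linear \<pi>" "\<And>v. \<pi> v \<in> span B" "\<And>v g. g \<in> span B \<Longrightarrow> (v - \<pi> v) \<bullet> g = 0"
    by (rule orthogonal_projection_exists[OF assms]) blast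
  have "L2_proj (span B) v = \<pi> v" for v
    unfolding L2_proj_def
  proof (rule the_equality)
    fix w assume w: "w \<in> span B \<and> (\<forall>z\<in>span B. (v - w) \<bullet> z = 0)"
    have "w - \<pi> v \<in> span B" using w p(2) by (simp add: span_diff)
    then have "(v - w) \<bullet> (w - \<pi> v) = 0" "(v - \<pi> v) \<bullet> (w - \<pi> v) = 0" using w p(3) by blast+
    then have "(w - \<pi> v) \<bullet> (w - \<pi> v) = 0" by (simp add: inner_diff_left)
    then show "w = \<pi> v" by simp
  qed (use p in blast)
  then have eq: "L2_proj (span B) = \<pi>" by blast
  show "linear (L2_proj (span B))" unfolding eq by (rule p(1))
  have "(norm v)\<^sup>2 = (norm ((v - \<pi> v) + \<pi> v))\<^sup>2" by simp
  also have "\<dots> = (norm (v - \<pi> v))\<^sup>2 + (norm (\<pi> v))\<^sup>2"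
    using p(3)[OF p(2)] by (intro norm_add_Pythagorean) (simp add: orthogonal_def)
  finally have "(norm (\<pi> v))\<^sup>2 \<le> (norm v)\<^sup>2" by simp
  then show "norm (L2_proj (span B) v) \<le> norm v" unfolding eq by (simp add: power2_le_iff_abs_le)
qed

lemma square_integrable_on_compact:
  fixes f :: "'a::euclidean_space \<Rightarrow> real"
  assumes "compact T" "continuous_on T f"
  shows "square_integrable (\<lambda>x. if x \<in> T then f x else 0)"
proof -
  have i: "integrable lebesgue (\<lambda>x. if x \<in> T then g x else 0)" if "continuous_on T g" for g :: "'a \<Rightarrow> real"
  proof -
    have "(\<lambda>x. indicator T x *\<^sub>R g x) = (\<lambda>x. if x \<in> T then g x else 0)" by (auto simp: indicator_def)
    then have *: "integrable lborel (\<lambda>x. if x \<in> T then g x else 0)"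
      using borel_integrable_compact[OF assms(1) that] by simp
    then show ?thesis using integrable_completion[OF borel_measurable_integrable[OF *]] by blast
  qed
  have "(\<lambda>x. (if x \<in> T then f x else 0)\<^sup>2) = (\<lambda>x. if x \<in> T then (f x)\<^sup>2 else 0)" by auto
  then show ?thesis
    using i[OF assms(2)] i[of "\<lambda>x. (f x)\<^sup>2"] assms(2)
    by (auto simp: square_integrable_def intro: borel_measurable_integrable continuous_on_power)
qed

lemma subspace_pw_polys: "subspace (pw_polys \<T> m)"
proof (rule subspaceI)
  show "0 \<in> pw_polys \<T> m"
    using L2_on_subspace[THEN subspace_0, of "\<Union>\<T>"] rep_zero polys_const[of 0 m] unfolding pw_polys_def by fastforce
next
  fix v w assume v: "v \<in> pw_polys \<T> m" and w: "w \<in> pw_polys \<T> m"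
  have "\<exists>p\<in>polys m. AE x in lebesgue. x \<in> T \<longrightarrow> rep_L2 (v + w) x = p x" if T: "T \<in> \<T>" for T
  proof -
    obtain p q where p: "p \<in> polys m" "AE x in lebesgue. x \<in> T \<longrightarrow> rep_L2 v x = p x"
      and q: "q \<in> polys m" "AE x in lebesgue. x \<in> T \<longrightarrow> rep_L2 w x = q x"
      using v w T unfolding pw_polys_def by blast
    have "AE x in lebesgue. x \<in> T \<longrightarrow> rep_L2 (v + w) x = p x + q x"
      using p(2) q(2) rep_add[of v w] by eventually_elim auto
    then show ?thesis by (intro bexI[of _ "\<lambda>x. p x + q x"] polys_add p q)
  qed
  then show "v + w \<in> pw_polys \<T> m"
    using v w subspace_add[OF L2_on_subspace, of v "\<Union>\<T>" w] by (simp add: pw_polys_def)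
next
  fix v c assume v: "v \<in> pw_polys \<T> m"
  have "\<exists>p\<in>polys m. AE x in lebesgue. x \<in> T \<longrightarrow> rep_L2 (c *\<^sub>R v) x = p x" if T: "T \<in> \<T>" for T
  proof -
    obtain p where p: "p \<in> polys m" "AE x in lebesgue. x \<in> T \<longrightarrow> rep_L2 v x = p x"
      using v T unfolding pw_polys_def by blast
    have "AE x in lebesgue. x \<in> T \<longrightarrow> rep_L2 (c *\<^sub>R v) x = c * p x"
      using p(2) rep_scaleR[of c v] by eventually_elim auto
    then show ?thesis by (intro bexI[of _ "\<lambda>x. c * p x"] polys_cmult p)
  qed
  then show "c *\<^sub>R v \<in> pw_polys \<T> m"
    using v subspace_scale[OF L2_on_subspace, of v "\<Union>\<T>" c] by (simp add: pw_polys_def)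
qed

lemma pw_polys_subset: "pw_polys \<T> m \<subseteq> pw_poly_space \<T>"
  unfolding pw_polys_def pw_poly_space_def is_piece_def by blast

definition bubble_poly :: "(real^'n) set \<Rightarrow> real^'n \<Rightarrow> real" where
  "bubble_poly T x = (real CARD('n) + 2) / 2 - real CARD('n) * (real CARD('n) + 1)\<^sup>2 * (real CARD('n) + 2) /
     (\<Sum>(p, q)\<in>{(p, q). p \<in> vertices T \<and> q \<in> vertices T \<and> p \<noteq> q}. (norm (p - q))\<^sup>2) * (norm (x - barycenter T))\<^sup>2"

lemma bubble_eq: "bubble T = abs_L2 (\<lambda>x. if x \<in> T then bubble_poly T x else 0)"
  unfolding bubble_def bubble_poly_def Let_def ..

lemma bubble_poly_polys: "bubble_poly T \<in> polys 2"
proof -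
  define m where "m = barycenter T"
  obtain a b where ab: "\<And>x. bubble_poly T x = a - b * (norm (x - m))\<^sup>2"
    unfolding bubble_poly_def m_def by blast
  have "(norm (x - m))\<^sup>2 = (\<Sum>i\<in>UNIV. x $ i ^ 2 + ((- 2 * m $ i) * x $ i ^ 1 + (m $ i)\<^sup>2))" for x
  proof -
    have "(norm (x - m))\<^sup>2 = (\<Sum>i\<in>UNIV. (x $ i - m $ i)\<^sup>2)"
      by (simp add: norm_vec_def L2_set_def sum_nonneg)
    also have "\<dots> = (\<Sum>i\<in>UNIV. x $ i ^ 2 + ((- 2 * m $ i) * x $ i ^ 1 + (m $ i)\<^sup>2))"
      by (intro sum.cong refl) (simp add: power2_diff)
    finally show ?thesis .
  qed
  then have eq: "bubble_poly T = (\<lambda>x. a + (- b) * (\<Sum>i\<in>UNIV. x $ i ^ 2 + ((- 2 * m $ i) * x $ i ^ 1 + (m $ i)\<^sup>2)))"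
    by (intro ext) (simp add: ab)
  show ?thesis
    unfolding eq by (intro polys_add polys_cmult polys_sum polys_const polys_component_power) simp_all
qed

context mesh
begin

lemma piece_add:
  "v \<in> pw_poly_space \<T> \<Longrightarrow> w \<in> pw_poly_space \<T> \<Longrightarrow> T \<in> \<T> \<Longrightarrow> piece (v + w) T = (\<lambda>x. piece v T x + piece w T x)"
  using piece_eq[OF mesh_element(5) is_piece_add] is_piece_piece[OF mesh_element(5)] by blast

lemma piece_scaleR:
  "v \<in> pw_poly_space \<T> \<Longrightarrow> T \<in> \<T> \<Longrightarrow> piece (c *\<^sub>R v) T = (\<lambda>x. c * piece v T x)"
  using piece_eq[OF mesh_element(5) is_piece_scaleR] is_piece_piece[OF mesh_element(5)] by blast

lemma jump_linear:
  assumes "F \<in> faces \<T>" "v \<in> pw_poly_space \<T>" "w \<in> pw_poly_space \<T>"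
  shows "jump \<Omega> \<T> (v + w) F x = jump \<Omega> \<T> v F x + jump \<Omega> \<T> w F x"
    "jump \<Omega> \<T> (c *\<^sub>R v) F x = c * jump \<Omega> \<T> v F x"
proof -
  obtain T where T: "T \<in> \<T>" "F facet_of T" using assms(1) by (auto simp: faces_def)
  have "jump \<Omega> \<T> (v + w) F x = jump \<Omega> \<T> v F x + jump \<Omega> \<T> w F x \<and> jump \<Omega> \<T> (c *\<^sub>R v) F x = c * jump \<Omega> \<T> v F x"
    using jump_cases[OF T]
  proof
    assume "\<forall>v x. jump \<Omega> \<T> v F x = piece v T x"
    then show ?thesis using piece_add[OF assms(2,3) T(1)] piece_scaleR[OF assms(2) T(1)] by simp
  next
    assume "\<exists>T1 T2. T1 \<in> \<T> \<and> T2 \<in> \<T> \<and> T1 \<noteq> T2 \<and> F facet_of T1 \<and> F facet_of T2 \<and> (T = T1 \<or> T = T2) \<and>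
      (\<forall>v x. jump \<Omega> \<T> v F x = piece v T1 x - piece v T2 x)"
    then obtain T1 T2 where T12: "T1 \<in> \<T>" "T2 \<in> \<T>" and j: "\<forall>v x. jump \<Omega> \<T> v F x = piece v T1 x - piece v T2 x"
      by blast
    show ?thesis
      using piece_add[OF assms(2,3) T12(1)] piece_add[OF assms(2,3) T12(2)] piece_scaleR[OF assms(2) T12(1)] piece_scaleR[OF assms(2) T12(2)]
      by (simp only: j[rule_format]) (simp add: algebra_simps)
  qed
  then show "jump \<Omega> \<T> (v + w) F x = jump \<Omega> \<T> v F x + jump \<Omega> \<T> w F x"
    "jump \<Omega> \<T> (c *\<^sub>R v) F x = c * jump \<Omega> \<T> v F x" by blast+
qed

lemma subspace_CR: "subspace (CR \<Omega> \<T>)"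
proof (rule subspaceI)
  note s = subspace_pw_polys[of \<T> 1]
  have sub: "v \<in> pw_poly_space \<T>" if "v \<in> pw_polys \<T> 1" for v using that pw_polys_subset by blast
  have 0: "0 \<in> pw_polys \<T> 1" using subspace_0[OF s] .
  have "jump \<Omega> \<T> 0 F x = 0" if "F \<in> faces \<T>" for F x
    using jump_linear(2)[OF that sub[OF 0] sub[OF 0], of 0 x] by simp
  then show "0 \<in> CR \<Omega> \<T>" using 0 by (simp add: CR_def)
  show "v + w \<in> CR \<Omega> \<T>" if "v \<in> CR \<Omega> \<T>" "w \<in> CR \<Omega> \<T>" for v w
    using that subspace_add[OF s] jump_linear(1) sub by (simp add: CR_def)
  show "c *\<^sub>R v \<in> CR \<Omega> \<T>" if "v \<in> CR \<Omega> \<T>" for c v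
    using that subspace_scale[OF s] jump_linear(2)[of _ v v] sub by (simp add: CR_def)
qed

lemma subspace_eCR: "subspace (eCR \<Omega> \<T>)"
  unfolding eCR_def by (rule subspace_sums[OF subspace_CR subspace_span])

text \<open>A simplex has at least two distinct vertices. Positivity of this denominator keeps the
  quadratic part of the bubble from degenerating.\<close>

lemma bubble_coefficient_pos:
  assumes "T \<in> \<T>"
  shows "0 < (\<Sum>(p, q)\<in>{(p, q). p \<in> vertices T \<and> q \<in> vertices T \<and> p \<noteq> q}. (norm (p - q))\<^sup>2)"
proof -
  have "int CARD('n) simplex T" using reg assms by (auto simp: regular_triangulation_def)
  then obtain C where C: "\<not> affine_dependent C" "int (card C) = int CARD('n) + 1" "T = convex hull C"
    unfolding simplex_def by blast
  have v: "vertices T = C" unfolding vertices_def C(3) using extreme_point_of_convex_hull_affine_independent[OF C(1)] by simp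
  have fin: "finite C" "2 \<le> card C" using C(2) dim card_ge_0_finite[of C] by linarith+
  obtain p q where pq: "p \<in> C" "q \<in> C" "p \<noteq> q"
    using fin by (metis card_le_Suc0_iff_eq not_less_eq_eq numeral_2_eq_2)
  show ?thesis
    unfolding v
  proof (rule sum_pos2[where i="(p, q)"])
    show "finite {(p, q). p \<in> C \<and> q \<in> C \<and> p \<noteq> q}"
      by (rule finite_subset[of _ "C \<times> C"]) (use fin in auto)
  qed (use pq in auto)
qed

lemma bubble_properties:
  assumes T: "T \<in> \<T>"
  shows "bubble T \<in> L2_on (\<Union>\<T>)" "is_piece (bubble T) T (bubble_poly T)"
    "\<And>T'. T' \<in> \<T> \<Longrightarrow> T' \<noteq> T \<Longrightarrow> is_piece (bubble T) T' (\<lambda>_. 0)"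
proof -
  have si: "square_integrable (\<lambda>x. if x \<in> T then bubble_poly T x else 0)"
    by (rule square_integrable_on_compact[OF mesh_element(3)[OF T] polys_continuous[OF bubble_poly_polys]])
  note ae = rep_abs_L2[OF si, folded bubble_eq]
  show "bubble T \<in> L2_on (\<Union>\<T>)"
    unfolding L2_on_def mem_Collect_eq using ae by eventually_elim (use T in auto)
  have "AE x in lebesgue. x \<in> T \<longrightarrow> rep_L2 (bubble T) x = bubble_poly T x"
    using ae by eventually_elim simp
  then show "is_piece (bubble T) T (bubble_poly T)" unfolding is_piece_def using bubble_poly_polys by blast
  fix T' assume T': "T' \<in> \<T>" "T' \<noteq> T"
  have "T \<inter> T' \<in> null_sets lebesgue"
    using mesh_Int_negligible[OF T T'(1)] T'(2) by (simp add: negligible_iff_null_sets)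
  then have "AE x in lebesgue. x \<notin> T \<inter> T'" by (rule AE_not_in)
  then have "AE x in lebesgue. x \<in> T' \<longrightarrow> rep_L2 (bubble T) x = 0"
    using ae by eventually_elim auto
  then show "is_piece (bubble T) T' (\<lambda>_. 0)" unfolding is_piece_def using polys_const[of 0 0] by blast
qed

text \<open>Other bubbles vanish almost everywhere on \<open>T\<close>, since distinct simplices
  overlap in null sets; only a multiple of its own bubble polynomial survives there.\<close>

lemma span_bubble:
  assumes "w \<in> span (bubble ` \<T>)"
  shows "w \<in> L2_on (\<Union>\<T>)" "T \<in> \<T> \<Longrightarrow> \<exists>c. is_piece w T (\<lambda>x. c * bubble_poly T x)"
proof -
  let ?S = "{w. w \<in> L2_on (\<Union>\<T>) \<and> (\<forall>T\<in>\<T>. \<exists>c. is_piece w T (\<lambda>x. c * bubble_poly T x))}"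
  have "w \<in> ?S"
  proof (rule subsetD[OF span_minimal assms])
    show "bubble ` \<T> \<subseteq> ?S"
    proof clarify
      fix T assume T: "T \<in> \<T>"
      have "\<exists>c. is_piece (bubble T) T' (\<lambda>x. c * bubble_poly T' x)" if "T' \<in> \<T>" for T'
      proof (cases "T' = T")
        case True
        then show ?thesis using bubble_properties(2)[OF T] by (intro exI[of _ 1]) simp
      next
        case False
        then show ?thesis using bubble_properties(3)[OF T that] by (intro exI[of _ 0]) simp
      qed
      then show "bubble T \<in> L2_on (\<Union>\<T>) \<and> (\<forall>T'\<in>\<T>. \<exists>c. is_piece (bubble T) T' (\<lambda>x. c * bubble_poly T' x))"
        using bubble_properties(1)[OF T] by blast
    qed
    show "subspace ?S"
    proof (rule subspaceI)
      have "is_piece 0 T (\<lambda>x. 0 * bubble_poly T x)" for T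
        unfolding is_piece_def using rep_zero polys_const[of 0 0] by force
      then show "0 \<in> ?S" using subspace_0[OF L2_on_subspace] by blast
    next
      fix v w assume vw: "v \<in> ?S" "w \<in> ?S"
      have "\<exists>c. is_piece (v + w) T (\<lambda>x. c * bubble_poly T x)" if T: "T \<in> \<T>" for T
      proof -
        obtain c d where "is_piece v T (\<lambda>x. c * bubble_poly T x)" "is_piece w T (\<lambda>x. d * bubble_poly T x)"
          using vw T by blast
        from is_piece_add[OF this] show ?thesis by (intro exI[of _ "c + d"]) (simp add: distrib_right)
      qed
      then show "v + w \<in> ?S" using vw subspace_add[OF L2_on_subspace] by blast
    next
      fix v and a :: real assume v: "v \<in> ?S"
      have "\<exists>c. is_piece (a *\<^sub>R v) T (\<lambda>x. c * bubble_poly T x)" if T: "T \<in> \<T>" for T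
      proof -
        obtain c where "is_piece v T (\<lambda>x. c * bubble_poly T x)" using v T by blast
        from is_piece_scaleR[OF this, of a] show ?thesis by (intro exI[of _ "a * c"]) (simp add: mult.assoc)
      qed
      then show "a *\<^sub>R v \<in> ?S" using v subspace_scale[OF L2_on_subspace] by blast
    qed
  qed
  then show "w \<in> L2_on (\<Union>\<T>)" "T \<in> \<T> \<Longrightarrow> \<exists>c. is_piece w T (\<lambda>x. c * bubble_poly T x)" by blast+
qed

lemma zero_if_pieces_zero:
  assumes "v \<in> L2_on (\<Union>\<T>)" "\<And>T. T \<in> \<T> \<Longrightarrow> is_piece v T (\<lambda>_. 0)"
  shows "v = 0"
proof -
  have "AE x in lebesgue. \<forall>T\<in>\<T>. x \<in> T \<longrightarrow> rep_L2 v x = 0"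
    using assms(2) by (subst AE_ball_countable[OF countable_finite[OF finite_mesh]]) (auto simp: is_piece_def)
  moreover have "AE x in lebesgue. x \<notin> \<Union>\<T> \<longrightarrow> rep_L2 v x = 0" using assms(1) by (simp add: L2_on_def)
  ultimately have "AE x in lebesgue. rep_L2 v x = 0" by eventually_elim blast
  then show ?thesis unfolding L2_eq_iff using rep_zero by eventually_elim simp
qed

lemma eCR_subset: "eCR \<Omega> \<T> \<subseteq> pw_poly_space \<T>"
proof
  fix v assume "v \<in> eCR \<Omega> \<T>"
  then obtain x w where v: "v = x + w" "x \<in> CR \<Omega> \<T>" "w \<in> span (bubble ` \<T>)" by (auto simp: eCR_def)
  have "x \<in> pw_poly_space \<T>" using v(2) pw_polys_subset by (auto simp: CR_def)
  moreover have "w \<in> pw_poly_space \<T>" using span_bubble(2)[OF v(3)] by (auto simp: pw_poly_space_def)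
  ultimately show "v \<in> pw_poly_space \<T>" unfolding v(1) by (rule subspace_add[OF subspace_pw_poly_space])
qed

lemma CR_subset_eCR: "CR \<Omega> \<T> \<subseteq> eCR \<Omega> \<T>"
proof
  fix v assume "v \<in> CR \<Omega> \<T>"
  then show "v \<in> eCR \<Omega> \<T>" unfolding eCR_def using span_zero[of "bubble ` \<T>"] by force
qed

lemma sym_form_a_pw_mesh: "sym_form (pw_poly_space \<T>) (a_pw \<T>)"
  by (rule sym_form_a_pw) (auto simp: mesh_element)

text \<open>For constant pieces the single jump condition at the barycenter already equates
  neighbouring values, and on a boundary face it forces the value 0. A nonzero value therefore
  always spreads to a neighbour.\<close>

lemma a_pw_definite_CR:
  assumes v: "v \<in> CR \<Omega> \<T>" "\<And>T. T \<in> \<T> \<Longrightarrow> \<exists>c. piece v T = (\<lambda>_. c)"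
  shows "v = 0"
proof (rule zero_if_pieces_zero)
  show "v \<in> L2_on (\<Union>\<T>)" using v(1) by (simp add: CR_def pw_polys_def)
  have vp: "v \<in> pw_poly_space \<T>" using v(1) pw_polys_subset by (auto simp: CR_def)
  obtain c where c: "\<And>T. T \<in> \<T> \<Longrightarrow> piece v T = (\<lambda>_. c T)" using v(2) by metis
  have zero: "c T = 0" if "T \<in> \<T>" for T
  proof (rule piecewise_constant_eq_zero[OF _ that])
    fix T F assume T: "T \<in> \<T>" "F facet_of T" and ne: "c T \<noteq> 0"
    have j: "jump \<Omega> \<T> v F (barycenter F) = 0" using v(1) T by (auto simp: CR_def faces_def)
    show "\<exists>T'\<in>\<T>. T' \<noteq> T \<and> F facet_of T' \<and> c T' = c T"
      using jump_cases[OF T]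
    proof (elim disjE exE conjE)
      assume "\<forall>v x. jump \<Omega> \<T> v F x = piece v T x"
      then show ?thesis using j c[OF T(1)] ne by simp
    next
      fix T1 T2 assume T12: "T1 \<in> \<T>" "T2 \<in> \<T>" "T1 \<noteq> T2" "F facet_of T1" "F facet_of T2" "T = T1"
        and "\<forall>v x. jump \<Omega> \<T> v F x = piece v T1 x - piece v T2 x"
      then show ?thesis using j c[OF T12(1)] c[OF T12(2)] by (intro bexI[of _ T2]) auto
    next
      fix T1 T2 assume T12: "T1 \<in> \<T>" "T2 \<in> \<T>" "T1 \<noteq> T2" "F facet_of T1" "F facet_of T2" "T = T2"
        and "\<forall>v x. jump \<Omega> \<T> v F x = piece v T1 x - piece v T2 x"
      then show ?thesis using j c[OF T12(1)] c[OF T12(2)] by (intro bexI[of _ T1]) auto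
    qed
  qed
  show "is_piece v T (\<lambda>_. 0)" if "T \<in> \<T>" for T
    using is_piece_piece[OF mesh_element(5)[OF that] vp that] c[OF that] zero[OF that] by simp
qed

lemma a_pw_definite:
  assumes v: "v \<in> eCR \<Omega> \<T>" "a_pw \<T> v v = 0"
  shows "v = 0"
proof -
  obtain x w where xw: "v = x + w" "x \<in> CR \<Omega> \<T>" "w \<in> span (bubble ` \<T>)" using v(1) by (auto simp: eCR_def)
  have vp: "v \<in> pw_poly_space \<T>" using v(1) eCR_subset by blast
  have xp: "x \<in> pw_poly_space \<T>" using xw(2) pw_polys_subset by (auto simp: CR_def)
  have const: "\<exists>c. piece v T = (\<lambda>_. c)" if "T \<in> \<T>" for T
    by (rule a_pw_zero_imp_piece_const[OF finite_mesh mesh_element(5,3,2) vp v(2) that]) blast+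
  have "is_piece w T (\<lambda>_. 0)" if T: "T \<in> \<T>" for T
  proof -
    obtain g where g: "is_piece w T (\<lambda>x. g * bubble_poly T x)" using span_bubble(2)[OF xw(3) T] by blast
    obtain p where p: "p \<in> polys 1" "is_piece x T p"
      using xw(2) T unfolding CR_def pw_polys_def is_piece_def by blast
    obtain a b where ab: "p = (\<lambda>x. b + a \<bullet> x)" using polys_1_affine[OF p(1)] .
    obtain c where "piece v T = (\<lambda>_. c)" using const[OF T] by blast
    moreover have "piece v T = (\<lambda>x. p x + g * bubble_poly T x)"
      unfolding xw(1) by (rule piece_eq[OF mesh_element(5)[OF T] is_piece_add[OF p(2) g]])
    ultimately have eq: "b + a \<bullet> y + g * bubble_poly T y = c" for y using ab by metis
    define m where "m = barycenter T"
    define \<beta> where "\<beta> = real CARD('n) * (real CARD('n) + 1)\<^sup>2 * (real CARD('n) + 2) /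
      (\<Sum>(p, q)\<in>{(p, q). p \<in> vertices T \<and> q \<in> vertices T \<and> p \<noteq> q}. (norm (p - q))\<^sup>2)"
    have \<beta>: "0 < \<beta>" using bubble_coefficient_pos[OF T] by (simp add: \<beta>_def zero_less_mult_iff)
    have bp: "bubble_poly T y = (real CARD('n) + 2) / 2 - \<beta> * (norm (y - m))\<^sup>2" for y
      by (simp add: bubble_poly_def \<beta>_def m_def)
    \<comment> \<open>The second difference at \<open>m - e\<close>, \<open>m\<close>,
      \<open>m + e\<close> removes the affine part and isolates the bubble coefficient as
      \<open>g * \<beta> = 0\<close>.\<close>
    define e :: "real^'n" where "e = axis undefined 1"
    have "norm e = 1" by (simp add: e_def)
    define G where "G = (real CARD('n) + 2) / 2"
    have "b + a \<bullet> m + g * G = c" using eq[of m] by (simp add: bp G_def)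
    moreover have "b + (a \<bullet> m + a \<bullet> e) + (g * G - g * \<beta>) = c"
      using eq[of "m + e"] \<open>norm e = 1\<close> by (simp add: bp G_def inner_add_right right_diff_distrib)
    moreover have "b + (a \<bullet> m - a \<bullet> e) + (g * G - g * \<beta>) = c"
      using eq[of "m - e"] \<open>norm e = 1\<close> by (simp add: bp G_def inner_diff_right right_diff_distrib)
    ultimately have "g * \<beta> = 0" by linarith
    then have "g = 0" using \<beta> by simp
    then show ?thesis using g by simp
  qed
  then have "w = 0" by (rule zero_if_pieces_zero[OF span_bubble(1)[OF xw(3)]])
  then show ?thesis using a_pw_definite_CR[of v] xw(1,2) const by simp
qed

text \<open>Writes the range of \<open>Pi0\<close> as a finite span, so that linearity and
  contractivity of the finite-dimensional projection apply.\<close>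

lemma pw_constants_span:
  "pw_polys \<T> 0 = span ((\<lambda>T. abs_L2 (\<lambda>x. if x \<in> T then 1 else 0)) ` \<T>)"
proof -
  let ?\<chi> = "\<lambda>T. abs_L2 (\<lambda>x::real^'n. if x \<in> T then 1 else (0::real))"
  have si: "square_integrable (\<lambda>x. if x \<in> T then 1 else (0::real))" if "T \<in> \<T>" for T
    by (rule square_integrable_on_compact[OF mesh_element(3)[OF that]]) simp
  have \<chi>: "?\<chi> T \<in> L2_on (\<Union>\<T>)" if "T \<in> \<T>" for T
    unfolding L2_on_def mem_Collect_eq using rep_abs_L2[OF si[OF that]] by eventually_elim (use that in auto)
  have piece: "AE x in lebesgue. x \<in> T' \<longrightarrow> rep_L2 (?\<chi> T) x = (if T = T' then 1 else 0)" if T: "T \<in> \<T>" "T' \<in> \<T>" for T T'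
  proof (cases "T = T'")
    case True
    then show ?thesis using rep_abs_L2[OF si[OF T(1)]] by auto
  next
    case False
    then have "T \<inter> T' \<in> null_sets lebesgue"
      using mesh_Int_negligible[OF T] by (simp add: negligible_iff_null_sets)
    then have "AE x in lebesgue. x \<notin> T \<inter> T'" by (rule AE_not_in)
    with rep_abs_L2[OF si[OF T(1)]] show ?thesis by eventually_elim (use False in auto)
  qed
  have isp: "is_piece (?\<chi> T) T' (\<lambda>_. if T = T' then 1 else 0)" if "T \<in> \<T>" "T' \<in> \<T>" for T T'
    unfolding is_piece_def using piece[OF that] polys_const[of "if T = T' then 1 else 0" 0] by blast
  show ?thesis
  proof
    show "span (?\<chi> ` \<T>) \<subseteq> pw_polys \<T> 0"
    proof (rule span_minimal[OF _ subspace_pw_polys], clarify)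
      fix T assume T: "T \<in> \<T>"
      have "\<exists>p\<in>polys 0. AE x in lebesgue. x \<in> T' \<longrightarrow> rep_L2 (?\<chi> T) x = p x" if "T' \<in> \<T>" for T'
        using piece[OF T that] by (intro bexI[of _ "\<lambda>_. if T = T' then 1 else 0"] polys_const)
      then show "?\<chi> T \<in> pw_polys \<T> 0" using \<chi>[OF T] by (simp add: pw_polys_def)
    qed
    show "pw_polys \<T> 0 \<subseteq> span (?\<chi> ` \<T>)"
    proof
      fix v assume v: "v \<in> pw_polys \<T> 0"
      have const: "\<exists>c. p = (\<lambda>_. c)" if "p \<in> polys 0" for p :: "real^'n \<Rightarrow> real"
        using that by (auto simp: polys_def)
      have "\<exists>c. is_piece v T (\<lambda>_. c)" if T: "T \<in> \<T>" for T
      proof -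
        obtain p where "p \<in> polys 0" "AE x in lebesgue. x \<in> T \<longrightarrow> rep_L2 v x = p x"
          using v T unfolding pw_polys_def by blast
        then show ?thesis using const[of p] unfolding is_piece_def by blast
      qed
      then obtain c where c: "\<And>T. T \<in> \<T> \<Longrightarrow> is_piece v T (\<lambda>_. c T)" by metis
      define w where "w = (\<Sum>T\<in>\<T>. c T *\<^sub>R ?\<chi> T)"
      have wp: "is_piece (\<Sum>T\<in>I. c T *\<^sub>R ?\<chi> T) T' (\<lambda>_. \<Sum>T\<in>I. c T * (if T = T' then 1 else 0))"
        if "I \<subseteq> \<T>" "T' \<in> \<T>" "finite I" for I T'
        using that(3,1)
      proof (induction I)
        case empty
        show ?case using is_piece_scaleR[OF c[OF that(2)], of 0] by simp
      next
        case (insert T I)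
        then have "is_piece (\<Sum>T\<in>I. c T *\<^sub>R ?\<chi> T) T' (\<lambda>_. \<Sum>T\<in>I. c T * (if T = T' then 1 else 0))" by simp
        moreover have "is_piece (c T *\<^sub>R ?\<chi> T) T' (\<lambda>_. c T * (if T = T' then 1 else 0))"
          using insert.prems that(2) by (intro is_piece_scaleR isp) auto
        ultimately show ?case
          unfolding sum.insert[OF insert.hyps] by (rule is_piece_add[rotated])
      qed
      have "v + (-1) *\<^sub>R w = 0"
      proof (rule zero_if_pieces_zero)
        have "w \<in> L2_on (\<Union>\<T>)" unfolding w_def by (intro subspace_sum subspace_scale L2_on_subspace \<chi>)
        then show "v + (-1) *\<^sub>R w \<in> L2_on (\<Union>\<T>)"
          using v by (intro subspace_add subspace_scale L2_on_subspace) (simp_all add: pw_polys_def)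
        fix T' assume T': "T' \<in> \<T>"
        have "(\<Sum>T\<in>\<T>. c T * (if T = T' then 1 else 0)) = c T'"
          using T' finite_mesh by (simp add: if_distrib[of "\<lambda>x. _ * x"] cong: if_cong)
        then show "is_piece (v + (-1) *\<^sub>R w) T' (\<lambda>_. 0)"
          using is_piece_add[OF c[OF T'] is_piece_scaleR[OF wp[OF subset_refl T' finite_mesh], of "-1"]] by (simp add: w_def)
      qed
      then have "v = w" by simp
      also have "w \<in> span (?\<chi> ` \<T>)" unfolding w_def by (intro span_sum span_scale span_base imageI)
      finally show "v \<in> span (?\<chi> ` \<T>)" .
    qed
  qed
qed

lemma Pi0_properties: "linear (Pi0 \<T>)" "norm (Pi0 \<T> v) \<le> norm v"
  unfolding Pi0_def pw_constants_span using finite_mesh by (auto intro: L2_proj_finite_span)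

text \<open>What the lower bound uses of the four schemes; the contraction property of
  \<open>Q\<close> is what allows them to be treated alike.\<close>

lemma scheme_properties:
  assumes "(Vh, P, Q) \<in> schemes \<Omega> \<T>"
  shows "subspace Vh" "Vh \<subseteq> eCR \<Omega> \<T>" "linear P" "linear Q" "norm (Q v) \<le> norm v"
  using assms CR_subset_eCR subspace_CR subspace_eCR Pi0_properties linear_id
  by (auto simp: schemes_def)

end


section \<open>The lower bound\<close>

text \<open>The family could repeat a vector; coefficients 1 and -1 at two equal members would
  violate the hypothesis, so the image has as many elements as the index set.\<close>

lemma independent_family_image:
  assumes "finite I" "\<And>c i. (\<Sum>i\<in>I. c i *\<^sub>R f i) = 0 \<Longrightarrow> i \<in> I \<Longrightarrow> c i = (0::real)"
  shows "inj_on f I" "independent (f ` I)"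
proof -
  show inj: "inj_on f I"
  proof (rule inj_onI, rule ccontr)
    fix i j assume ij: "i \<in> I" "j \<in> I" "f i = f j" "i \<noteq> j"
    have "(\<Sum>l\<in>I. (if l = i then 1 else if l = j then - 1 else 0) *\<^sub>R f l) =
      (\<Sum>l\<in>I. (if l = i then f i else 0) - (if l = j then f j else 0))"
      using ij(4) by (intro sum.cong) auto
    also have "\<dots> = f i - f j" using assms(1) ij(1,2) by (simp add: sum_subtractf)
    finally have "(\<Sum>l\<in>I. (if l = i then 1 else if l = j then - 1 else 0) *\<^sub>R f l) = 0" using ij(3) by simp
    from assms(2)[OF this ij(1)] show False by simp
  qed
  show "independent (f ` I)"
  proof
    assume "dependent (f ` I)"
    then obtain u v where u: "v \<in> f ` I" "u v \<noteq> 0" "(\<Sum>v\<in>f ` I. u v *\<^sub>R v) = 0"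
      using dependent_finite[of "f ` I"] assms(1) by auto
    then have "(\<Sum>i\<in>I. u (f i) *\<^sub>R f i) = 0" by (simp add: sum.reindex[OF inj])
    then show False using assms(2)[of "\<lambda>i. u (f i)"] u(1,2) by blast
  qed
qed

lemma card_le_dim_span:
  assumes "finite S" "independent B" "B \<subseteq> span S"
  shows "card B \<le> dim (span S)"
proof -
  obtain b where b: "b \<subseteq> span S" "independent b" "span S \<subseteq> span b" "card b = dim (span S)"
    using basis_exists[of "span S"] by blast
  have "finite b" using independent_span_bound[OF assms(1) b(2,1)] by simp
  then show ?thesis using independent_span_bound[OF _ assms(2), of b] assms(3) b(3,4) by auto
qed

theorem theorem6p5:
  fixes \<Omega> :: "(real^'n) set" and V :: "real^'n \<Rightarrow> real" and \<T> :: "(real^'n) set set"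
    and Vh :: "(real^'n) L2 set" and P Q A :: "(real^'n) L2 \<Rightarrow> (real^'n) L2"
    and lam lamh :: "nat \<Rightarrow> real" and u :: "nat \<Rightarrow> (real^'n) L2"
    and N K k m :: nat
  assumes "CARD('n) \<ge> 2"
    and "lipschitz_domain \<Omega>" and "polyhedral \<Omega>" and "bounded \<Omega>"
    and "V \<in> Linfty_on \<Omega>" and "essinf_on \<Omega> V = 0"
    and "enumerates_eigenvalues {1..} lam (exact_eigenspace \<Omega> V)"
    and "regular_triangulation \<Omega> \<T>"
    and "(Vh, P, Q) \<in> schemes \<Omega> \<T>"
    and "enumerates_eigenvalues {1..N} lamh (discrete_eigenspace \<Omega> V \<T> Vh P Q)"
    and "K \<le> N"
    and "\<And>j. j \<in> {1..K} \<Longrightarrow> u j \<in> discrete_eigenspace \<Omega> V \<T> Vh P Q (lamh j) \<and> norm (u j) = 1"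
    and "\<And>i j. i \<in> {1..K} \<Longrightarrow> j \<in> {1..K} \<Longrightarrow> i \<noteq> j \<Longrightarrow> Q (u i) \<bullet> Q (u j) = 0"
    and "\<And>v. v \<in> Vh \<Longrightarrow> A v \<in> S0 \<Omega> \<T> m"
    and "\<And>v w. v \<in> Vh \<Longrightarrow> w \<in> Vh \<Longrightarrow> A (v + w) = A v + A w"
    and "\<And>c v. v \<in> Vh \<Longrightarrow> A (c *\<^sub>R v) = c *\<^sub>R A v"
    and "1 \<le> k" and "k \<le> K"
    and "(SUP v\<in>span (u ` {1..k}) - {0}. ereal (norm (v - A v) / sqrt (a_pw \<T> v v)))
           < ereal (lamh k powr (-1/2))"
  shows "dim (span ((\<lambda>j. A (u j)) ` {1..K})) \<ge> k \<and>
    (\<exists>\<mu>. is_min_max (rayleigh \<Omega> V) (span ((\<lambda>j. A (u j)) ` {1..K})) k \<mu> \<and> \<mu> \<ge> lam k)"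
proof -
  note A_mem = assms(14) and A_add = assms(15) and A_scale = assms(16) and k = assms(17,18) and alpha = assms(19)
  interpret mesh \<Omega> \<T> using assms(1,2,4,8) by unfold_locales
  have op: "open \<Omega>" using assms(2) by (simp add: lipschitz_domain_def)
  note sch = scheme_properties[OF assms(9)]
  obtain M where Vf: "sym_form UNIV (V_form \<Omega> V)" "\<And>v. 0 \<le> V_form \<Omega> V v v"
    using V_form_properties[OF op assms(5,6)] by blast
  interpret Vf: sym_form UNIV "V_form \<Omega> V" by (rule Vf(1))
  interpret a: sym_form Vh "a_pw \<T>"
    using sym_form.subform[OF sym_form_a_pw_mesh sch(1)] sch(2) eCR_subset by blast
  define D where "D v w = a_pw \<T> v w + V_form \<Omega> V (P v) (P w)" for v w
  interpret D: sym_form Vh D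
  proof
    fix x y z c assume x: "x \<in> Vh" and z: "z \<in> Vh"
    show "D (c *\<^sub>R x) z = c * D x z"
      by (simp add: D_def a.scale_left[OF x z] linear_cmul[OF sch(3)] Vf.scale_left distrib_left)
    show "D x z = D z x" unfolding D_def using a.sym[OF x z] Vf.sym[of "P x" "P z"] by simp
    assume y: "y \<in> Vh"
    show "D (x + y) z = D x z + D y z"
      by (simp add: D_def a.add_left[OF x y z] linear_add[OF sch(3)] Vf.add_left)
  qed (rule sch(1))
  have a_le_D: "a_pw \<T> v v \<le> D v v" for v using Vf(2)[of "P v"] by (simp add: D_def)
  have a_pos: "0 < a_pw \<T> v v" if v: "v \<in> Vh" "v \<noteq> 0" for v
    using a_pw_definite[of v] a_pw_nonneg[of \<T> v] sch(2) v by force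
  have u: "u j \<in> Vh" "\<And>w. w \<in> Vh \<Longrightarrow> D (u j) w = lamh j * (Q (u j) \<bullet> Q w)" "u j \<noteq> 0" if "j \<in> {1..K}" for j
    using assms(12)[OF that] by (auto simp: discrete_eigenspace_def D_def)
  have lamh: "0 < lamh j" "lamh j \<le> lamh k" if "j \<in> {1..k}" for j
  proof -
    have "mono_on {1..N} lamh" "\<forall>i\<in>{1..N}. 0 < lamh i"
      using assms(10) by (auto simp: enumerates_eigenvalues_def)
    moreover have "j \<in> {1..N}" "k \<in> {1..N}" "j \<le> k" using that k assms(11) by auto
    ultimately show "0 < lamh j" "lamh j \<le> lamh k" by (auto intro: mono_onD)
  qed
  have uk: "j \<in> {1..K}" if "j \<in> {1..k}" for j using that k by auto
  have lincomb: "(\<Sum>j\<in>J. c j *\<^sub>R u j) \<in> Vh" if "J \<subseteq> {1..K}" for c J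
    using that u(1) by (intro subspace_sum subspace_scale sch(1)) auto
  have Q_lincomb: "Q (u i) \<bullet> Q (\<Sum>j\<in>{1..k}. c j *\<^sub>R u j) = c i * (norm (Q (u i)))\<^sup>2" if i: "i \<in> {1..k}" for c i
  proof -
    have "Q (u i) \<bullet> Q (\<Sum>j\<in>{1..k}. c j *\<^sub>R u j) = (\<Sum>j\<in>{1..k}. c j * (Q (u i) \<bullet> Q (u j)))"
      by (simp add: linear_sum[OF sch(4)] linear_cmul[OF sch(4)] inner_sum_right)
    also have "\<dots> = (\<Sum>j\<in>{1..k}. if j = i then c i * (norm (Q (u i)))\<^sup>2 else 0)"
      using assms(13)[OF uk[OF i] uk] by (intro sum.cong refl) (auto simp: power2_norm_eq_inner)
    also have "\<dots> = c i * (norm (Q (u i)))\<^sup>2" using i by simp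
    finally show ?thesis .
  qed
  \<comment> \<open>The discrete equation tested with \<open>u j\<close> itself: its left-hand side
    is positive by definiteness of \<open>a_pw\<close>, so \<open>Q\<close> cannot annihilate
    \<open>u j\<close>.\<close>
  have Qu: "0 < (norm (Q (u j)))\<^sup>2" if j: "j \<in> {1..k}" for j
  proof -
    have "0 < D (u j) (u j)" using a_pos[OF u(1,3)[OF uk[OF j]]] a_le_D[of "u j"] by linarith
    then show ?thesis
      using u(2)[OF uk[OF j] u(1)[OF uk[OF j]]] lamh(1)[OF j] by (simp add: zero_less_mult_iff power2_norm_eq_inner)
  qed
  have coeff_zero: "c i = 0" if "(\<Sum>j\<in>{1..k}. c j *\<^sub>R u j) = 0" "i \<in> {1..k}" for c i
    using Q_lincomb[OF that(2), of c] Qu[OF that(2)] that(1) linear_0[OF sch(4)] by simp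
  have D_le: "D v v \<le> lamh k * (norm v)\<^sup>2" if v: "v = (\<Sum>j\<in>{1..k}. c j *\<^sub>R u j)" for v c
  proof -
    have vV: "v \<in> Vh" unfolding v using k by (intro lincomb) auto
    have "D v v = (\<Sum>j\<in>{1..k}. c j * D (u j) v)"
      by (subst (1) v) (rule D.sum_left[OF u(1)[OF uk] vV])
    also have "\<dots> = (\<Sum>j\<in>{1..k}. lamh j * (c j * (Q (u j) \<bullet> Q v)))"
      using u(2)[OF uk vV] by (intro sum.cong) auto
    also have "\<dots> \<le> (\<Sum>j\<in>{1..k}. lamh k * (c j * (Q (u j) \<bullet> Q v)))"
    \<comment> \<open>After diagonalization each summand is a nonnegative multiple of
      \<open>lamh j\<close>, so every eigenvalue may be raised to \<open>lamh k\<close>.\<close>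
    proof (intro sum_mono mult_right_mono)
      fix j assume j: "j \<in> {1..k}"
      show "lamh j \<le> lamh k" by (rule lamh(2)[OF j])
      show "0 \<le> c j * (Q (u j) \<bullet> Q v)" unfolding v Q_lincomb[OF j] by (simp add: zero_le_mult_iff mult.assoc[symmetric])
    qed
    also have "\<dots> = lamh k * (Q (\<Sum>j\<in>{1..k}. c j *\<^sub>R u j) \<bullet> Q v)"
      by (simp add: linear_sum[OF sch(4)] linear_cmul[OF sch(4)] inner_sum_left sum_distrib_left)
    also have "\<dots> = lamh k * (norm (Q v))\<^sup>2" by (simp add: v power2_norm_eq_inner)
    also have "\<dots> \<le> lamh k * (norm v)\<^sup>2"
      using lamh(1)[of k] k sch(5)[of v] by (intro mult_left_mono power_mono) auto
    finally show ?thesis .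
  qed
  \<comment> \<open>If \<open>A v = 0\<close>, the bound on the supremum reads
    \<open>lamh k * norm v ^ 2 < a_pw v v\<close>, against
    \<open>a_pw v v <= D v v <= lamh k * norm v ^ 2\<close>.\<close>
  have A_nonzero: "A v \<noteq> 0" if v: "v = (\<Sum>j\<in>{1..k}. c j *\<^sub>R u j)" "v \<noteq> 0" for v c
  proof
    assume Av: "A v = 0"
    have vV: "v \<in> Vh" unfolding v(1) using k by (intro lincomb) auto
    have ap: "0 < a_pw \<T> v v" by (rule a_pos[OF vV v(2)])
    have lk: "0 < lamh k" using lamh(1)[of k] k by simp
    have "v \<in> span (u ` {1..k})" unfolding v(1) by (intro span_sum span_scale span_base imageI)
    then have "v \<in> span (u ` {1..k}) - {0}" using v(2) by blast
    then have "ereal (norm (v - A v) / sqrt (a_pw \<T> v v)) \<le>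
        (SUP v\<in>span (u ` {1..k}) - {0}. ereal (norm (v - A v) / sqrt (a_pw \<T> v v)))"
      by (rule SUP_upper)
    then have "ereal (norm (v - A v) / sqrt (a_pw \<T> v v)) < ereal (lamh k powr (-1/2))"
      using alpha by (rule le_less_trans)
    then have "norm v / sqrt (a_pw \<T> v v) < 1 / sqrt (lamh k)"
      using lk by (simp add: Av powr_minus_divide powr_half_sqrt)
    then have "norm v * sqrt (lamh k) < sqrt (a_pw \<T> v v)"
      using ap lk by (simp add: field_simps)
    then have "(norm v * sqrt (lamh k))\<^sup>2 < (sqrt (a_pw \<T> v v))\<^sup>2"
      using lk by (intro power_strict_mono) auto
    then have "lamh k * (norm v)\<^sup>2 < a_pw \<T> v v"
      using ap lk by (simp add: power_mult_distrib mult.commute)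
    then show False using a_le_D[of v] D_le[OF v(1)] by linarith
  qed
  have A_lincomb: "A (\<Sum>j\<in>{1..k}. c j *\<^sub>R u j) = (\<Sum>j\<in>{1..k}. c j *\<^sub>R A (u j))" for c
  proof -
    have A0: "A 0 = 0" using A_scale[OF subspace_0[OF sch(1)], of 0] by simp
    \<comment> \<open>\<open>A\<close> is linear on \<open>Vh\<close> only, so the induction must
      keep every partial sum in \<open>Vh\<close>.\<close>
    have "A (\<Sum>j\<in>J. c j *\<^sub>R u j) = (\<Sum>j\<in>J. c j *\<^sub>R A (u j))" if "finite J" "J \<subseteq> {1..K}" for J
      using that
    proof (induction J)
      case (insert i J)
      have "c i *\<^sub>R u i \<in> Vh" using insert.prems u(1) sch(1) by (auto intro: subspace_scale)
      moreover have "(\<Sum>j\<in>J. c j *\<^sub>R u j) \<in> Vh" using insert.prems by (intro lincomb) auto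
      ultimately show ?case
        using insert A_scale[OF u(1)[of i]] by (simp add: A_add)
    qed (simp add: A0)
    from this[of "{1..k}"] show ?thesis using k by auto
  qed
  define S where "S = (\<lambda>j. A (u j)) ` {1..K}"
  have finS: "finite S" by (simp add: S_def)
  have ind: "inj_on (\<lambda>j. A (u j)) {1..k}" "independent ((\<lambda>j. A (u j)) ` {1..k})"
  proof -
    have *: "c i = 0" if "(\<Sum>j\<in>{1..k}. c j *\<^sub>R A (u j)) = 0" "i \<in> {1..k}" for c i
    proof -
      have "(\<Sum>j\<in>{1..k}. c j *\<^sub>R u j) = 0"
        using A_nonzero[OF refl, of c] that(1) A_lincomb[of c] by auto
      then show ?thesis using coeff_zero that(2) by blast
    qed
    show "inj_on (\<lambda>j. A (u j)) {1..k}" "independent ((\<lambda>j. A (u j)) ` {1..k})"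
      using independent_family_image[of "{1..k}" "\<lambda>j. A (u j)"] * by (metis finite_atLeastAtMost)+
  qed
  have "(\<lambda>j. A (u j)) ` {1..k} \<subseteq> S" unfolding S_def using k by (intro image_mono) auto
  then have "(\<lambda>j. A (u j)) ` {1..k} \<subseteq> span S" using span_superset by blast
  then have "card ((\<lambda>j. A (u j)) ` {1..k}) \<le> dim (span S)" by (rule card_le_dim_span[OF finS ind(2)])
  then have dim: "k \<le> dim (span S)" unfolding card_image[OF ind(1)] card_atLeastAtMost by (simp only: diff_Suc_1)
  have SH: "span S \<subseteq> H10 \<Omega>"
  proof (rule span_minimal[OF _ subspace_H10[OF op]])
    show "S \<subseteq> H10 \<Omega>" using A_mem u(1) by (auto simp: S_def S0_def)
  qed
  have "sym_form (span S) (energy \<Omega> V)"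
    by (rule sym_form.subform[OF sym_form_energy[OF op Vf(1)] subspace_span SH])
  then obtain W \<mu> where W: "is_min_max (rayleigh \<Omega> V) (span S) k \<mu>" "subspace W" "W \<subseteq> span S" "dim W = k"
    "\<And>w. w \<in> W - {0} \<Longrightarrow> rayleigh \<Omega> V w \<le> \<mu>"
  proof (rule min_max_exists[OF finS _ k(1) dim])
    show "rayleigh \<Omega> V v = energy \<Omega> V v v / (v \<bullet> v)" for v by (simp add: rayleigh_def energy_def)
  qed blast
  \<comment> \<open>The bound is applied on the optimal subspace \<open>W\<close>, a
    \<open>k\<close>-dimensional subspace of \<open>H10\<close>, where no quotient exceeds the
    min-max value.\<close>
  obtain w where "w \<in> W - {0}" "lam k \<le> rayleigh \<Omega> V w"
    using min_max_lower_bound[OF op assms(4,5,6,7) k(1) W(2) _ W(4)] W(3) SH by blast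
  then have "lam k \<le> \<mu>" using W(5) order_trans by blast
  then show ?thesis using dim W(1) by (auto simp: S_def)
qed

end
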